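(* Let $0<\alpha<\frac{n+1}{2}$ and let $\mathbf{W}_\alpha=\{\mathbf{W}_\alpha(\varphi);\varphi\in L^2(\mathbb{R}_+;\mathcal{W}^{-\alpha,2})\}$ be the centered Gaussian family with covariance $$\mathbf{E}\left(\mathbf{W}_\alpha(\varphi)\mathbf{W}_\alpha(\psi)\right)=\int_{\mathbb{R}_+}\int_{\mathbf{H}^n}\big[(-\Delta)^{-\alpha}\varphi\big](t,q)\big[(-\Delta)^{-\alpha}\psi\big](t,q)\,d\mu(q)\,dt.$$ Then for any $\lambda>0$, $$\{\mathbf{W}_\alpha(\varphi\circ\delta_\lambda),\ \varphi\in L^2(\mathbb{R}_+;\mathcal{W}^{-\alpha,2})\}\stackrel{\mathcal{D}}{=}\{\lambda^{-(n+1+2\alpha)}\,\mathbf{W}_\alpha(\varphi),\ \varphi\in L^2(\mathbb{R}_+;\mathcal{W}^{-\alpha,2})\}.$$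
   Context: Let $n\ge1$. The Heisenberg group $\mathbf{H}^n$ is $\mathbb{R}^n\times\mathbb{R}^n\times\mathbb{R}$ with product $(x,y,z)\star(x',y',z')=(x+x',y+y',z+z'+2\sum_{i=1}^n(x_i'y_i-x_iy_i'))$; $\mu$ is Lebesgue measure on $\mathbb{R}^{2n+1}$. Let $X_i=\partial_{x_i}+2y_i\partial_z$, $Y_i=\partial_{y_i}-2x_i\partial_z$ and $\Delta=\sum_{i=1}^n(X_i^2+Y_i^2)$, essentially self-adjoint on $C_0^\infty(\mathbb{R}^{2n+1})\subset L^2(\mathbf{H}^n,\mu)$; $\Delta$ also denotes its self-adjoint extension, and $(-\Delta)^{-\alpha}$ is defined by the spectral theorem, with domain $\mathcal{W}^{-\alpha,2}\subset L^2(\mathbf{H}^n,\mu)$. $L^2(\mathbb{R}_+;\mathcal{W}^{-\alpha,2})$ is the space of measurable $\varphi$ on $\mathbb{R}_+\times\mathbf{H}^n$ with $\varphi(t,\cdot)\in\mathcal{W}^{-\alpha,2}$ for a.e. $t$ and $\int_{\mathbb{R}_+}\|(-\Delta)^{-\alpha}\varphi(t,\cdot)\|_{L^2(\mu)}^2dt<\infty$. The dilation is $\delta_\lambda(x,y,z)=(\lambda x,\lambda y,\lambda^2z)$ and $(\varphi\circ\delta_\lambda)(t,q)=\varphi(t,\delta_\lambda q)$. $\stackrel{\mathcal{D}}{=}$ denotes equality in law of the two families. *)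

theory Defs
  imports "HOL-Probability.Probability"
begin

section \<open>Real L2 spaces and unbounded operators\<close>

text \<open>Elements of the L2 space are represented by functions, and equality in L2 is equality almost
  everywhere.  A (possibly unbounded) operator is represented by its graph, a set of pairs of
  functions.  The graphs built below are saturated with respect to almost-everywhere equality in both
  components, except for the graph on test functions, which is only used through its closure.\<close>

definition L2 :: "'a measure \<Rightarrow> ('a \<Rightarrow> real) set" where
  "L2 M = {f \<in> borel_measurable M. integrable M (\<lambda>x. (f x)\<^sup>2)}"

definition l2_inner :: "'a measure \<Rightarrow> ('a \<Rightarrow> real) \<Rightarrow> ('a \<Rightarrow> real) \<Rightarrow> real" where
  "l2_inner M f g = (\<integral>x. f x * g x \<partial>M)"

definition l2_norm :: "'a measure \<Rightarrow> ('a \<Rightarrow> real) \<Rightarrow> real" where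
  "l2_norm M f = sqrt (l2_inner M f f)"

type_synonym 'a graph = "(('a \<Rightarrow> real) \<times> ('a \<Rightarrow> real)) set"

definition op_closure :: "'a measure \<Rightarrow> 'a graph \<Rightarrow> 'a graph" where
  "op_closure M A = {(f, g). f \<in> L2 M \<and> g \<in> L2 M \<and>
     (\<exists>u v. (\<forall>k::nat. (u k, v k) \<in> A) \<and>
        (\<lambda>k. l2_norm M (\<lambda>x. u k x - f x)) \<longlonglongrightarrow> 0 \<and>
        (\<lambda>k. l2_norm M (\<lambda>x. v k x - g x)) \<longlonglongrightarrow> 0)}"

definition op_uminus :: "'a graph \<Rightarrow> 'a graph" where
  "op_uminus A = {(f, \<lambda>x. - g x) |f g. (f, g) \<in> A}"


section \<open>Spectral measures and functional calculus\<close>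

definition orthogonal_projection ::
    "'a measure \<Rightarrow> (('a \<Rightarrow> real) \<Rightarrow> ('a \<Rightarrow> real)) \<Rightarrow> bool" where
  "orthogonal_projection M P \<longleftrightarrow>
     (\<forall>f\<in>L2 M. P f \<in> L2 M) \<and>
     (\<forall>f\<in>L2 M. \<forall>g\<in>L2 M. \<forall>a b. AE x in M. P (\<lambda>y. a * f y + b * g y) x = a * P f x + b * P g x) \<and>
     (\<forall>f\<in>L2 M. AE x in M. P (P f) x = P f x) \<and>
     (\<forall>f\<in>L2 M. \<forall>g\<in>L2 M. l2_inner M (P f) g = l2_inner M f (P g))"

definition projection_valued_measure ::
    "'a measure \<Rightarrow> (real set \<Rightarrow> ('a \<Rightarrow> real) \<Rightarrow> ('a \<Rightarrow> real)) \<Rightarrow> bool" where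
  "projection_valued_measure M E \<longleftrightarrow>
     (\<forall>B\<in>sets borel. orthogonal_projection M (E B)) \<and>
     (\<forall>f\<in>L2 M. AE x in M. E UNIV f x = f x) \<and>
     (\<forall>B\<in>sets borel. \<forall>C\<in>sets borel. \<forall>f\<in>L2 M. AE x in M. E (B \<inter> C) f x = E B (E C f) x) \<and>
     (\<forall>D::nat \<Rightarrow> real set. range D \<subseteq> sets borel \<longrightarrow> disjoint_family D \<longrightarrow>
        (\<forall>f\<in>L2 M. (\<lambda>N. l2_norm M (\<lambda>x. E (\<Union>i. D i) f x - (\<Sum>i<N. E (D i) f x))) \<longlonglongrightarrow> 0))"

definition scalar_spectral_measure ::
    "'a measure \<Rightarrow> (real set \<Rightarrow> ('a \<Rightarrow> real) \<Rightarrow> ('a \<Rightarrow> real)) \<Rightarrow> ('a \<Rightarrow> real) \<Rightarrow> real measure" where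
  "scalar_spectral_measure M E f =
     measure_of UNIV (sets borel) (\<lambda>B. ennreal (l2_inner M (E B f) f))"

text \<open>The graph of the operator \<open>\<integral> h dE\<close>.  Its domain consists of the \<open>f\<close> with
  \<open>\<integral> h\<^sup>2 d\<langle>E f, f\<rangle> < \<infinity>\<close>, and its value \<open>g\<close> satisfies \<open>\<langle>g, k\<rangle> = \<integral> h d\<langle>E f, k\<rangle>\<close> for all \<open>k\<close> in the
  domain, which is a dense subspace, so that \<open>g\<close> is determined.  The signed measure \<open>\<langle>E f, k\<rangle>\<close> is
  expressed by polarization.\<close>

definition spectral_integral ::
    "'a measure \<Rightarrow> (real set \<Rightarrow> ('a \<Rightarrow> real) \<Rightarrow> ('a \<Rightarrow> real)) \<Rightarrow> (real \<Rightarrow> real) \<Rightarrow> 'a graph" where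
  "spectral_integral M E h =
     (let D = {f \<in> L2 M. integrable (scalar_spectral_measure M E f) (\<lambda>s. (h s)\<^sup>2)}
      in {(f, g). f \<in> D \<and> g \<in> L2 M \<and>
            (\<forall>k\<in>D. l2_inner M g k =
               ((\<integral>s. h s \<partial>scalar_spectral_measure M E (\<lambda>x. f x + k x)) -
                (\<integral>s. h s \<partial>scalar_spectral_measure M E (\<lambda>x. f x - k x))) / 4)})"

definition spectral_resolution ::
    "'a measure \<Rightarrow> 'a graph \<Rightarrow> (real set \<Rightarrow> ('a \<Rightarrow> real) \<Rightarrow> ('a \<Rightarrow> real)) \<Rightarrow> bool" where
  "spectral_resolution M A E \<longleftrightarrow>
     projection_valued_measure M E \<and> A = spectral_integral M E (\<lambda>s. s)"

text \<open>By the spectral theorem a self-adjoint \<open>A\<close> has a spectral resolution, which is unique up to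
  almost-everywhere equality of the values \<open>E B f\<close>.\<close>

definition functional_calculus :: "'a measure \<Rightarrow> 'a graph \<Rightarrow> (real \<Rightarrow> real) \<Rightarrow> 'a graph" where
  "functional_calculus M A h =
     {(f, g). \<exists>E. spectral_resolution M A E \<and> (f, g) \<in> spectral_integral M E h}"

text \<open>Powers of a nonnegative self-adjoint operator that is injective if \<open>a < 0\<close>.  In that case \<open>E\<close>
  does not charge the negative half-line, nor (if \<open>a < 0\<close>) the point \<open>0\<close>, so the value chosen there
  is immaterial.\<close>

definition op_powr :: "'a measure \<Rightarrow> 'a graph \<Rightarrow> real \<Rightarrow> 'a graph" where
  "op_powr M A a = functional_calculus M A (\<lambda>s. if 0 < s then s powr a else 0)"


section \<open>The Heisenberg group and its sub-Laplacian\<close>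

type_synonym 'n heis = "(real ^ 'n) \<times> (real ^ 'n) \<times> real"

definition heis_mult :: "'n::finite heis \<Rightarrow> 'n heis \<Rightarrow> 'n heis"  (infixl \<open>\<star>\<close> 70) where
  "p \<star> p' = (case p of (x, y, z) \<Rightarrow> case p' of (x', y', z') \<Rightarrow>
     (x + x', y + y', z + z' + 2 * (\<Sum>i\<in>UNIV. x' $ i * y $ i - x $ i * y' $ i)))"

definition heis_dilation :: "real \<Rightarrow> 'n::finite heis \<Rightarrow> 'n heis"  (\<open>\<delta>\<close>) where
  "\<delta> r p = (case p of (x, y, z) \<Rightarrow> (r *\<^sub>R x, r *\<^sub>R y, r\<^sup>2 * z))"

lemma heis_dilation_mult: "\<delta> r (p \<star> p') = \<delta> r p \<star> \<delta> r p'"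
  by (cases p; cases p')
     (simp add: heis_dilation_def heis_mult_def algebra_simps power2_eq_square sum_distrib_left)

definition directional_deriv ::
    "'a::euclidean_space \<Rightarrow> ('a \<Rightarrow> real) \<Rightarrow> ('a \<Rightarrow> real)" where
  "directional_deriv v f = (\<lambda>p. frechet_derivative f (at p) v)"

primrec C_k :: "nat \<Rightarrow> ('a::euclidean_space \<Rightarrow> real) \<Rightarrow> bool" where
  "C_k 0 f \<longleftrightarrow> continuous_on UNIV f"
| "C_k (Suc k) f \<longleftrightarrow> (\<forall>p. f differentiable (at p)) \<and> (\<forall>v. C_k k (directional_deriv v f))"

definition test_functions :: "('a::euclidean_space \<Rightarrow> real) set" where
  "test_functions = {f. (\<forall>k. C_k k f) \<and> (\<exists>K. compact K \<and> (\<forall>p. p \<notin> K \<longrightarrow> f p = 0))}"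

definition heis_X :: "'n::finite \<Rightarrow> ('n heis \<Rightarrow> real) \<Rightarrow> ('n heis \<Rightarrow> real)" where
  "heis_X i f = (\<lambda>(x, y, z). directional_deriv (axis i 1, 0, 0) f (x, y, z)
                   + 2 * y $ i * directional_deriv (0, 0, 1) f (x, y, z))"

definition heis_Y :: "'n::finite \<Rightarrow> ('n heis \<Rightarrow> real) \<Rightarrow> ('n heis \<Rightarrow> real)" where
  "heis_Y i f = (\<lambda>(x, y, z). directional_deriv (0, axis i 1, 0) f (x, y, z)
                   - 2 * x $ i * directional_deriv (0, 0, 1) f (x, y, z))"

definition sublaplacian :: "('n::finite heis \<Rightarrow> real) \<Rightarrow> ('n heis \<Rightarrow> real)" where
  "sublaplacian f = (\<lambda>p. \<Sum>i\<in>UNIV. heis_X i (heis_X i f) p + heis_Y i (heis_Y i f) p)"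

text \<open>The operator on test functions is essentially self-adjoint, that is, its closure is
  self-adjoint and is its only self-adjoint extension.\<close>

definition sublaplacian_op :: "'n::finite heis graph" where
  "sublaplacian_op = op_closure lebesgue {(f, sublaplacian f) |f. f \<in> test_functions}"

definition neg_power_graph :: "real \<Rightarrow> 'n::finite heis graph" where
  "neg_power_graph \<alpha> = op_powr lebesgue (op_uminus sublaplacian_op) (- \<alpha>)"

definition sobolev_neg :: "real \<Rightarrow> ('n::finite heis \<Rightarrow> real) set" where
  "sobolev_neg \<alpha> = Domain (neg_power_graph \<alpha>)"

text \<open>A representative of the almost-everywhere class; meaningful for arguments in
  \<open>sobolev_neg \<alpha>\<close> only.\<close>

definition neg_power :: "real \<Rightarrow> ('n::finite heis \<Rightarrow> real) \<Rightarrow> ('n heis \<Rightarrow> real)" where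
  "neg_power \<alpha> f = (SOME g. (f, g) \<in> neg_power_graph \<alpha>)"

text \<open>Functions on \<open>\<real>\<^sub>+ \<times> H\<close> are total functions whose values at negative times are disregarded.\<close>

definition L2_sobolev_neg :: "real \<Rightarrow> (real \<times> 'n::finite heis \<Rightarrow> real) set" where
  "L2_sobolev_neg \<alpha> =
     {\<phi> \<in> borel_measurable (lebesgue_on ({0..} \<times> UNIV)).
        (AE t in lebesgue_on {0..}. (\<lambda>q. \<phi> (t, q)) \<in> sobolev_neg \<alpha>) \<and>
        (\<integral>\<^sup>+t. ennreal ((l2_norm lebesgue (neg_power \<alpha> (\<lambda>q. \<phi> (t, q))))\<^sup>2) \<partial>lebesgue_on {0..}) < \<infinity>}"

definition noise_covariance ::
    "real \<Rightarrow> (real \<times> 'n::finite heis \<Rightarrow> real) \<Rightarrow> (real \<times> 'n heis \<Rightarrow> real) \<Rightarrow> real" where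
  "noise_covariance \<alpha> \<phi> \<psi> =
     (\<integral>t. (\<integral>q. neg_power \<alpha> (\<lambda>q'. \<phi> (t, q')) q * neg_power \<alpha> (\<lambda>q'. \<psi> (t, q')) q \<partial>lebesgue)
        \<partial>lebesgue_on {0..})"

definition dilate :: "real \<Rightarrow> (real \<times> 'n::finite heis \<Rightarrow> real) \<Rightarrow> (real \<times> 'n heis \<Rightarrow> real)" where
  "dilate r \<phi> = (\<lambda>(t, q). \<phi> (t, \<delta> r q))"


section \<open>Gaussian families and equality in law\<close>

text \<open>Degenerate laws (variance zero) are allowed.\<close>

definition centered_gaussian :: "'w measure \<Rightarrow> ('w \<Rightarrow> real) \<Rightarrow> bool" where
  "centered_gaussian P X \<longleftrightarrow> X \<in> borel_measurable P \<and>
     ((AE \<omega> in P. X \<omega> = 0) \<or> (\<exists>\<sigma>>0. distributed P lborel X (normal_density 0 \<sigma>)))"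

definition centered_gaussian_family ::
    "'w measure \<Rightarrow> 'i set \<Rightarrow> ('i \<Rightarrow> 'w \<Rightarrow> real) \<Rightarrow> bool" where
  "centered_gaussian_family P I W \<longleftrightarrow>
     (\<forall>F c. finite F \<longrightarrow> F \<subseteq> I \<longrightarrow> centered_gaussian P (\<lambda>\<omega>. \<Sum>i\<in>F. c i * W i \<omega>))"

text \<open>Both families are required to consist of random variables, since \<^const>\<open>distr\<close> is only
  meaningful for measurable maps.\<close>

definition equal_in_law ::
    "'w measure \<Rightarrow> 'i set \<Rightarrow> ('i \<Rightarrow> 'w \<Rightarrow> real) \<Rightarrow> ('i \<Rightarrow> 'w \<Rightarrow> real) \<Rightarrow> bool" where
  "equal_in_law P I X Y \<longleftrightarrow>
     (\<forall>i\<in>I. X i \<in> borel_measurable P) \<and> (\<forall>i\<in>I. Y i \<in> borel_measurable P) \<and>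
     distr P (Pi\<^sub>M I (\<lambda>_. borel)) (\<lambda>\<omega>. \<lambda>i\<in>I. X i \<omega>) =
     distr P (Pi\<^sub>M I (\<lambda>_. borel)) (\<lambda>\<omega>. \<lambda>i\<in>I. Y i \<omega>)"

end

(* Let A = -\<Delta>.  Dilating by \<delta> r turns A into r^2 A, so a spectral resolution E of A is carried to
   another one, B |-> U E(r^-2 B) U^-1 with U f = f o \<delta> r.  Spectral resolutions are unique: the range of
   E [a-N, a+N] is characterised by the growth of the powers of A - a, since A - a has norm at most N
   on it and enlarges every component of spectral distance more than N from a by more than N.  Hence
   A^-\<alpha> (f o \<delta> r) = r^(-2 \<alpha>) (A^-\<alpha> f) o \<delta> r, and as \<delta> r scales Lebesgue measure by r^(2n+2), the
   covariance is multiplied by r^(-2(n+1+2\<alpha>)).  Gaussian families with equal covariances have equal laws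
   of all linear combinations, which determine the joint law: one replaces the factors exp(i t X) by
   indicators one coordinate at a time, using the one-dimensional uniqueness theorem with the
   nonnegative weights 1, 1 + cos and 1 + sin. *)

theory Submission
  imports Defs
begin

section \<open>Real L2 spaces\<close>

text \<open>Uniqueness of resolutions is forced by the encoding. \<open>functional_calculus\<close>
  accepts every resolution \<open>E\<close>, and \<open>neg_power\<close> picks some value from the
  resulting graph, so the value picked for a dilated function and the dilate of the value picked for
  the original may stem from different resolutions. As \<open>spectral_integral\<close> sees
  \<open>E\<close> only through the measures <E B f, f>, agreement of these scalar measures is
  enough.

  To iterate A - a on the range of E [a-N, a+N], a value of A there must first be exhibited,
  although the definition only describes it by testing against other vectors. It is built by hand:
  rescale the interval into [0,1) and write s as the sum of its binary digits, s = sum of 2^-(n+1)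
  times the indicator of a set \<open>C n\<close>. Then A f is a dyadic series of projections E (C
  n) f, whose sum can be formed pointwise almost everywhere.

  A second obstacle is measurability: slices in time and elements of a graph come without it, so
  several identities are proved also for the default value 0 of a Bochner integral.\<close>

lemma L2_measurable: "f \<in> L2 M \<Longrightarrow> f \<in> borel_measurable M"
  by (simp add: L2_def)

lemma L2_square_integrable: "f \<in> L2 M \<Longrightarrow> integrable M (\<lambda>x. (f x)\<^sup>2)"
  by (simp add: L2_def)

lemma L2_mult_integrable:
  assumes "f \<in> L2 M" "g \<in> L2 M"
  shows "integrable M (\<lambda>x. f x * g x)"
proof (rule Bochner_Integration.integrable_bound)
  show "integrable M (\<lambda>x. (f x)\<^sup>2 + (g x)\<^sup>2)"
    using assms by (intro Bochner_Integration.integrable_add L2_square_integrable)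
  show "(\<lambda>x. f x * g x) \<in> borel_measurable M"
    using assms L2_measurable by (intro borel_measurable_times) auto
  show "AE x in M. norm (f x * g x) \<le> norm ((f x)\<^sup>2 + (g x)\<^sup>2)"
  proof (rule AE_I2)
    fix x
    have "2 * \<bar>f x * g x\<bar> \<le> (f x)\<^sup>2 + (g x)\<^sup>2"
      using sum_squares_bound[of "\<bar>f x\<bar>" "\<bar>g x\<bar>"] by (simp add: abs_mult)
    then show "norm (f x * g x) \<le> norm ((f x)\<^sup>2 + (g x)\<^sup>2)" by simp
  qed
qed

lemma L2_lincomb:
  assumes "f \<in> L2 M" "g \<in> L2 M"
  shows "(\<lambda>x. a * f x + b * g x) \<in> L2 M"
proof -
  have "(\<lambda>x. (a * f x + b * g x)\<^sup>2) =
      (\<lambda>x. a\<^sup>2 * (f x)\<^sup>2 + (2 * a * b) * (f x * g x) + b\<^sup>2 * (g x)\<^sup>2)"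
    by (auto simp: power2_eq_square algebra_simps)
  moreover have "(\<lambda>x. a * f x + b * g x) \<in> borel_measurable M"
    using assms[THEN L2_measurable] by measurable
  ultimately show ?thesis
    using assms by (simp add: L2_def[of M] L2_mult_integrable)
qed

lemma L2_add: "f \<in> L2 M \<Longrightarrow> g \<in> L2 M \<Longrightarrow> (\<lambda>x. f x + g x) \<in> L2 M"
  using L2_lincomb[of f M g 1 1] by simp

lemma L2_diff: "f \<in> L2 M \<Longrightarrow> g \<in> L2 M \<Longrightarrow> (\<lambda>x. f x - g x) \<in> L2 M"
  using L2_lincomb[of f M g 1 "-1"] by simp

lemma L2_cmult: "f \<in> L2 M \<Longrightarrow> (\<lambda>x. a * f x) \<in> L2 M"
  using L2_lincomb[of f M f a 0] by simp

lemma L2_zero: "(\<lambda>x. 0) \<in> L2 M"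
  by (simp add: L2_def)

lemma L2_sum: "(\<And>i. i \<in> I \<Longrightarrow> f i \<in> L2 M) \<Longrightarrow> (\<lambda>x. \<Sum>i\<in>I. f i x) \<in> L2 M"
  by (induction I rule: infinite_finite_induct) (auto intro: L2_zero L2_add)

lemma l2_inner_commute: "l2_inner M f g = l2_inner M g f"
  by (simp add: l2_inner_def mult.commute)

lemma l2_inner_lincomb_left:
  assumes "f \<in> L2 M" "g \<in> L2 M" "h \<in> L2 M"
  shows "l2_inner M (\<lambda>x. a * f x + b * g x) h = a * l2_inner M f h + b * l2_inner M g h"
proof -
  have "(\<lambda>x. (a * f x + b * g x) * h x) = (\<lambda>x. a * (f x * h x) + b * (g x * h x))"
    by (auto simp: algebra_simps)
  then show ?thesis
    using assms by (simp add: l2_inner_def L2_mult_integrable)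
qed

lemma l2_inner_add_left:
  "f \<in> L2 M \<Longrightarrow> g \<in> L2 M \<Longrightarrow> h \<in> L2 M \<Longrightarrow>
    l2_inner M (\<lambda>x. f x + g x) h = l2_inner M f h + l2_inner M g h"
  using l2_inner_lincomb_left[of f M g h 1 1] by simp

lemma l2_inner_diff_left:
  "f \<in> L2 M \<Longrightarrow> g \<in> L2 M \<Longrightarrow> h \<in> L2 M \<Longrightarrow>
    l2_inner M (\<lambda>x. f x - g x) h = l2_inner M f h - l2_inner M g h"
  using l2_inner_lincomb_left[of f M g h 1 "-1"] by simp

lemma l2_inner_cmult_left: "l2_inner M (\<lambda>x. a * f x) h = a * l2_inner M f h"
  by (simp add: l2_inner_def mult.assoc)

lemma l2_inner_cmult_right: "l2_inner M h (\<lambda>x. a * f x) = a * l2_inner M h f"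
  using l2_inner_cmult_left l2_inner_commute by metis

lemma l2_inner_diff_right:
  "f \<in> L2 M \<Longrightarrow> g \<in> L2 M \<Longrightarrow> h \<in> L2 M \<Longrightarrow>
    l2_inner M h (\<lambda>x. f x - g x) = l2_inner M h f - l2_inner M h g"
  by (simp add: l2_inner_commute[of M h] l2_inner_diff_left)

lemma l2_inner_sum_left:
  assumes "\<And>i. i \<in> I \<Longrightarrow> f i \<in> L2 M" "h \<in> L2 M"
  shows "l2_inner M (\<lambda>x. \<Sum>i\<in>I. f i x) h = (\<Sum>i\<in>I. l2_inner M (f i) h)"
  using assms(1)
  by (induction I rule: infinite_finite_induct)
    (use assms(2) in \<open>auto simp: l2_inner_add_left L2_sum\<close>, simp_all add: l2_inner_def)

lemma l2_inner_cong_AE: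
  assumes "AE x in M. f x = f' x" "f \<in> L2 M" "f' \<in> L2 M" "g \<in> L2 M"
  shows "l2_inner M f g = l2_inner M f' g"
  unfolding l2_inner_def
  using assms(1) assms(2-4)[THEN L2_measurable]
  by (intro integral_cong_AE borel_measurable_times) auto

lemma l2_inner_nonneg: "0 \<le> l2_inner M f f"
  by (simp add: l2_inner_def)

lemma l2_norm_nonneg: "0 \<le> l2_norm M f"
  by (simp add: l2_norm_def l2_inner_nonneg)

lemma l2_norm_square: "(l2_norm M f)\<^sup>2 = l2_inner M f f"
  by (simp add: l2_norm_def l2_inner_nonneg)

lemma l2_inner_self_zero_imp_AE:
  assumes "f \<in> L2 M" "l2_inner M f f = 0"
  shows "AE x in M. f x = 0"
proof -
  have "AE x in M. f x * f x = 0"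
    using assms(2) integral_nonneg_eq_0_iff_AE[OF L2_mult_integrable[OF assms(1,1)]]
    by (simp add: l2_inner_def)
  then show ?thesis by simp
qed

lemma l2_inner_Cauchy_Schwarz:
  assumes "f \<in> L2 M" "g \<in> L2 M"
  shows "\<bar>l2_inner M f g\<bar> \<le> l2_norm M f * l2_norm M g"
proof -
  let ?a = "l2_inner M f f" and ?b = "l2_inner M f g" and ?c = "l2_inner M g g"
  have pos: "0 \<le> s\<^sup>2 * ?a + 2 * s * t * ?b + t\<^sup>2 * ?c" for s t
  proof -
    let ?h = "\<lambda>x. s * f x + t * g x"
    have "l2_inner M ?h ?h = s * l2_inner M f ?h + t * l2_inner M g ?h"
      using assms by (intro l2_inner_lincomb_left L2_lincomb)
    also have "l2_inner M f ?h = s * ?a + t * ?b"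
      using l2_inner_lincomb_left[OF assms assms(1)] by (simp add: l2_inner_commute)
    also have "l2_inner M g ?h = s * ?b + t * ?c"
      using l2_inner_lincomb_left[OF assms assms(2)] by (simp add: l2_inner_commute)
    finally show ?thesis
      using l2_inner_nonneg[of M ?h] by (simp add: power2_eq_square algebra_simps)
  qed
  have "?b\<^sup>2 \<le> ?a * ?c"
  proof (cases "?c = 0")
    case True
    have "?b = 0"
    proof (rule ccontr)
      assume "?b \<noteq> 0"
      \<comment> \<open>With \<open>?c = 0\<close> the form is affine in \<open>t\<close>; this
        choice of \<open>t\<close> gives it the value -1.\<close>
      have "2 * 1 * (- (?a + 1) / (2 * ?b)) * ?b = - (?a + 1)"
        using \<open>?b \<noteq> 0\<close> by simp
      with pos[of 1 "- (?a + 1) / (2 * ?b)"] True show False by simp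
    qed
    then show ?thesis using True by simp
  next
    case False
    then have c: "0 < ?c" using l2_inner_nonneg[of M g] by linarith
    \<comment> \<open>\<open>s = ?c\<close> and \<open>t = - ?b\<close> make the form
      \<open>?c\<close> times the quantity to be bounded.\<close>
    have "0 \<le> ?c * (?a * ?c - ?b\<^sup>2)"
      using pos[of ?c "- ?b"] by (simp add: power2_eq_square algebra_simps)
    then show ?thesis using c by (simp add: zero_le_mult_iff)
  qed
  then show ?thesis
    unfolding l2_norm_def real_sqrt_mult[symmetric] by (metis real_sqrt_abs real_sqrt_le_mono)
qed

lemma l2_eqI:
  assumes "f \<in> L2 M" "g \<in> L2 M" "\<And>k. k \<in> L2 M \<Longrightarrow> l2_inner M f k = l2_inner M g k"
  shows "AE x in M. f x = g x"
proof -
  let ?d = "\<lambda>x. f x - g x"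
  have "l2_inner M ?d ?d = 0"
    using assms L2_diff[OF assms(1,2)] by (simp add: l2_inner_diff_left)
  then have "AE x in M. ?d x = 0"
    using assms by (intro l2_inner_self_zero_imp_AE L2_diff)
  then show ?thesis by simp
qed

text \<open>Pointwise almost everywhere, the series converges because the weighted sum of the squares is
  integrable; no completeness of \<open>L\<^sup>2\<close> is needed.\<close>

lemma L2_dyadic_series:
  fixes v :: "nat \<Rightarrow> 'a \<Rightarrow> real"
  assumes v: "\<And>n. v n \<in> L2 M" and bd: "\<And>n. l2_norm M (v n) \<le> C"
  obtains w where "w \<in> L2 M"
    "\<And>k. k \<in> L2 M \<Longrightarrow> (\<lambda>n. (1/2) ^ Suc n * l2_inner M (v n) k) sums l2_inner M w k"
proof -
  let ?p = "\<lambda>n. (1/2::real) ^ Suc n"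
  have p: "?p sums 1" by (rule power_half_series)
  have [measurable]: "v n \<in> borel_measurable M" for n using L2_measurable[OF v] .
  have C: "0 \<le> C" using bd[of 0] l2_norm_nonneg[of M "v 0"] by linarith
  have inner_le: "l2_inner M (v n) (v n) \<le> C\<^sup>2" for n
    using bd[of n] l2_norm_nonneg[of M "v n"] by (metis l2_norm_square power_mono)
  define q where "q x = (\<Sum>n. ennreal (?p n * (v n x)\<^sup>2))" for x
  have [measurable]: "q \<in> borel_measurable M" unfolding q_def by measurable
  have "(\<integral>\<^sup>+x. q x \<partial>M) = (\<Sum>n. \<integral>\<^sup>+x. ennreal (?p n * (v n x)\<^sup>2) \<partial>M)"
    unfolding q_def by (rule nn_integral_suminf) measurable
  also have "\<dots> = (\<Sum>n. ennreal (?p n * l2_inner M (v n) (v n)))"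
  proof (rule suminf_cong)
    fix n
    show "(\<integral>\<^sup>+x. ennreal (?p n * (v n x)\<^sup>2) \<partial>M) = ennreal (?p n * l2_inner M (v n) (v n))"
      using L2_square_integrable[OF v[of n]]
      by (subst nn_integral_eq_integral) (auto simp: l2_inner_def power2_eq_square)
  qed
  also have "\<dots> \<le> (\<Sum>n. ennreal (?p n * C\<^sup>2))"
    by (intro suminf_le allI ennreal_leI mult_left_mono inner_le) auto
  also have "\<dots> = ennreal (1 * C\<^sup>2)"
    by (rule suminf_ennreal_eq[OF _ sums_mult2[OF p]]) auto
  finally have q_int: "(\<integral>\<^sup>+x. q x \<partial>M) < \<infinity>"
    by (simp add: order.strict_trans1)
  then have "AE x in M. q x \<noteq> \<infinity>"
    by (intro nn_integral_PInf_AE) auto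
  then have summ: "AE x in M. summable (\<lambda>n. ?p n * (v n x)\<^sup>2)"
    unfolding q_def by eventually_elim (rule summable_suminf_not_top, auto)
  \<comment> \<open>The weights are summable, so |v| \<le> v^2 + 1 gives absolute convergence from
    convergence of the squares.\<close>
  have summ1: "AE x in M. summable (\<lambda>n. ?p n * \<bar>v n x\<bar>)"
    using summ
  proof eventually_elim
    fix x assume "summable (\<lambda>n. ?p n * (v n x)\<^sup>2)"
    then have "summable (\<lambda>n. ?p n * (v n x)\<^sup>2 + ?p n)"
      using sums_summable[OF p] by (rule summable_add)
    then show "summable (\<lambda>n. ?p n * \<bar>v n x\<bar>)"
    proof (rule summable_comparison_test')
      fix n :: nat assume "n \<ge> 0"
      have "2 * \<bar>v n x\<bar> \<le> (v n x)\<^sup>2 + 1"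
        using sum_squares_bound[of "\<bar>v n x\<bar>" 1] by simp
      then have "\<bar>v n x\<bar> \<le> (v n x)\<^sup>2 + 1" by linarith
      then have "?p n * \<bar>v n x\<bar> \<le> ?p n * ((v n x)\<^sup>2 + 1)"
        by (intro mult_left_mono) auto
      then show "norm (?p n * \<bar>v n x\<bar>) \<le> ?p n * (v n x)\<^sup>2 + ?p n"
        by (simp add: abs_mult distrib_left)
    qed
  qed
  define w where "w x = (\<Sum>n. ?p n * v n x)" for x
  have [measurable]: "w \<in> borel_measurable M" unfolding w_def by measurable
  have w_le: "AE x in M. (w x)\<^sup>2 \<le> (\<Sum>n. ?p n * (v n x)\<^sup>2)"
    using summ summ1
  proof eventually_elim
    fix x assume s2: "summable (\<lambda>n. ?p n * (v n x)\<^sup>2)" and s1: "summable (\<lambda>n. ?p n * \<bar>v n x\<bar>)"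
    have sv: "summable (\<lambda>n. ?p n * v n x)"
      using s1 by - (rule summable_rabs_cancel, simp add: abs_mult)
    \<comment> \<open>Cauchy-Schwarz with each weight split as \<open>sqrt (?p n)\<close> times
      itself; the weights sum to 1, so the square of an average is at most the average of the
      squares.\<close>
    have fin: "(\<Sum>n<N. ?p n * v n x)\<^sup>2 \<le> (\<Sum>n. ?p n * (v n x)\<^sup>2)" for N
    proof -
      have "(\<Sum>n<N. ?p n * v n x)\<^sup>2 = (\<Sum>n<N. sqrt (?p n) * (sqrt (?p n) * v n x))\<^sup>2"
        by (simp add: mult.assoc[symmetric])
      also have "\<dots> \<le> (\<Sum>n<N. (sqrt (?p n))\<^sup>2) * (\<Sum>n<N. (sqrt (?p n) * v n x)\<^sup>2)"
        by (rule Cauchy_Schwarz_ineq_sum)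
      also have "\<dots> = (\<Sum>n<N. ?p n) * (\<Sum>n<N. ?p n * (v n x)\<^sup>2)"
        by (simp add: power_mult_distrib)
      also have "\<dots> \<le> 1 * (\<Sum>n. ?p n * (v n x)\<^sup>2)"
        using sum_le_suminf[OF sums_summable[OF p], of "{..<N}"] sums_unique[OF p]
          sum_le_suminf[OF s2, of "{..<N}"]
        by (intro mult_mono sum_nonneg) auto
      finally show ?thesis by simp
    qed
    have "(\<lambda>N. (\<Sum>n<N. ?p n * v n x)\<^sup>2) \<longlonglongrightarrow> (w x)\<^sup>2"
      unfolding w_def by (intro tendsto_power summable_LIMSEQ sv)
    then show "(w x)\<^sup>2 \<le> (\<Sum>n. ?p n * (v n x)\<^sup>2)"
      by (rule LIMSEQ_le_const2) (use fin in auto)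
  qed
  have "w \<in> L2 M"
  proof -
    have "(\<integral>\<^sup>+x. ennreal ((w x)\<^sup>2) \<partial>M) \<le> (\<integral>\<^sup>+x. q x \<partial>M)"
    proof (rule nn_integral_mono_AE, use w_le summ in eventually_elim)
      fix x assume *: "(w x)\<^sup>2 \<le> (\<Sum>n. ?p n * (v n x)\<^sup>2)" "summable (\<lambda>n. ?p n * (v n x)\<^sup>2)"
      have "q x = ennreal (\<Sum>n. ?p n * (v n x)\<^sup>2)"
        unfolding q_def by (rule suminf_ennreal2[OF _ *(2)]) auto
      then show "ennreal ((w x)\<^sup>2) \<le> q x" using *(1) by (simp add: ennreal_leI)
    qed
    also note q_int
    finally have "integrable M (\<lambda>x. (w x)\<^sup>2)"
      by (intro integrableI_bounded) auto
    then show ?thesis by (simp add: L2_def)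
  qed
  moreover have "(\<lambda>n. ?p n * l2_inner M (v n) k) sums l2_inner M w k" if k: "k \<in> L2 M" for k
  proof -
    have abs_L2: "f \<in> L2 M \<Longrightarrow> (\<lambda>x. \<bar>f x\<bar>) \<in> L2 M" for f by (auto simp: L2_def)
    have norm_abs: "l2_norm M (\<lambda>x. \<bar>f x\<bar>) = l2_norm M f" for f
      by (simp add: l2_norm_def l2_inner_def)
    have int: "integrable M (\<lambda>x. ?p n * v n x * k x)" for n
      using L2_mult_integrable[OF v k] by (simp add: mult.assoc)
    have int_le: "(\<integral>x. norm (?p n * v n x * k x) \<partial>M) \<le> ?p n * (C * l2_norm M k)" for n
    proof -
      have "(\<integral>x. norm (?p n * v n x * k x) \<partial>M) = ?p n * l2_inner M (\<lambda>x. \<bar>v n x\<bar>) (\<lambda>x. \<bar>k x\<bar>)"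
        by (simp add: l2_inner_def abs_mult mult.assoc)
      also have "\<dots> \<le> ?p n * (l2_norm M (v n) * l2_norm M k)"
        using l2_inner_Cauchy_Schwarz[OF abs_L2[OF v[of n]] abs_L2[OF k]]
        by (intro mult_left_mono) (auto simp: norm_abs)
      also have "\<dots> \<le> ?p n * (C * l2_norm M k)"
        by (intro mult_left_mono mult_right_mono bd l2_norm_nonneg) auto
      finally show ?thesis .
    qed
    have "(\<lambda>n. \<integral>x. ?p n * v n x * k x \<partial>M) sums (\<integral>x. (\<Sum>n. ?p n * v n x * k x) \<partial>M)"
    proof (rule sums_integral[OF int])
      show "AE x in M. summable (\<lambda>n. norm (?p n * v n x * k x))"
        using summ1
      proof eventually_elim
        fix x assume "summable (\<lambda>n. ?p n * \<bar>v n x\<bar>)"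
        from summable_mult2[OF this, of "\<bar>k x\<bar>"]
        show "summable (\<lambda>n. norm (?p n * v n x * k x))" by (simp add: abs_mult)
      qed
      show "summable (\<lambda>n. \<integral>x. norm (?p n * v n x * k x) \<partial>M)"
      proof (rule summable_comparison_test'[where g = "\<lambda>n. ?p n * (C * l2_norm M k)"])
        show "summable (\<lambda>n. ?p n * (C * l2_norm M k))"
          by (intro summable_mult2 sums_summable[OF p])
      qed (use int_le in auto)
    qed
    moreover have "(\<integral>x. (\<Sum>n. ?p n * v n x * k x) \<partial>M) = l2_inner M w k"
      unfolding l2_inner_def
    proof (rule integral_cong_AE)
      show "AE x in M. (\<Sum>n. ?p n * v n x * k x) = w x * k x"
        using summ1
      proof eventually_elim
        fix x assume "summable (\<lambda>n. ?p n * \<bar>v n x\<bar>)"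
        then have "summable (\<lambda>n. ?p n * v n x)"
          by - (rule summable_rabs_cancel, simp add: abs_mult)
        from suminf_mult2[OF this, of "k x"]
        show "(\<Sum>n. ?p n * v n x * k x) = w x * k x" by (simp add: w_def)
      qed
    qed (use L2_measurable[OF k] in measurable)
    ultimately show ?thesis
      by (simp add: l2_inner_def mult.assoc)
  qed
  ultimately show ?thesis using that by blast
qed

section \<open>Projection-valued measures\<close>

text \<open>Induction over nonnegative measurable functions carries the inequality from sets to
  integrals. It later turns the parallelogram law for spectral measures into integrability.\<close>

lemma nn_integral_le_add_measure:
  assumes u: "u \<in> borel_measurable N" and [measurable_cong]: "sets N1 = sets N" "sets N2 = sets N"
    and le: "\<And>B. B \<in> sets N \<Longrightarrow> emeasure N B \<le> c * (emeasure N1 B + emeasure N2 B)"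
  shows "(\<integral>\<^sup>+x. u x \<partial>N) \<le> c * ((\<integral>\<^sup>+x. u x \<partial>N1) + (\<integral>\<^sup>+x. u x \<partial>N2))"
  using u
proof (induction rule: borel_measurable_induct)
  case (cong f g)
  have "space N1 = space N" "space N2 = space N"
    using assms(2,3) by (auto dest: sets_eq_imp_space_eq)
  then have "integral\<^sup>N N' f = integral\<^sup>N N' g" if "N' \<in> {N, N1, N2}" for N'
    using cong(3) that by (intro nn_integral_cong) auto
  then show ?case using cong(4) by simp
next
  case (set A)
  then show ?case using le[of A] by simp
next
  case (mult u a)
  note [measurable] = mult(2)
  have "(\<integral>\<^sup>+x. a * u x \<partial>N) = a * (\<integral>\<^sup>+x. u x \<partial>N)" by (rule nn_integral_cmult) measurable
  also have "\<dots> \<le> a * (c * ((\<integral>\<^sup>+x. u x \<partial>N1) + (\<integral>\<^sup>+x. u x \<partial>N2)))"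
    using mult by (intro mult_left_mono) auto
  also have "\<dots> = c * (a * (\<integral>\<^sup>+x. u x \<partial>N1) + a * (\<integral>\<^sup>+x. u x \<partial>N2))"
    by (simp add: algebra_simps)
  finally show ?case by (simp add: nn_integral_cmult)
next
  case (add u v)
  note [measurable] = add.hyps(1,3)
  have "(\<integral>\<^sup>+x. v x + u x \<partial>N) = (\<integral>\<^sup>+x. v x \<partial>N) + (\<integral>\<^sup>+x. u x \<partial>N)" by (rule nn_integral_add) measurable
  also have "\<dots> \<le> c * ((\<integral>\<^sup>+x. v x \<partial>N1) + (\<integral>\<^sup>+x. v x \<partial>N2)) + c * ((\<integral>\<^sup>+x. u x \<partial>N1) + (\<integral>\<^sup>+x. u x \<partial>N2))"
    using add by (intro add_mono) auto
  also have "\<dots> = c * (((\<integral>\<^sup>+x. v x \<partial>N1) + (\<integral>\<^sup>+x. u x \<partial>N1)) + ((\<integral>\<^sup>+x. v x \<partial>N2) + (\<integral>\<^sup>+x. u x \<partial>N2)))"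
    by (simp add: algebra_simps)
  finally show ?case by (simp add: nn_integral_add)
next
  case (seq U)
  note [measurable] = seq(1)
  have "(\<integral>\<^sup>+x. (SUP i. U i) x \<partial>N) = (SUP i. \<integral>\<^sup>+x. U i x \<partial>N)"
    using seq by (simp add: nn_integral_monotone_convergence_SUP image_comp)
  also have "\<dots> \<le> c * ((\<integral>\<^sup>+x. (SUP i. U i) x \<partial>N1) + (\<integral>\<^sup>+x. (SUP i. U i) x \<partial>N2))"
  proof (rule SUP_least)
    fix i
    have "(\<integral>\<^sup>+x. U i x \<partial>N) \<le> c * ((\<integral>\<^sup>+x. U i x \<partial>N1) + (\<integral>\<^sup>+x. U i x \<partial>N2))"
      using seq by simp
    also have "\<dots> \<le> c * ((\<integral>\<^sup>+x. (SUP i. U i) x \<partial>N1) + (\<integral>\<^sup>+x. (SUP i. U i) x \<partial>N2))"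
      by (intro mult_left_mono add_mono nn_integral_mono) (auto simp: image_comp intro: SUP_upper)
    finally show "(\<integral>\<^sup>+x. U i x \<partial>N) \<le> c * ((\<integral>\<^sup>+x. (SUP i. U i) x \<partial>N1) + (\<integral>\<^sup>+x. (SUP i. U i) x \<partial>N2))" .
  qed
  finally show ?case .
qed

locale pvm =
  fixes M :: "'a measure" and E :: "real set \<Rightarrow> ('a \<Rightarrow> real) \<Rightarrow> ('a \<Rightarrow> real)"
  assumes pvm: "projection_valued_measure M E"
begin

lemma proj: "B \<in> sets borel \<Longrightarrow> orthogonal_projection M (E B)"
  using pvm by (simp add: projection_valued_measure_def)

lemma E_L2: "B \<in> sets borel \<Longrightarrow> f \<in> L2 M \<Longrightarrow> E B f \<in> L2 M"
  using proj[of B] by (simp add: orthogonal_projection_def)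

lemma E_lincomb:
  "B \<in> sets borel \<Longrightarrow> f \<in> L2 M \<Longrightarrow> g \<in> L2 M \<Longrightarrow>
    AE x in M. E B (\<lambda>y. a * f y + b * g y) x = a * E B f x + b * E B g x"
  using proj[of B] by (simp add: orthogonal_projection_def)

lemma E_sym:
  "B \<in> sets borel \<Longrightarrow> f \<in> L2 M \<Longrightarrow> g \<in> L2 M \<Longrightarrow> l2_inner M (E B f) g = l2_inner M f (E B g)"
  using proj[of B] by (simp add: orthogonal_projection_def)

lemma E_UNIV: "f \<in> L2 M \<Longrightarrow> AE x in M. E UNIV f x = f x"
  using pvm by (simp add: projection_valued_measure_def)

lemma E_Int:
  "B \<in> sets borel \<Longrightarrow> C \<in> sets borel \<Longrightarrow> f \<in> L2 M \<Longrightarrow> AE x in M. E (B \<inter> C) f x = E B (E C f) x"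
  using pvm by (simp add: projection_valued_measure_def)

lemma inner_E_E:
  assumes "B \<in> sets borel" "C \<in> sets borel" "f \<in> L2 M" "g \<in> L2 M"
  shows "l2_inner M (E B f) (E C g) = l2_inner M (E (B \<inter> C) f) g"
proof -
  have "l2_inner M (E B f) (E C g) = l2_inner M (E C (E B f)) g"
    using assms by (simp add: E_sym E_L2)
  also have "\<dots> = l2_inner M (E (C \<inter> B) f) g"
    using assms by (intro l2_inner_cong_AE E_L2 AE_symmetric[OF E_Int]) auto
  finally show ?thesis by (simp add: Int_commute)
qed

lemma inner_E_lincomb:
  assumes "B \<in> sets borel" "f \<in> L2 M" "g \<in> L2 M" "k \<in> L2 M"
  shows "l2_inner M (E B (\<lambda>y. a * f y + b * g y)) k = a * l2_inner M (E B f) k + b * l2_inner M (E B g) k"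
proof -
  have "l2_inner M (E B (\<lambda>y. a * f y + b * g y)) k = l2_inner M (\<lambda>x. a * E B f x + b * E B g x) k"
    using assms by (intro l2_inner_cong_AE E_L2 L2_lincomb E_lincomb) auto
  then show ?thesis using assms by (simp add: l2_inner_lincomb_left E_L2)
qed

text \<open>Cauchy-Schwarz against \<open>g\<close> turns the norm convergence in the definition of
  a projection-valued measure into countable additivity of a scalar set function.\<close>

lemma inner_E_sums:
  assumes D: "range D \<subseteq> sets borel" "disjoint_family D" and f: "f \<in> L2 M" and g: "g \<in> L2 M"
  shows "(\<lambda>i. l2_inner M (E (D i) f) g) sums l2_inner M (E (\<Union>i. D i) f) g"
proof -
  let ?U = "\<Union>i::nat. D i"
  have L: "E ?U f \<in> L2 M" "(\<lambda>x. \<Sum>i<N. E (D i) f x) \<in> L2 M" "E (D i) f \<in> L2 M" for N i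
    using D f by (auto intro!: E_L2 L2_sum)
  have lim: "(\<lambda>N. l2_norm M (\<lambda>x. E ?U f x - (\<Sum>i<N. E (D i) f x)) * l2_norm M g) \<longlonglongrightarrow> 0"
    using pvm D f unfolding projection_valued_measure_def by (intro tendsto_mult_left_zero) blast
  have "(\<lambda>N. l2_inner M (E ?U f) g - (\<Sum>i<N. l2_inner M (E (D i) f) g)) \<longlonglongrightarrow> 0"
  proof (rule Lim_null_comparison[OF _ lim], rule always_eventually, rule allI)
    fix N
    have "l2_inner M (E ?U f) g - (\<Sum>i<N. l2_inner M (E (D i) f) g)
        = l2_inner M (\<lambda>x. E ?U f x - (\<Sum>i<N. E (D i) f x)) g"
      using L g by (simp add: l2_inner_diff_left l2_inner_sum_left)
    then show "norm (l2_inner M (E ?U f) g - (\<Sum>i<N. l2_inner M (E (D i) f) g))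
        \<le> l2_norm M (\<lambda>x. E ?U f x - (\<Sum>i<N. E (D i) f x)) * l2_norm M g"
      using l2_inner_Cauchy_Schwarz[OF L2_diff[OF L(1,2)] g] by simp
  qed
  from tendsto_diff[OF tendsto_const[of "l2_inner M (E ?U f) g"] this]
  show ?thesis by (simp add: sums_def)
qed

abbreviation "\<mu> \<equiv> scalar_spectral_measure M E"

lemma space_scalar [simp]: "space (\<mu> f) = UNIV"
  by (simp add: scalar_spectral_measure_def space_measure_of_conv)

lemma sets_scalar [simp, measurable_cong]: "sets (\<mu> f) = sets borel"
  unfolding scalar_spectral_measure_def
  by (subst sets_measure_of) (auto simp: sets.sigma_sets_eq[of borel, simplified])

lemma inner_E_nonneg:
  assumes "B \<in> sets borel" "f \<in> L2 M"
  shows "0 \<le> l2_inner M (E B f) f"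
  using inner_E_E[OF assms(1,1) assms(2,2)] l2_inner_nonneg[of M "E B f"] by simp

lemma emeasure_scalar:
  assumes B: "B \<in> sets borel" and f: "f \<in> L2 M"
  shows "emeasure (\<mu> f) B = ennreal (l2_inner M (E B f) f)"
proof (rule emeasure_measure_of[OF scalar_spectral_measure_def])
  show "sets borel \<subseteq> Pow (UNIV::real set)" by simp
  show "B \<in> sets (\<mu> f)" using B by simp
  \<comment> \<open>Countable additivity for the sequence of empty sets makes a constant series
    summable, so the constant is 0.\<close>
  have empty: "l2_inner M (E {} f) f = 0"
  proof -
    have "(\<lambda>i::nat. l2_inner M (E {} f) f) sums l2_inner M (E {} f) f"
      using inner_E_sums[of "\<lambda>_. {}" f f] f by (simp add: disjoint_family_on_def)
    then have "(\<lambda>i::nat. l2_inner M (E {} f) f) \<longlonglongrightarrow> 0"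
      by (intro summable_LIMSEQ_zero sums_summable)
    then show ?thesis by (simp add: LIMSEQ_const_iff)
  qed
  show "positive (sets (\<mu> f)) (\<lambda>B. ennreal (l2_inner M (E B f) f))"
    by (simp add: positive_def empty)
  show "countably_additive (sets (\<mu> f)) (\<lambda>B. ennreal (l2_inner M (E B f) f))"
  proof (rule countably_additiveI)
    fix A :: "nat \<Rightarrow> real set" assume A: "range A \<subseteq> sets (\<mu> f)" "disjoint_family A"
    show "(\<Sum>i. ennreal (l2_inner M (E (A i) f) f)) = ennreal (l2_inner M (E (\<Union>i. A i) f) f)"
      using A inner_E_sums[of A f f] f inner_E_nonneg[of "A i" f for i]
      by (intro suminf_ennreal_eq) auto
  qed
qed

lemma finite_scalar: "f \<in> L2 M \<Longrightarrow> finite_measure (\<mu> f)"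
  by (rule finite_measureI) (simp add: emeasure_scalar)

lemma measure_scalar:
  "B \<in> sets borel \<Longrightarrow> f \<in> L2 M \<Longrightarrow> measure (\<mu> f) B = l2_inner M (E B f) f"
  by (simp add: measure_def emeasure_scalar inner_E_nonneg)

lemma measure_scalar_UNIV: "f \<in> L2 M \<Longrightarrow> measure (\<mu> f) UNIV = l2_inner M f f"
  using l2_inner_cong_AE[OF E_UNIV, of f f] by (simp add: measure_scalar E_L2)

lemma inner_E_le:
  assumes "B \<in> sets borel" "f \<in> L2 M"
  shows "l2_inner M (E B f) (E B f) \<le> l2_inner M f f"
proof -
  interpret finite_measure "\<mu> f" using assms by (simp add: finite_scalar)
  have "l2_inner M (E B f) (E B f) = measure (\<mu> f) B"
    using inner_E_E[OF assms(1,1) assms(2,2)] assms by (simp add: measure_scalar)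
  also have "\<dots> \<le> measure (\<mu> f) UNIV" using bounded_measure[of B] by simp
  finally show ?thesis using assms by (simp add: measure_scalar_UNIV)
qed

lemma norm_E_le: "B \<in> sets borel \<Longrightarrow> f \<in> L2 M \<Longrightarrow> l2_norm M (E B f) \<le> l2_norm M f"
  unfolding l2_norm_def by (simp add: inner_E_le)

lemma measure_scalar_lincomb:
  assumes "B \<in> sets borel" "f \<in> L2 M" "g \<in> L2 M"
  shows "measure (\<mu> (\<lambda>x. a * f x + b * g x)) B =
    a\<^sup>2 * measure (\<mu> f) B + 2 * a * b * l2_inner M (E B f) g + b\<^sup>2 * measure (\<mu> g) B"
proof -
  let ?h = "\<lambda>x. a * f x + b * g x"
  have h: "?h \<in> L2 M" using assms by (intro L2_lincomb)
  have "l2_inner M (E B ?h) ?h = a * l2_inner M (E B f) ?h + b * l2_inner M (E B g) ?h"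
    using assms h by (intro inner_E_lincomb)
  moreover have "l2_inner M k ?h = a * l2_inner M k f + b * l2_inner M k g" if "k \<in> L2 M" for k
    using assms that by (simp add: l2_inner_commute[of M k] l2_inner_lincomb_left)
  moreover have "l2_inner M (E B g) f = l2_inner M (E B f) g"
    using assms by (metis E_sym l2_inner_commute)
  ultimately show ?thesis
    using assms h by (simp add: measure_scalar E_L2 power2_eq_square algebra_simps)
qed

text \<open>Identifies the difference of measures in \<open>spectral_integral\<close>, after
  division by 4, with the signed measure <E B f, g>.\<close>

lemma measure_scalar_polar:
  assumes "B \<in> sets borel" "f \<in> L2 M" "g \<in> L2 M"
  shows "measure (\<mu> (\<lambda>x. f x + g x)) B - measure (\<mu> (\<lambda>x. f x - g x)) B = 4 * l2_inner M (E B f) g"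
  using measure_scalar_lincomb[OF assms, of 1 1] measure_scalar_lincomb[OF assms, of 1 "-1"] by simp

lemma measure_scalar_parallelogram:
  assumes "B \<in> sets borel" "f \<in> L2 M" "g \<in> L2 M"
  shows "measure (\<mu> (\<lambda>x. f x + g x)) B + measure (\<mu> (\<lambda>x. f x - g x)) B =
    2 * measure (\<mu> f) B + 2 * measure (\<mu> g) B"
  using measure_scalar_lincomb[OF assms, of 1 1] measure_scalar_lincomb[OF assms, of 1 "-1"] by simp

lemma scalar_eqI:
  assumes "finite_measure N" "sets N = sets borel" "f \<in> L2 M"
    "\<And>B. B \<in> sets borel \<Longrightarrow> measure (\<mu> f) B = measure N B"
  shows "\<mu> f = N"
proof (rule measure_eqI)
  fix B assume "B \<in> sets (\<mu> f)"
  then show "emeasure (\<mu> f) B = emeasure N B"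
    using assms finite_scalar[of f] by (simp add: finite_measure.emeasure_eq_measure)
qed (simp add: assms)

text \<open>Since <E B (E C f), E C f> = <E (B \<inter> C) f, f>, projecting a vector cuts its
  spectral measure down to \<open>C\<close>. Integrals over a part of the spectrum become integrals
  for a projected vector.\<close>

lemma scalar_E:
  assumes C: "C \<in> sets borel" and f: "f \<in> L2 M"
  shows "\<mu> (E C f) = density (\<mu> f) (indicator C)"
proof -
  interpret finite_measure "\<mu> f" using f by (rule finite_scalar)
  have em: "emeasure (density (\<mu> f) (indicator C)) B = emeasure (\<mu> f) (B \<inter> C)"
    if "B \<in> sets borel" for B
    using that C by (simp add: emeasure_density indicator_inter_arith[symmetric] Int_commute)
  show ?thesis
  proof (rule scalar_eqI)
    show "finite_measure (density (\<mu> f) (indicator C))"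
      using em[of UNIV] by (intro finite_measureI) (simp add: emeasure_eq_measure)
    fix B :: "real set" assume B: "B \<in> sets borel"
    have "measure (\<mu> (E C f)) B = l2_inner M (E (B \<inter> C) f) f"
    proof -
      have "l2_inner M (E B (E C f)) (E C f) = l2_inner M (E (B \<inter> C) f) (E C f)"
        using B C f E_Int[OF B C f] by (intro l2_inner_cong_AE E_L2) auto
      also have "\<dots> = l2_inner M (E (B \<inter> C) f) f"
        using B C f by (subst inner_E_E) (auto simp: Int_assoc)
      finally show ?thesis using B C f by (simp add: measure_scalar E_L2)
    qed
    then show "measure (\<mu> (E C f)) B = measure (density (\<mu> f) (indicator C)) B"
      using em[OF B] B C f by (simp add: measure_def[of "density _ _"] emeasure_scalar inner_E_nonneg)
  qed (use C f E_L2 in auto)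
qed

text \<open>By the parallelogram law the spectral measures of f + g and f - g are at most 2
  \<open>\<mu> f\<close> + 2 \<open>\<mu> g\<close>. With squares as integrand, this keeps the
  polarized integrals within the domain of the operator.\<close>

lemma integrable_scalar_add_diff:
  fixes h :: "real \<Rightarrow> real"
  assumes f: "f \<in> L2 M" and g: "g \<in> L2 M"
    and hf: "integrable (\<mu> f) h" and hg: "integrable (\<mu> g) h"
  shows "integrable (\<mu> (\<lambda>x. f x + g x)) h" "integrable (\<mu> (\<lambda>x. f x - g x)) h"
proof -
  have [measurable]: "h \<in> borel_measurable borel"
    using borel_measurable_integrable[OF hf] by (simp cong: measurable_cong_sets)
  have int: "integrable (\<mu> k) h" if k: "k \<in> L2 M"
    and le: "\<And>B. B \<in> sets borel \<Longrightarrow> measure (\<mu> k) B \<le> 2 * measure (\<mu> f) B + 2 * measure (\<mu> g) B" for k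
  proof (rule integrableI_bounded)
    have "emeasure (\<mu> k) B \<le> 2 * (emeasure (\<mu> f) B + emeasure (\<mu> g) B)" if "B \<in> sets (\<mu> k)" for B
    proof -
      have "emeasure (\<mu> k) B \<le> ennreal (2 * (measure (\<mu> f) B + measure (\<mu> g) B))"
        unfolding finite_measure.emeasure_eq_measure[OF finite_scalar[OF k]]
        using le[of B] that by (intro ennreal_leI) simp
      also have "\<dots> = 2 * (emeasure (\<mu> f) B + emeasure (\<mu> g) B)"
        by (simp add: finite_measure.emeasure_eq_measure[OF finite_scalar] f g ennreal_mult)
      finally show ?thesis .
    qed
    then have "(\<integral>\<^sup>+s. ennreal (norm (h s)) \<partial>\<mu> k) \<le>
        2 * ((\<integral>\<^sup>+s. ennreal (norm (h s)) \<partial>\<mu> f) + (\<integral>\<^sup>+s. ennreal (norm (h s)) \<partial>\<mu> g))"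
      by (intro nn_integral_le_add_measure) auto
    also have "\<dots> < \<infinity>"
      using hf hg by (simp add: integrable_iff_bounded ennreal_mult_less_top)
    finally show "(\<integral>\<^sup>+s. ennreal (norm (h s)) \<partial>\<mu> k) < \<infinity>" .
  qed simp
  have nonneg: "measure N B \<ge> 0" for N :: "real measure" and B by simp
  show "integrable (\<mu> (\<lambda>x. f x + g x)) h"
  proof (rule int)
    fix B :: "real set" assume "B \<in> sets borel"
    then show "measure (\<mu> (\<lambda>x. f x + g x)) B \<le> 2 * measure (\<mu> f) B + 2 * measure (\<mu> g) B"
      using measure_scalar_parallelogram[of B f g] f g nonneg[of "\<mu> (\<lambda>x. f x - g x)" B] by linarith
  qed (intro L2_add f g)
  show "integrable (\<mu> (\<lambda>x. f x - g x)) h"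
  proof (rule int)
    fix B :: "real set" assume "B \<in> sets borel"
    then show "measure (\<mu> (\<lambda>x. f x - g x)) B \<le> 2 * measure (\<mu> f) B + 2 * measure (\<mu> g) B"
      using measure_scalar_parallelogram[of B f g] f g nonneg[of "\<mu> (\<lambda>x. f x + g x)" B] by linarith
  qed (intro L2_diff f g)
qed

end

text \<open>The parity of the floor of 2^(n+1) x is the binary digit of \<open>x\<close> at place
  n+1; the partial sums are the truncations of \<open>x\<close>. A multiplication by s thereby
  becomes a weighted sum of indicators.\<close>

lemma binary_expansion_sums:
  fixes x :: real
  assumes "0 \<le> x" "x < 1"
  shows "(\<lambda>n. (1/2) ^ Suc n * of_bool (odd \<lfloor>2 ^ Suc n * x\<rfloor>)) sums x"
proof -
  have partial: "(\<Sum>n<m. (1/2) ^ Suc n * of_bool (odd \<lfloor>2 ^ Suc n * x\<rfloor>)) = \<lfloor>2 ^ m * x\<rfloor> / 2 ^ m" for m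
  proof (induction m)
    case 0
    then show ?case using assms by (simp add: floor_eq_iff)
  next
    case (Suc m)
    let ?y = "2 ^ m * x"
    have "\<lfloor>2 * ?y\<rfloor> = 2 * \<lfloor>?y\<rfloor> \<or> \<lfloor>2 * ?y\<rfloor> = 2 * \<lfloor>?y\<rfloor> + 1" by linarith
    then have "\<lfloor>2 * ?y\<rfloor> = 2 * \<lfloor>?y\<rfloor> + of_bool (odd \<lfloor>2 * ?y\<rfloor>)" by auto
    then have "real_of_int \<lfloor>2 ^ Suc m * x\<rfloor> = 2 * real_of_int \<lfloor>?y\<rfloor> + of_bool (odd \<lfloor>2 ^ Suc m * x\<rfloor>)"
      by (metis (no_types, opaque_lifting) mult.assoc of_int_add of_int_mult of_int_numeral of_int_of_bool power_Suc)
    then show ?case using Suc by (simp add: field_simps power_one_over del: power_Suc) (simp add: field_simps)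
  qed
  have "(\<lambda>m. \<lfloor>2 ^ m * x\<rfloor> / 2 ^ m) \<longlonglongrightarrow> x"
  proof (rule tendsto_sandwich)
    show "\<forall>\<^sub>F m in sequentially. x - (1/2) ^ m \<le> \<lfloor>2 ^ m * x\<rfloor> / 2 ^ m"
    proof (intro always_eventually allI)
      fix m
      have "2 ^ m * x - 1 \<le> \<lfloor>2 ^ m * x\<rfloor>" by linarith
      then have "(2 ^ m * x - 1) / 2 ^ m \<le> \<lfloor>2 ^ m * x\<rfloor> / 2 ^ m" by (intro divide_right_mono) auto
      then show "x - (1/2) ^ m \<le> \<lfloor>2 ^ m * x\<rfloor> / 2 ^ m" by (simp add: diff_divide_distrib power_one_over)
    qed
    show "\<forall>\<^sub>F m in sequentially. \<lfloor>2 ^ m * x\<rfloor> / 2 ^ m \<le> x"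
      by (intro always_eventually allI) (simp add: divide_le_eq mult.commute)
    show "(\<lambda>m. x - (1/2) ^ m) \<longlonglongrightarrow> x"
      using tendsto_diff[OF tendsto_const[of x] LIMSEQ_power_zero[of "1/2::real"]] by simp
  qed simp
  then show ?thesis by (simp only: sums_def partial)
qed

section \<open>Weak integrals against a projection-valued measure\<close>

context pvm begin

lemma spectral_integral_iff:
  "(f, g) \<in> spectral_integral M E h \<longleftrightarrow>
    f \<in> L2 M \<and> integrable (\<mu> f) (\<lambda>s. (h s)\<^sup>2) \<and> g \<in> L2 M \<and>
    (\<forall>k. k \<in> L2 M \<longrightarrow> integrable (\<mu> k) (\<lambda>s. (h s)\<^sup>2) \<longrightarrow> l2_inner M g k =
       ((\<integral>s. h s \<partial>\<mu> (\<lambda>x. f x + k x)) - (\<integral>s. h s \<partial>\<mu> (\<lambda>x. f x - k x))) / 4)"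
  by (auto simp: spectral_integral_def Let_def)

lemma integrable_scalar_if_square:
  fixes h :: "real \<Rightarrow> real"
  assumes [measurable]: "h \<in> borel_measurable borel" and f: "f \<in> L2 M"
    and "integrable (\<mu> f) (\<lambda>s. (h s)\<^sup>2)"
  shows "integrable (\<mu> f) h"
  by (rule finite_measure.square_integrable_imp_integrable[OF finite_scalar[OF f] _ assms(3)]) simp

lemma integrable_scalar_bounded:
  fixes h :: "real \<Rightarrow> real"
  assumes [measurable]: "h \<in> borel_measurable borel" and f: "f \<in> L2 M" and "\<And>s. \<bar>h s\<bar> \<le> K"
  shows "integrable (\<mu> f) h"
  by (rule finite_measure.integrable_const_bound[OF finite_scalar[OF f], where B = K]) (use assms(3) in auto)

lemma scalar_E_real:
  assumes "C \<in> sets borel" "f \<in> L2 M"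
  shows "\<mu> (E C f) = density (\<mu> f) (\<lambda>s. ennreal (indicator C s))"
  using scalar_E[OF assms] by (simp add: ennreal_indicator)

lemma integral_scalar_E:
  fixes h :: "real \<Rightarrow> real"
  assumes [measurable]: "h \<in> borel_measurable borel" "C \<in> sets borel" and f: "f \<in> L2 M"
  shows "(\<integral>s. h s \<partial>\<mu> (E C f)) = (\<integral>s. indicator C s * h s \<partial>\<mu> f)"
    and "integrable (\<mu> (E C f)) h \<longleftrightarrow> integrable (\<mu> f) (\<lambda>s. indicator C s * h s)"
  unfolding scalar_E_real[OF assms(2) f] by (auto simp: integral_density integrable_density)

lemma integral_indicator_scalar:
  assumes "C \<in> sets borel" "f \<in> L2 M"
  shows "(\<integral>s. indicator C s \<partial>\<mu> f) = l2_inner M (E C f) f"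
  using assms by (simp add: measure_scalar)

text \<open>For the test vector E B f both measures in the polarized definition have explicit
  densities with respect to \<open>\<mu> f\<close>, so the weak identity can be evaluated.\<close>

lemma spectral_integral_inner_E:
  fixes h :: "real \<Rightarrow> real"
  assumes h[measurable]: "h \<in> borel_measurable borel" and B[measurable]: "B \<in> sets borel"
    and fg: "(f, g) \<in> spectral_integral M E h"
  shows "l2_inner M g (E B f) = (\<integral>s. indicator B s * h s \<partial>\<mu> f)"
proof -
  have f: "f \<in> L2 M" and hf: "integrable (\<mu> f) (\<lambda>s. (h s)\<^sup>2)"
    using fg by (auto simp: spectral_integral_iff)
  let ?k = "E B f"
  have k: "?k \<in> L2 M" using B f by (rule E_L2)
  have ih: "integrable (\<mu> f) h" using integrable_scalar_if_square[OF h f hf] .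
  have iBh: "integrable (\<mu> f) (\<lambda>s. indicator B s * h s)"
    using integrable_mult_indicator[OF _ ih, of B] by simp
  have "integrable (\<mu> ?k) (\<lambda>s. (h s)\<^sup>2)"
    using integrable_mult_indicator[OF _ hf, of B] f by (simp add: integral_scalar_E)
  then have eq: "l2_inner M g ?k =
       ((\<integral>s. h s \<partial>\<mu> (\<lambda>x. f x + ?k x)) - (\<integral>s. h s \<partial>\<mu> (\<lambda>x. f x - ?k x))) / 4"
    using fg k by (auto simp: spectral_integral_iff)
  interpret finite_measure "\<mu> f" using f by (rule finite_scalar)
  \<comment> \<open>The vector f + b E B f has density (1 + b)^2 on \<open>B\<close> and 1 off
    \<open>B\<close>. For b = 1 and b = -1 this is 4 and 0 on \<open>B\<close>, so the difference is
    4 times the indicator and cancels the division by 4.\<close>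
  have dens: "(\<integral>s. h s \<partial>\<mu> (\<lambda>x. 1 * f x + b * ?k x)) =
      (\<integral>s. h s \<partial>\<mu> f) + (2 * b + b\<^sup>2) * (\<integral>s. indicator B s * h s \<partial>\<mu> f)" if b: "2 * b + b\<^sup>2 \<ge> -1" for b
  proof -
    let ?w = "\<lambda>s. 1 + (2 * b + b\<^sup>2) * indicator B s :: real"
    have w: "0 \<le> ?w s" for s using b by (auto simp: indicator_def)
    have iw: "integrable (\<mu> f) (\<lambda>s. ?w s * indicator C s)" if [measurable]: "C \<in> sets borel" for C
      by (rule integrable_const_bound[where B = "1 + \<bar>2 * b + b\<^sup>2\<bar>"]) (auto simp: indicator_def)
    have em: "emeasure (density (\<mu> f) (\<lambda>s. ennreal (?w s))) C =
        ennreal (measure (\<mu> f) C + (2 * b + b\<^sup>2) * measure (\<mu> f) (C \<inter> B))" if [measurable]: "C \<in> sets borel" for C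
    proof -
      have "emeasure (density (\<mu> f) (\<lambda>s. ennreal (?w s))) C = (\<integral>\<^sup>+s. ennreal (?w s * indicator C s) \<partial>\<mu> f)"
        by (auto simp: emeasure_density indicator_def intro!: nn_integral_cong)
      also have "\<dots> = ennreal (\<integral>s. ?w s * indicator C s \<partial>\<mu> f)"
        using w that by (intro nn_integral_eq_integral iw) auto
      also have "(\<integral>s. ?w s * indicator C s \<partial>\<mu> f) =
          (\<integral>s. indicator C s + (2 * b + b\<^sup>2) * indicator (C \<inter> B) s \<partial>\<mu> f)"
        by (intro Bochner_Integration.integral_cong) (auto simp: indicator_def)
      also have "\<dots> = measure (\<mu> f) C + (2 * b + b\<^sup>2) * measure (\<mu> f) (C \<inter> B)"
        by (subst Bochner_Integration.integral_add) (auto simp: emeasure_eq_measure)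
      finally show ?thesis .
    qed
    have "\<mu> (\<lambda>x. 1 * f x + b * ?k x) = density (\<mu> f) (\<lambda>s. ennreal (?w s))"
    proof (rule scalar_eqI)
      show "finite_measure (density (\<mu> f) (\<lambda>s. ennreal (?w s)))"
        using em[of UNIV] by (intro finite_measureI) simp
      show "(\<lambda>x. 1 * f x + b * ?k x) \<in> L2 M" by (intro L2_lincomb f k)
      fix C :: "real set" assume [measurable]: "C \<in> sets borel"
      have "measure (\<mu> ?k) C = measure (\<mu> f) (C \<inter> B)"
        using integral_scalar_E(1)[of "indicator C" B f] f
        by (simp add: indicator_inter_arith[symmetric] Int_commute)
      moreover have "l2_inner M (E C f) ?k = measure (\<mu> f) (C \<inter> B)"
        using f by (simp add: inner_E_E measure_scalar)
      ultimately have "measure (\<mu> (\<lambda>x. 1 * f x + b * ?k x)) C =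
          measure (\<mu> f) C + (2 * b + b\<^sup>2) * measure (\<mu> f) (C \<inter> B)"
        using measure_scalar_lincomb[OF _ f k, of C 1 b] by (simp add: algebra_simps)
      moreover from this have "0 \<le> measure (\<mu> f) C + (2 * b + b\<^sup>2) * measure (\<mu> f) (C \<inter> B)"
        by (metis measure_nonneg)
      ultimately show "measure (\<mu> (\<lambda>x. 1 * f x + b * ?k x)) C =
          measure (density (\<mu> f) (\<lambda>s. ennreal (?w s))) C"
        by (simp add: measure_def[of "density _ _"] em)
    qed simp
    then have "(\<integral>s. h s \<partial>\<mu> (\<lambda>x. 1 * f x + b * ?k x)) = (\<integral>s. ?w s * h s \<partial>\<mu> f)"
      using w by (simp add: integral_density)
    also have "\<dots> = (\<integral>s. h s + (2 * b + b\<^sup>2) * (indicator B s * h s) \<partial>\<mu> f)"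
      by (intro Bochner_Integration.integral_cong) (auto simp: algebra_simps)
    also have "\<dots> = (\<integral>s. h s \<partial>\<mu> f) + (2 * b + b\<^sup>2) * (\<integral>s. indicator B s * h s \<partial>\<mu> f)"
      using ih iBh by simp
    finally show ?thesis .
  qed
  show ?thesis using eq dens[of 1] dens[of "-1"] by simp
qed

text \<open>The definition tests a value only against the domain. Projecting an arbitrary
  \<open>k\<close> to a slice of the spectrum where \<open>h\<close> is bounded lands in the domain,
  and the slices add up to \<open>k\<close>.\<close>

lemma spectral_integral_functional:
  fixes h :: "real \<Rightarrow> real"
  assumes h[measurable]: "h \<in> borel_measurable borel"
    and fg: "(f, g) \<in> spectral_integral M E h" and fg': "(f, g') \<in> spectral_integral M E h"
  shows "AE x in M. g x = g' x"
proof (rule l2_eqI)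
  show g: "g \<in> L2 M" and g': "g' \<in> L2 M" using fg fg' by (auto simp: spectral_integral_iff)
  fix k assume k: "k \<in> L2 M"
  \<comment> \<open>Taking the integer part of |h| makes the slices disjoint and exhausting, with
    |h| \<le> i + 1 on slice \<open>i\<close>.\<close>
  define D where "D i = {s. \<lfloor>\<bar>h s\<bar>\<rfloor> = int i}" for i :: nat
  have D[measurable]: "D i \<in> sets borel" for i unfolding D_def by measurable
  have U: "(\<Union>i. D i) = UNIV"
  proof -
    have "s \<in> D (nat \<lfloor>\<bar>h s\<bar>\<rfloor>)" for s by (simp add: D_def)
    then show ?thesis by blast
  qed
  have dis: "disjoint_family D" by (auto simp: disjoint_family_on_def D_def)
  have eq: "l2_inner M (E (D i) k) g = l2_inner M (E (D i) k) g'" for i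
  proof -
    have "integrable (\<mu> k) (\<lambda>s. indicator (D i) s * (h s)\<^sup>2)"
    proof (rule integrable_scalar_bounded[OF _ k])
      fix s
      have "\<bar>h s\<bar> \<le> real i + 1" if "s \<in> D i" using that unfolding D_def by (simp add: floor_eq_iff)
      then have "(h s)\<^sup>2 \<le> (real i + 1)\<^sup>2" if "s \<in> D i"
        using that power_mono[of "\<bar>h s\<bar>" "real i + 1" 2] by simp
      then show "\<bar>indicator (D i) s * (h s)\<^sup>2\<bar> \<le> (real i + 1)\<^sup>2"
        by (simp add: indicator_def)
    qed measurable
    then have "integrable (\<mu> (E (D i) k)) (\<lambda>s. (h s)\<^sup>2)"
      using k by (subst integral_scalar_E) auto
    then have "l2_inner M g (E (D i) k) = l2_inner M g' (E (D i) k)"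
      using fg fg' E_L2[OF D[of i] k] unfolding spectral_integral_iff by metis
    then show ?thesis by (simp add: l2_inner_commute)
  qed
  have "l2_inner M (E UNIV k) g = l2_inner M (E UNIV k) g'"
  proof (rule sums_unique2)
    have "range D \<subseteq> sets borel" using D by auto
    then show "(\<lambda>i. l2_inner M (E (D i) k) g') sums l2_inner M (E UNIV k) g"
      "(\<lambda>i. l2_inner M (E (D i) k) g') sums l2_inner M (E UNIV k) g'"
      using inner_E_sums[OF _ dis k g] inner_E_sums[OF _ dis k g'] unfolding U eq by auto
  qed
  moreover have "l2_inner M (E UNIV k) u = l2_inner M u k" if "u \<in> L2 M" for u
    using l2_inner_cong_AE[OF E_UNIV[OF k] _ k that] E_L2[OF _ k] by (simp add: l2_inner_commute)
  ultimately show "l2_inner M g k = l2_inner M g' k" using g g' by simp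
qed

end

section \<open>The operator on a bounded spectral interval\<close>

context pvm begin

lemma inner_E_restrict:
  assumes C: "C \<in> sets borel" and J: "J \<in> sets borel" and f: "f \<in> L2 M" and k: "k \<in> L2 M"
    and fJ: "AE x in M. E J f x = f x"
  shows "l2_inner M (E C f) k = l2_inner M (E (C \<inter> J) f) k"
proof -
  have "l2_inner M (E C f) k = l2_inner M f (E C k)" using C f k by (rule E_sym)
  also have "\<dots> = l2_inner M (E J f) (E C k)"
    using l2_inner_cong_AE[OF fJ E_L2[OF J f] f E_L2[OF C k]] by simp
  finally show ?thesis using assms by (simp add: inner_E_E Int_commute)
qed

text \<open>Constructs A f for \<open>f\<close> spectrally supported in \<open>J\<close> as c f + L
  w, where w is the dyadic series of the projections of \<open>f\<close> to the sets where a given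
  binary digit of (s - c) / L is 1. The half-open bound on \<open>J\<close> keeps that quotient
  below 1.\<close>

lemma ex_L2_interval_integral:
  fixes L :: real
  assumes J[measurable]: "J \<in> sets borel" and f: "f \<in> L2 M" and fJ: "AE x in M. E J f x = f x"
    and L: "0 < L" and JL: "J \<subseteq> {c..<c+L}"
  obtains g where "g \<in> L2 M" "AE x in M. E J g x = g x"
    "\<And>k. k \<in> L2 M \<Longrightarrow> l2_inner M g k =
      ((\<integral>s. indicator J s * s \<partial>\<mu> (\<lambda>x. f x + k x)) - (\<integral>s. indicator J s * s \<partial>\<mu> (\<lambda>x. f x - k x))) / 4"
proof -
  let ?X = "\<lambda>s::real. (s - c) / L"
  define C where "C n = {s. odd \<lfloor>2 ^ Suc n * ?X s\<rfloor>} \<inter> J" for n :: nat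
  have C[measurable]: "C n \<in> sets borel" for n unfolding C_def by measurable
  have CJ: "C n \<inter> J = C n" for n by (auto simp: C_def)
  let ?p = "\<lambda>n. (1/2::real) ^ Suc n"
  have digits: "(\<lambda>n. ?p n * indicator (C n) s) sums (indicator J s * ?X s)" for s
  proof (cases "s \<in> J")
    case True
    then have "c \<le> s" "s < c + L" using JL by auto
    then have "0 \<le> ?X s" "?X s < 1" using L by (auto simp: field_simps)
    from binary_expansion_sums[OF this] True show ?thesis
      by (simp add: C_def indicator_def of_bool_def)
  qed (simp add: C_def)
  have bnd: "\<bar>indicator J s * ?X s\<bar> \<le> 1" for s
    using JL L by (auto simp: indicator_def field_simps)
  \<comment> \<open>The same digits expand the scalar integrals, so the series for w and the
    polarized integrals can be compared term by term.\<close>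
  have integral_sums: "(\<lambda>n. ?p n * l2_inner M (E (C n) u) u) sums (\<integral>s. indicator J s * ?X s \<partial>\<mu> u)"
    if u: "u \<in> L2 M" for u
  proof -
    interpret finite_measure "\<mu> u" using u by (rule finite_scalar)
    have "(\<lambda>n. \<integral>s. ?p n * indicator (C n) s \<partial>\<mu> u) sums (\<integral>s. (\<Sum>n. ?p n * indicator (C n) s) \<partial>\<mu> u)"
    proof (rule sums_integral)
      show "integrable (\<mu> u) (\<lambda>s. ?p n * indicator (C n) s)" for n
        by (simp add: emeasure_eq_measure)
      show "AE s in \<mu> u. summable (\<lambda>n. norm (?p n * indicator (C n) s))"
        using sums_summable[OF digits] by (simp add: abs_mult)
      show "summable (\<lambda>n. \<integral>s. norm (?p n * indicator (C n) s) \<partial>\<mu> u)"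
      proof (rule summable_comparison_test'[where g = "\<lambda>n. ?p n * measure (\<mu> u) UNIV"])
        show "summable (\<lambda>n. ?p n * measure (\<mu> u) UNIV)"
          by (intro summable_mult2 sums_summable[OF power_half_series])
        fix n
        show "norm (\<integral>s. norm (?p n * indicator (C n) s) \<partial>\<mu> u) \<le> ?p n * measure (\<mu> u) UNIV"
          using bounded_measure[of "C n"] by (simp add: abs_mult)
      qed
    qed
    then show ?thesis
      using sums_unique[OF digits] u by (simp add: integral_indicator_scalar measure_scalar)
  qed
  obtain w where w: "w \<in> L2 M"
    and ws: "\<And>k. k \<in> L2 M \<Longrightarrow> (\<lambda>n. ?p n * l2_inner M (E (C n) f) k) sums l2_inner M w k"
    using L2_dyadic_series[of "\<lambda>n. E (C n) f" M "l2_norm M f"] C f E_L2 norm_E_le by blast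
  let ?g = "\<lambda>x. c * f x + L * w x"
  have g: "?g \<in> L2 M" by (intro L2_lincomb f w)
  have gk: "l2_inner M ?g k = c * l2_inner M f k + L * l2_inner M w k" if "k \<in> L2 M" for k
    using that f w by (intro l2_inner_lincomb_left)
  have "AE x in M. E J ?g x = ?g x"
  proof (rule l2_eqI[OF E_L2[OF J g] g])
    fix k assume k: "k \<in> L2 M"
    have EJk: "E J k \<in> L2 M" using J k by (rule E_L2)
    have "l2_inner M f (E J k) = l2_inner M f k"
      using E_sym[OF J f k] l2_inner_cong_AE[OF fJ E_L2[OF J f] f k] by simp
    moreover have "l2_inner M w (E J k) = l2_inner M w k"
    proof -
      have "l2_inner M (E (C n) f) (E J k) = l2_inner M (E (C n) f) k" for n
        using inner_E_E[OF C J f k] by (simp add: CJ)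
      then show ?thesis using ws[OF EJk] ws[OF k] by (simp add: sums_unique2)
    qed
    ultimately show "l2_inner M (E J ?g) k = l2_inner M ?g k"
      using E_sym[OF J g k] gk[OF EJk] gk[OF k] by simp
  qed
  moreover have "l2_inner M ?g k =
      ((\<integral>s. indicator J s * s \<partial>\<mu> (\<lambda>x. f x + k x)) - (\<integral>s. indicator J s * s \<partial>\<mu> (\<lambda>x. f x - k x))) / 4"
    if k: "k \<in> L2 M" for k
  proof -
    let ?P = "\<lambda>x. f x + k x" and ?Q = "\<lambda>x. f x - k x"
    have P: "?P \<in> L2 M" and Q: "?Q \<in> L2 M" using f k by (auto intro: L2_add L2_diff)
    have int: "(\<integral>s. indicator J s * s \<partial>\<mu> u) = c * l2_inner M (E J u) u + L * (\<integral>s. indicator J s * ?X s \<partial>\<mu> u)"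
      if u: "u \<in> L2 M" for u
    proof -
      have "(\<integral>s. indicator J s * s \<partial>\<mu> u) = (\<integral>s. c * indicator J s + L * (indicator J s * ?X s) \<partial>\<mu> u)"
        using L by (intro Bochner_Integration.integral_cong) (auto simp: field_simps)
      also have "\<dots> = c * (\<integral>s. indicator J s \<partial>\<mu> u) + L * (\<integral>s. indicator J s * ?X s \<partial>\<mu> u)"
      proof -
        have "integrable (\<mu> u) (indicator J :: real \<Rightarrow> real)"
          by (rule integrable_scalar_bounded[OF _ u, where K = 1]) (auto simp: indicator_def)
        moreover have "integrable (\<mu> u) (\<lambda>s. indicator J s * ?X s)"
          by (rule integrable_scalar_bounded[OF _ u bnd]) measurable
        ultimately show ?thesis by (simp only: Bochner_Integration.integral_add
          Bochner_Integration.integral_mult_right integrable_mult_right)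
      qed
      finally show ?thesis using measure_scalar[OF J u] by simp
    qed
    have pol: "l2_inner M (E B ?P) ?P - l2_inner M (E B ?Q) ?Q = 4 * l2_inner M (E B f) k"
      if "B \<in> sets borel" for B
      using measure_scalar_polar[OF that f k] that P Q by (simp add: measure_scalar)
    have "(\<lambda>n. ?p n * (l2_inner M (E (C n) ?P) ?P - l2_inner M (E (C n) ?Q) ?Q)) sums
        ((\<integral>s. indicator J s * ?X s \<partial>\<mu> ?P) - (\<integral>s. indicator J s * ?X s \<partial>\<mu> ?Q))"
      using sums_diff[OF integral_sums[OF P] integral_sums[OF Q]] by (simp add: right_diff_distrib)
    moreover have "(\<lambda>n. ?p n * (4 * l2_inner M (E (C n) f) k)) sums (4 * l2_inner M w k)"
      using sums_mult[OF ws[OF k], of 4] by (simp add: mult.left_commute)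
    ultimately have "(\<integral>s. indicator J s * ?X s \<partial>\<mu> ?P) - (\<integral>s. indicator J s * ?X s \<partial>\<mu> ?Q) = 4 * l2_inner M w k"
      unfolding pol[OF C] by (rule sums_unique2)
    moreover have "l2_inner M (E J f) k = l2_inner M f k"
      using l2_inner_cong_AE[OF fJ E_L2[OF J f] f k] .
    ultimately show ?thesis
      using pol[OF J] int[OF P] int[OF Q] gk[OF k] by (simp add: algebra_simps)
  qed
  ultimately show ?thesis using g that by blast
qed

text \<open>The vector built from the truncated integrand also satisfies the untruncated weak
  identity, because \<open>f\<close> has no spectral mass outside the interval. The bound holds
  because |s - a| \<le> N on the interval bounds the quadratic form of A - a, and polarization
  passes from the form to the norm.\<close>

lemma spectral_integral_on_interval:
  assumes N: "0 \<le> N" and f: "f \<in> L2 M" and fJ: "AE x in M. E {a-N..a+N} f x = f x"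
  obtains g where "(f, g) \<in> spectral_integral M E (\<lambda>s. s)" "AE x in M. E {a-N..a+N} g x = g x"
    "l2_norm M (\<lambda>x. g x - a * f x) \<le> N * l2_norm M f"
proof -
  define J where "J = {a-N..a+N}"
  have J[measurable]: "J \<in> sets borel" by (simp add: J_def)
  note fJ = fJ[folded J_def]
  obtain g where g: "g \<in> L2 M" and gJ: "AE x in M. E J g x = g x"
    and gk: "\<And>k. k \<in> L2 M \<Longrightarrow> l2_inner M g k =
      ((\<integral>s. indicator J s * s \<partial>\<mu> (\<lambda>x. f x + k x)) - (\<integral>s. indicator J s * s \<partial>\<mu> (\<lambda>x. f x - k x))) / 4"
  \<comment> \<open>The closed interval of length 2N must fit into a half-open one of positive
    length, also for N = 0; hence 2N + 1.\<close>
  proof (rule ex_L2_interval_integral[OF J f fJ, of "2 * N + 1" "a - N"])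
    show "0 < 2 * N + 1" "J \<subseteq> {a - N..<a - N + (2 * N + 1)}" using N by (auto simp: J_def)
  qed blast
  have "(f, g) \<in> spectral_integral M E (\<lambda>s. s)"
    unfolding spectral_integral_iff
  proof (intro conjI allI impI f g)
    let ?K = "(\<bar>a\<bar> + N)\<^sup>2"
    have "integrable (\<mu> f) (\<lambda>s. indicator J s * s\<^sup>2)"
    proof (rule integrable_scalar_bounded[OF _ f])
      fix s :: real
      have "\<bar>s\<bar> \<le> \<bar>a\<bar> + N" if "s \<in> J" using that by (auto simp: J_def)
      then have "s\<^sup>2 \<le> ?K" if "s \<in> J" using that power_mono[of "\<bar>s\<bar>" "\<bar>a\<bar> + N" 2] by simp
      then show "\<bar>indicator J s * s\<^sup>2\<bar> \<le> ?K" by (simp add: indicator_def)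
    qed measurable
    then have "integrable (\<mu> (E J f)) (\<lambda>s. s\<^sup>2)" using f by (simp add: integral_scalar_E)
    moreover have "\<mu> (E J f) = \<mu> f"
    proof (rule scalar_eqI[OF finite_scalar[OF f] _ E_L2[OF J f]])
      fix B :: "real set" assume B: "B \<in> sets borel"
      have "l2_inner M (E B (E J f)) (E J f) = l2_inner M (E J f) (E B (E J f))"
        by (rule l2_inner_commute)
      also have "\<dots> = l2_inner M f (E B (E J f))"
        using B f by (intro l2_inner_cong_AE fJ E_L2) auto
      also have "\<dots> = l2_inner M (E J f) (E B f)"
        using E_sym[OF B f E_L2[OF J f]] by (metis l2_inner_commute)
      also have "\<dots> = l2_inner M f (E B f)"
        using B f by (intro l2_inner_cong_AE fJ E_L2) auto
      finally show "measure (\<mu> (E J f)) B = measure (\<mu> f) B"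
        using B f by (simp add: measure_scalar E_L2 l2_inner_commute)
    qed simp
    ultimately show f2: "integrable (\<mu> f) (\<lambda>s. s\<^sup>2)" by simp
    fix k assume k: "k \<in> L2 M" and k2: "integrable (\<mu> k) (\<lambda>s. s\<^sup>2)"
    let ?P = "\<lambda>x. f x + k x" and ?Q = "\<lambda>x. f x - k x"
    have P: "?P \<in> L2 M" and Q: "?Q \<in> L2 M" using f k by (auto intro: L2_add L2_diff)
    have iP: "integrable (\<mu> ?P) (\<lambda>s. s)"
      by (rule integrable_scalar_if_square[OF _ P integrable_scalar_add_diff(1)[OF f k f2 k2]]) simp
    have iQ: "integrable (\<mu> ?Q) (\<lambda>s. s)"
      by (rule integrable_scalar_if_square[OF _ Q integrable_scalar_add_diff(2)[OF f k f2 k2]]) simp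
    have split: "(\<integral>s. s \<partial>\<mu> u) = (\<integral>s. indicator J s * s \<partial>\<mu> u) + (\<integral>s. s \<partial>\<mu> (E (-J) u))"
      if u: "u \<in> L2 M" and iu: "integrable (\<mu> u) (\<lambda>s. s)" for u
    proof -
      have "(\<integral>s. s \<partial>\<mu> u) = (\<integral>s. indicator J s * s + indicator (-J) s * s \<partial>\<mu> u)"
        by (intro Bochner_Integration.integral_cong) (auto simp: indicator_def)
      also have "\<dots> = (\<integral>s. indicator J s * s \<partial>\<mu> u) + (\<integral>s. indicator (-J) s * s \<partial>\<mu> u)"
        using integrable_mult_indicator[OF _ iu, of J] integrable_mult_indicator[OF _ iu, of "-J"]
        by (intro Bochner_Integration.integral_add) auto
      finally show ?thesis using u by (simp add: integral_scalar_E)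
    qed
    \<comment> \<open>Off \<open>J\<close> the measures of f + k and f - k coincide: their
      difference is 4 <E (B \<inter> -J) f, k>, and that projection of \<open>f\<close> vanishes.
      The outer parts therefore cancel in the polarized difference.\<close>
    have "\<mu> (E (-J) ?P) = \<mu> (E (-J) ?Q)"
    proof (rule scalar_eqI)
      fix B :: "real set" assume [measurable]: "B \<in> sets borel"
      have *: "measure (\<mu> (E (-J) u)) B = measure (\<mu> u) (B \<inter> -J)" if "u \<in> L2 M" for u
        using integral_scalar_E(1)[of "indicator B" "-J" u] that
        by (simp add: indicator_inter_arith[symmetric] Int_commute)
      have "measure (\<mu> ?P) (B \<inter> -J) - measure (\<mu> ?Q) (B \<inter> -J) = 4 * l2_inner M (E ((B \<inter> -J) \<inter> J) f) k"
        using measure_scalar_polar[of "B \<inter> -J" f k] inner_E_restrict[OF _ J f k fJ, of "B \<inter> -J"] f k by simp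
      also have "(B \<inter> -J) \<inter> J = {}" by auto
      also have "l2_inner M (E {} f) k = 0"
      proof -
        have "l2_inner M (E {} f) (E {} f) = 0"
          using f inner_E_E[of "{}" "{}" f f] measure_scalar[of "{}" f] by simp
        then have "l2_norm M (E {} f) = 0" by (simp add: l2_norm_def)
        then show ?thesis using l2_inner_Cauchy_Schwarz[OF E_L2[of "{}" f] k] f by simp
      qed
      finally show "measure (\<mu> (E (-J) ?P)) B = measure (\<mu> (E (-J) ?Q)) B"
        using * P Q by simp
    qed (use P Q finite_scalar E_L2 in auto)
    then show "l2_inner M g k = ((\<integral>s. s \<partial>\<mu> ?P) - (\<integral>s. s \<partial>\<mu> ?Q)) / 4"
      using gk[OF k] split[OF P iP] split[OF Q iQ] by simp
  qed
  moreover have "l2_norm M (\<lambda>x. g x - a * f x) \<le> N * l2_norm M f"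
  proof -
    let ?D = "\<lambda>x. 1 * g x + (- a) * f x"
    have D: "?D \<in> L2 M" by (intro L2_lincomb f g)
    \<comment> \<open>Polarization only yields a bound by the sum of the squared norms. The product
      bound is recovered by taking k = t D and choosing \<open>t\<close>.\<close>
    have Dk: "l2_inner M ?D k \<le> N / 2 * (l2_inner M f f + l2_inner M k k)" if k: "k \<in> L2 M" for k
    proof -
      let ?P = "\<lambda>x. f x + k x" and ?Q = "\<lambda>x. f x - k x"
      have P: "?P \<in> L2 M" and Q: "?Q \<in> L2 M" using f k by (auto intro: L2_add L2_diff)
      have bd: "\<bar>indicator J s * (s - a)\<bar> \<le> N" for s
        using N by (auto simp: J_def indicator_def)
      have int: "(\<integral>s. indicator J s * s \<partial>\<mu> u) - a * l2_inner M (E J u) u = (\<integral>s. indicator J s * (s - a) \<partial>\<mu> u)"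
        and le: "\<bar>\<integral>s. indicator J s * (s - a) \<partial>\<mu> u\<bar> \<le> N * l2_inner M u u" if u: "u \<in> L2 M" for u
      proof -
        interpret finite_measure "\<mu> u" using u by (rule finite_scalar)
        have i1: "integrable (\<mu> u) (\<lambda>s. indicator J s * (s - a))"
          by (rule integrable_scalar_bounded[OF _ u bd]) measurable
        have i2: "integrable (\<mu> u) (indicator J :: real \<Rightarrow> real)" by (simp add: emeasure_eq_measure)
        have "(\<integral>s. indicator J s * s \<partial>\<mu> u) = (\<integral>s. indicator J s * (s - a) + a * indicator J s \<partial>\<mu> u)"
          by (intro Bochner_Integration.integral_cong) (auto simp: algebra_simps)
        also have "\<dots> = (\<integral>s. indicator J s * (s - a) \<partial>\<mu> u) + a * l2_inner M (E J u) u"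
          using i1 i2 by (simp add: integral_indicator_scalar[OF J u, symmetric])
        finally show "(\<integral>s. indicator J s * s \<partial>\<mu> u) - a * l2_inner M (E J u) u = (\<integral>s. indicator J s * (s - a) \<partial>\<mu> u)"
          by simp
        have "\<bar>\<integral>s. indicator J s * (s - a) \<partial>\<mu> u\<bar> \<le> (\<integral>s. \<bar>indicator J s * (s - a)\<bar> \<partial>\<mu> u)"
          by (rule integral_abs_bound)
        also have "\<dots> \<le> (\<integral>s. N \<partial>\<mu> u)"
          using i1 bd by (intro integral_mono) auto
        finally show "\<bar>\<integral>s. indicator J s * (s - a) \<partial>\<mu> u\<bar> \<le> N * l2_inner M u u"
          using measure_scalar_UNIV[OF u] by (simp add: mult.commute)
      qed
      have "4 * l2_inner M ?D k = (\<integral>s. indicator J s * (s - a) \<partial>\<mu> ?P) - (\<integral>s. indicator J s * (s - a) \<partial>\<mu> ?Q)"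
      proof -
        have "l2_inner M ?D k = l2_inner M g k - a * l2_inner M f k"
          using l2_inner_lincomb_left[OF g f k, of 1 "-a"] by simp
        also have "l2_inner M f k = l2_inner M (E J f) k"
          using l2_inner_cong_AE[OF fJ E_L2[OF J f] f k] by simp
        finally have "l2_inner M ?D k = l2_inner M g k - a * l2_inner M (E J f) k" .
        moreover have "a * (4 * l2_inner M (E J f) k) = a * (l2_inner M (E J ?P) ?P - l2_inner M (E J ?Q) ?Q)"
          using measure_scalar_polar[OF J f k] P Q by (simp add: measure_scalar)
        ultimately show ?thesis
          unfolding int[OF P, symmetric] int[OF Q, symmetric] gk[OF k] by (simp add: algebra_simps)
      qed
      also have "\<dots> \<le> N * l2_inner M ?P ?P + N * l2_inner M ?Q ?Q"
        using le[OF P] le[OF Q] by linarith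
      also have "\<dots> = N * (2 * (l2_inner M f f + l2_inner M k k))"
      proof -
        have "l2_inner M ?P ?P + l2_inner M ?Q ?Q = 2 * (l2_inner M f f + l2_inner M k k)"
          using measure_scalar_parallelogram[of UNIV f k] P Q f k
          by (simp add: measure_scalar_UNIV algebra_simps)
        then show ?thesis by (metis distrib_left)
      qed
      finally show ?thesis by (simp add: field_simps)
    qed
    let ?F = "l2_norm M f" and ?W = "l2_norm M ?D"
    have t: "t * ?W\<^sup>2 \<le> N / 2 * (?F\<^sup>2 + t\<^sup>2 * ?W\<^sup>2)" for t
      unfolding l2_norm_square using Dk[of "\<lambda>x. t * ?D x"] L2_cmult[OF D, of t]
      by (simp add: l2_inner_cmult_left l2_inner_cmult_right power2_eq_square mult.assoc)
    have "?W \<le> N * ?F"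
    proof (cases "?W = 0")
      case True
      then show ?thesis using N l2_norm_nonneg[of M f] by simp
    next
      case False
      then have W: "0 < ?W" using l2_norm_nonneg[of M ?D] by linarith
      show ?thesis
      proof (cases "?F = 0")
        case True
        \<comment> \<open>For f of norm 0 the bound reads t \<le> (N / 2) t^2, which fails once N t
          \<le> 1; the choice 1 / (N + 1) also covers N = 0.\<close>
        define q where "q = 1 / (N + 1)"
        have q: "0 < q" "N * q \<le> 1" using N by (auto simp: q_def field_simps)
        have "q * ?W\<^sup>2 \<le> (N / 2 * q\<^sup>2) * ?W\<^sup>2" using t[of q] True by simp
        then have "q \<le> N / 2 * q\<^sup>2" using W by (simp only: mult_le_cancel_right_pos zero_less_power)
        also have "\<dots> = (N * q) * (q / 2)" by (simp add: power2_eq_square)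
        also have "\<dots> \<le> 1 * (q / 2)" using q by (intro mult_right_mono) auto
        finally have False using q by simp
        then show ?thesis ..
      next
        case False
        then have F: "0 < ?F" using l2_norm_nonneg[of M f] by linarith
        \<comment> \<open>The choice \<open>t = ?F / ?W\<close> makes the two squares on the right
          equal.\<close>
        have "?F * ?W \<le> ?F * (N * ?F)"
          using t[of "?F / ?W"] W by (simp add: power2_eq_square field_simps)
        then show ?thesis using F by simp
      qed
    qed
    then show ?thesis by simp
  qed
  ultimately show ?thesis using gJ that unfolding J_def by blast
qed

end

section \<open>Uniqueness of the spectral resolution\<close>

context pvm begin

text \<open>On \<open>B\<close> the function \<epsilon> (s - a) is at least m, hence m |E B u|^2
  \<le> \<epsilon> <(A - a) u, E B u>, and Cauchy-Schwarz removes one factor |E B u|. The sign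
  \<epsilon> treats sets to the right and to the left of \<open>a\<close> together.\<close>

lemma norm_E_le_shifted:
  assumes B[measurable]: "B \<in> sets borel" and ug: "(u, g) \<in> spectral_integral M E (\<lambda>s. s)"
    and \<epsilon>: "\<bar>\<epsilon>\<bar> = 1" and m: "0 < m" and far: "\<And>s. s \<in> B \<Longrightarrow> m \<le> \<epsilon> * (s - a)"
  shows "m * l2_norm M (E B u) \<le> l2_norm M (E B (\<lambda>x. g x - a * u x))"
proof -
  let ?D = "\<lambda>x. 1 * g x + (- a) * u x"
  have u: "u \<in> L2 M" and g: "g \<in> L2 M" and u2: "integrable (\<mu> u) (\<lambda>s. s\<^sup>2)"
    using ug by (auto simp: spectral_integral_iff)
  have D: "?D \<in> L2 M" by (intro L2_lincomb g u)
  have Bu: "E B u \<in> L2 M" using B u by (rule E_L2)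
  interpret finite_measure "\<mu> u" using u by (rule finite_scalar)
  have iu: "integrable (\<mu> u) (\<lambda>s. s)" by (rule integrable_scalar_if_square[OF _ u u2]) simp
  have iB: "integrable (\<mu> u) (\<lambda>s. indicator B s * s)"
    using integrable_mult_indicator[OF _ iu, of B] by simp
  have iB1: "integrable (\<mu> u) (indicator B :: real \<Rightarrow> real)" by (simp add: emeasure_eq_measure)
  have uBu: "l2_inner M u (E B u) = l2_inner M (E B u) (E B u)"
    using inner_E_E[OF B B u u] by (simp add: l2_inner_commute)
  have muB: "measure (\<mu> u) B = (l2_norm M (E B u))\<^sup>2"
    using uBu B u by (simp add: measure_scalar l2_norm_square l2_inner_commute)
  have "m * (l2_norm M (E B u))\<^sup>2 = (\<integral>s. m * indicator B s \<partial>\<mu> u)"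
    by (simp add: muB)
  also have "\<dots> \<le> (\<integral>s. \<epsilon> * (indicator B s * s - a * indicator B s) \<partial>\<mu> u)"
  proof (rule integral_mono)
    show "m * indicator B s \<le> \<epsilon> * (indicator B s * s - a * indicator B s)" for s
      using far[of s] by (simp add: indicator_def algebra_simps)
  qed (use iB iB1 in auto)
  also have "\<dots> = \<epsilon> * ((\<integral>s. indicator B s * s \<partial>\<mu> u) - a * measure (\<mu> u) B)"
    using iB iB1 by simp
  also have "\<dots> = \<epsilon> * l2_inner M ?D (E B u)"
    using spectral_integral_inner_E[OF _ B ug] l2_inner_lincomb_left[OF g u Bu, of 1 "-a"] uBu
    by (simp add: muB l2_norm_square)
  also have "l2_inner M ?D (E B u) = l2_inner M (E B ?D) (E B u)"
    using inner_E_E[OF B B D u] E_sym[OF B D u] by simp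
  also have "\<epsilon> * \<dots> \<le> \<bar>l2_inner M (E B ?D) (E B u)\<bar>"
    using \<epsilon> by (metis abs_ge_self abs_mult mult_1)
  also have "\<dots> \<le> l2_norm M (E B ?D) * l2_norm M (E B u)"
    by (rule l2_inner_Cauchy_Schwarz[OF E_L2[OF B D] Bu])
  finally have *: "(m * l2_norm M (E B u)) * l2_norm M (E B u) \<le> l2_norm M (E B ?D) * l2_norm M (E B u)"
    by (simp add: power2_eq_square mult.assoc)
  show ?thesis
  proof (cases "l2_norm M (E B u) = 0")
    case True
    then show ?thesis using l2_norm_nonneg[of M] by simp
  next
    case False
    then have "0 < l2_norm M (E B u)" using l2_norm_nonneg[of M "E B u"] by linarith
    then show ?thesis using * by simp
  qed
qed

text \<open>Expanding the square, |E J f - f|^2 = |f|^2 - <E J f, f>, which is the spectral mass of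
  \<open>f\<close> outside \<open>J\<close>.\<close>

lemma E_eq_if_null_Compl:
  assumes J: "J \<in> sets borel" and f: "f \<in> L2 M" and null: "measure (\<mu> f) (-J) = 0"
  shows "AE x in M. E J f x = f x"
proof -
  interpret finite_measure "\<mu> f" using f by (rule finite_scalar)
  have "measure (\<mu> f) J = measure (\<mu> f) UNIV"
    using null J finite_measure_compl[of J] by (simp add: Compl_eq_Diff_UNIV)
  then have Jf: "l2_inner M (E J f) f = l2_inner M f f"
    using J f by (simp add: measure_scalar_UNIV) (simp add: measure_scalar)
  have JJ: "l2_inner M (E J f) (E J f) = l2_inner M (E J f) f"
    using inner_E_E[OF J J f f] by simp
  let ?d = "\<lambda>x. E J f x - f x"
  note L = E_L2[OF J f] f
  have "l2_inner M ?d ?d = 0"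
    using l2_inner_diff_left[OF L L2_diff[OF L]] l2_inner_diff_right[OF L L(1)] l2_inner_diff_right[OF L L(2)]
      Jf JJ l2_inner_commute[of M f "E J f"] by simp
  from l2_inner_self_zero_imp_AE[OF L2_diff[OF L] this] show ?thesis by simp
qed

end

text \<open>On the range of \<open>E [a-N, a+N]\<close> the shifted operator \<open>A - a\<close> acts with norm at most \<open>N\<close>, while a
  component of spectral distance more than \<open>N\<close> from \<open>a\<close> would be stretched by more than \<open>N\<close>.\<close>

lemma E_interval_transfer:
  assumes "pvm M E" "pvm M E'"
    and eq: "spectral_integral M E (\<lambda>s. s) = spectral_integral M E' (\<lambda>s. s)"
    and N: "0 \<le> N" and f: "f \<in> L2 M" and fJ: "AE x in M. E {a-N..a+N} f x = f x"
  shows "AE x in M. E' {a-N..a+N} f x = f x"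
proof -
  interpret E: pvm M E by fact
  interpret E': pvm M E' by fact
  let ?J = "{a-N..a+N}"
  have zero: "l2_norm M (E' B f) = 0"
    if B: "B \<in> sets borel" and \<epsilon>: "\<bar>\<epsilon>\<bar> = 1" and m: "N < m" and far: "\<And>s. s \<in> B \<Longrightarrow> m \<le> \<epsilon> * (s - a)"
    for B \<epsilon> m
  proof -
    have m0: "0 < m" using N m by simp
    \<comment> \<open>Each round trades \<open>u\<close> for (A - a) u, which stays in the range of
      \<open>E ?J\<close>, and gains the factor N / m < 1; so \<open>u\<close> varies in the
      induction. Letting \<open>k\<close> grow forces the component to vanish.\<close>
    have bound: "l2_norm M (E' B u) \<le> (N / m) ^ k * l2_norm M u"
      if "u \<in> L2 M" "AE x in M. E ?J u x = u x" for u k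
      using that
    proof (induction k arbitrary: u)
      case 0
      then show ?case using E'.norm_E_le[OF B] by simp
    next
      case (Suc k)
      obtain g where g: "(u, g) \<in> spectral_integral M E (\<lambda>s. s)" "AE x in M. E ?J g x = g x"
        and le: "l2_norm M (\<lambda>x. g x - a * u x) \<le> N * l2_norm M u"
        using E.spectral_integral_on_interval[OF N Suc.prems] .
      have gL: "g \<in> L2 M" using g(1) by (simp add: E.spectral_integral_iff)
      let ?D = "\<lambda>x. 1 * g x + (- a) * u x"
      have D: "?D \<in> L2 M" by (intro L2_lincomb gL Suc.prems)
      have "AE x in M. E ?J ?D x = 1 * E ?J g x + (- a) * E ?J u x"
        by (rule E.E_lincomb[OF _ gL Suc.prems(1)]) simp
      with g(2) Suc.prems(2) have DJ: "AE x in M. E ?J ?D x = ?D x" by eventually_elim simp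
      have "m * l2_norm M (E' B u) \<le> l2_norm M (E' B ?D)"
        using E'.norm_E_le_shifted[OF B _ \<epsilon> m0 far, of u g] g(1) eq by simp
      also have "\<dots> \<le> (N / m) ^ k * l2_norm M ?D" by (rule Suc.IH[OF D DJ])
      also have "\<dots> \<le> (N / m) ^ k * (N * l2_norm M u)"
        using le N m0 by (intro mult_left_mono) auto
      finally show ?case using m0 by (simp add: field_simps)
    qed
    have "(\<lambda>k. (N / m) ^ k * l2_norm M f) \<longlonglongrightarrow> 0 * l2_norm M f"
      using N m m0 by (intro tendsto_mult LIMSEQ_power_zero tendsto_const) auto
    then have "l2_norm M (E' B f) \<le> 0 * l2_norm M f"
      by (rule LIMSEQ_le_const) (use bound[OF f fJ] in auto)
    then show ?thesis using l2_norm_nonneg[of M "E' B f"] by simp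
  qed
  interpret finite_measure "E'.\<mu> f" using f by (rule E'.finite_scalar)
  have null: "B \<in> null_sets (E'.\<mu> f)"
    if B: "B \<in> sets borel" and \<epsilon>: "\<bar>\<epsilon>\<bar> = 1" and m: "N < m" and far: "\<And>s. s \<in> B \<Longrightarrow> m \<le> \<epsilon> * (s - a)"
    for B \<epsilon> m
  proof -
    have "measure (E'.\<mu> f) B = (l2_norm M (E' B f))\<^sup>2"
      using E'.inner_E_E[OF B B f f] B f by (simp add: E'.measure_scalar l2_norm_square)
    then show ?thesis using zero[OF that] B by (auto intro!: null_setsI simp: emeasure_eq_measure)
  qed
  \<comment> \<open>The ratio N / m is below 1 only with a strict gap, so the complement of the
    interval is exhausted by countably many sets at distance at least N + 1 / (i + 1) from
    \<open>a\<close>.\<close>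
  let ?B = "\<lambda>\<epsilon> i. {s. N + 1 / real (Suc i) \<le> \<epsilon> * (s - a)}"
  have J_eq: "- ?J = (\<Union>i. ?B 1 i) \<union> (\<Union>i. ?B (-1) i)"
  proof (intro equalityI subsetI)
    fix s assume "s \<in> - ?J"
    then have "N < s - a \<or> N < - 1 * (s - a)" by auto
    moreover have "\<exists>i. N + 1 / real (Suc i) \<le> t" if "N < t" for t
    proof -
      obtain i where "inverse (real (Suc i)) < t - N" using reals_Archimedean[of "t - N"] \<open>N < t\<close> by (auto simp del: of_nat_Suc)
      then show ?thesis by (intro exI[of _ i]) (simp add: inverse_eq_divide del: of_nat_Suc)
    qed
    ultimately show "s \<in> (\<Union>i. ?B 1 i) \<union> (\<Union>i. ?B (-1) i)" by force
  next
    fix s assume "s \<in> (\<Union>i. ?B 1 i) \<union> (\<Union>i. ?B (-1) i)"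
    then have "(\<exists>i. s \<in> ?B 1 i) \<or> (\<exists>i. s \<in> ?B (-1) i)" by blast
    then obtain i where "N + 1 / real (Suc i) \<le> \<bar>s - a\<bar>"
    proof (elim disjE exE)
      fix i assume "s \<in> ?B 1 i" "\<And>i. N + 1 / real (Suc i) \<le> \<bar>s - a\<bar> \<Longrightarrow> thesis"
      moreover have "1 * (s - a) \<le> \<bar>s - a\<bar>" by simp
      ultimately show thesis using order_trans by blast
    next
      fix i assume "s \<in> ?B (-1) i" "\<And>i. N + 1 / real (Suc i) \<le> \<bar>s - a\<bar> \<Longrightarrow> thesis"
      moreover have "- 1 * (s - a) \<le> \<bar>s - a\<bar>" by simp
      ultimately show thesis using order_trans by blast
    qed
    moreover have "0 < 1 / real (Suc i)" by simp
    ultimately have "N < \<bar>s - a\<bar>" by linarith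
    then show "s \<in> - ?J" by auto
  qed
  have B_null: "?B \<epsilon> i \<in> null_sets (E'.\<mu> f)" if "\<bar>\<epsilon>\<bar> = 1" for \<epsilon> i
    by (rule null[OF _ that, of _ "N + 1 / real (Suc i)"]) auto
  have "(\<Union>i. ?B 1 i) \<union> (\<Union>i. ?B (-1) i) \<in> null_sets (E'.\<mu> f)"
    by (intro null_sets.Un null_sets_UN B_null) simp_all
  then have "- ?J \<in> null_sets (E'.\<mu> f)" unfolding J_eq .
  then have "measure (E'.\<mu> f) (- ?J) = 0" by (auto simp: measure_def)
  then show ?thesis using f by (intro E'.E_eq_if_null_Compl) auto
qed

text \<open>The transfer in both directions shows that E' J fixes E J f and E J fixes E' J f; by
  symmetry of the projections <E J f, f> = <f, E J (E' J f)> = <E' J f, f>. Closed intervals are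
  stable under intersection and generate the Borel sets.\<close>

lemma scalar_spectral_measure_unique:
  assumes "pvm M E" "pvm M E'"
    and eq: "spectral_integral M E (\<lambda>s. s) = spectral_integral M E' (\<lambda>s. s)"
    and f: "f \<in> L2 M"
  shows "scalar_spectral_measure M E f = scalar_spectral_measure M E' f"
proof -
  interpret E: pvm M E by fact
  interpret E': pvm M E' by fact
  have inner: "l2_inner M (E {c..d} f) f = l2_inner M (E' {c..d} f) f" if "c \<le> d" for c d
  proof -
    \<comment> \<open>Midpoint and half-length bring the interval into the form used by the
      transfer.\<close>
    define a N where "a = (c + d) / 2" and "N = (d - c) / 2"
    have N: "0 \<le> N" using that by (simp add: N_def)
    define J where "J = {a-N..a+N}"
    have J: "J \<in> sets borel" by (simp add: J_def)
    have cd: "{c..d} = J" by (simp add: J_def a_def N_def field_simps)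
    note L = E.E_L2[OF J f] E'.E_L2[OF J f]
    have "AE x in M. E J (E J f) x = E J f x"
      using E.proj[OF J] f by (simp add: orthogonal_projection_def)
    then have 1: "AE x in M. E' J (E J f) x = E J f x"
      using E_interval_transfer[OF assms(1,2) eq N L(1)] unfolding J_def by blast
    have "AE x in M. E' J (E' J f) x = E' J f x"
      using E'.proj[OF J] f by (simp add: orthogonal_projection_def)
    then have 2: "AE x in M. E J (E' J f) x = E' J f x"
      using E_interval_transfer[OF assms(2,1) eq[symmetric] N L(2)] unfolding J_def by blast
    have "l2_inner M (E J f) f = l2_inner M (E' J (E J f)) f"
      by (rule l2_inner_cong_AE[OF 1 E'.E_L2[OF J L(1)] L(1) f, symmetric])
    also have "\<dots> = l2_inner M f (E J (E' J f))"
      using E'.E_sym[OF J L(1) f] E.E_sym[OF J f L(2)] by simp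
    also have "\<dots> = l2_inner M (E' J f) f"
      using l2_inner_cong_AE[OF 2 E.E_L2[OF J L(2)] L(2) f] by (metis l2_inner_commute)
    finally show ?thesis unfolding cd .
  qed
  show ?thesis
  proof (rule measure_eqI_generator_eq)
    let ?G = "range (\<lambda>(c, d). {c..d::real})"
    show "Int_stable ?G" by (force simp: Int_stable_def)
    show "?G \<subseteq> Pow UNIV" by simp
    show "sets (E.\<mu> f) = sigma_sets UNIV ?G" "sets (E'.\<mu> f) = sigma_sets UNIV ?G"
      by (simp_all add: borel_eq_atLeastAtMost)
    show "range (\<lambda>n. {- real n..real n}) \<subseteq> ?G" by auto
    show "(\<Union>n. {- real n..real n}) = UNIV"
    proof -
      have "s \<in> {- real (nat \<lceil>\<bar>s\<bar>\<rceil>)..real (nat \<lceil>\<bar>s\<bar>\<rceil>)}" for s by (simp, linarith)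
      then show ?thesis by blast
    qed
    show "emeasure (E.\<mu> f) {- real n..real n} \<noteq> \<infinity>" for n
      using f by (simp add: E.emeasure_scalar)
    fix X assume "X \<in> ?G"
    then obtain c d where X: "X = {c..d}" by auto
    show "emeasure (E.\<mu> f) X = emeasure (E'.\<mu> f) X"
      using inner[of c d] f unfolding X
      by (cases "c \<le> d") (simp_all add: E.emeasure_scalar E'.emeasure_scalar)
  qed
qed

text \<open>The two values may be witnessed by different resolutions. As the weak identity involves
  only scalar spectral measures, which agree, both values belong to one and the same
  \<open>spectral_integral\<close>.\<close>

lemma functional_calculus_functional:
  assumes h: "h \<in> borel_measurable borel"
    and fg: "(f, g) \<in> functional_calculus M A h" and fg': "(f, g') \<in> functional_calculus M A h"
  shows "AE x in M. g x = g' x"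
proof -
  obtain E E' where E: "spectral_resolution M A E" "(f, g) \<in> spectral_integral M E h"
    and E': "spectral_resolution M A E'" "(f, g') \<in> spectral_integral M E' h"
    using fg fg' by (auto simp: functional_calculus_def)
  have p: "pvm M E" "pvm M E'" using E(1) E'(1) by (auto simp: spectral_resolution_def pvm_def)
  have "spectral_integral M E (\<lambda>s. s) = spectral_integral M E' (\<lambda>s. s)"
    using E(1) E'(1) by (simp add: spectral_resolution_def)
  from scalar_spectral_measure_unique[OF p this]
  have \<mu>: "scalar_spectral_measure M E u = scalar_spectral_measure M E' u" if "u \<in> L2 M" for u
    using that .
  have "(f, g') \<in> spectral_integral M E h"
    using E'(2) unfolding pvm.spectral_integral_iff[OF p(1)] pvm.spectral_integral_iff[OF p(2)]
    by (auto simp: \<mu> L2_add L2_diff)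
  with E(2) show ?thesis by (rule pvm.spectral_integral_functional[OF p(1) h])
qed

section \<open>Dilation of spectral resolutions\<close>

text \<open>\<open>K\<close> is the Jacobian of \<open>T\<close>: the integral of f is
  \<open>K\<close> times the integral of f composed with \<open>T\<close>. Writing this with
  \<open>density\<close> and \<open>distr\<close> matches the affine change of variables for
  Lebesgue measure.\<close>

definition scales_measure :: "'a measure \<Rightarrow> ('a \<Rightarrow> 'a) \<Rightarrow> real \<Rightarrow> bool" where
  "scales_measure M T K \<longleftrightarrow> T \<in> M \<rightarrow>\<^sub>M M \<and> 0 < K \<and> M = density (distr M M T) (\<lambda>_. ennreal K)"

context
  fixes M :: "'a measure" and T K
  assumes T: "scales_measure M T K"
begin

lemma scales_measure_measurable: "T \<in> M \<rightarrow>\<^sub>M M"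
  using T by (simp add: scales_measure_def)

lemma scales_measure_pos: "0 < K"
  using T by (simp add: scales_measure_def)

lemma scales_measure_eq: "M = density (distr M M T) (\<lambda>_. ennreal K)"
  using T by (simp add: scales_measure_def)

lemma scales_measure_AE:
  assumes "AE x in M. Q x" shows "AE x in M. Q (T x)"
proof -
  have "AE x in density (distr M M T) (\<lambda>_. ennreal K). Q x"
    by (subst scales_measure_eq[symmetric]) (rule assms)
  then have "AE x in distr M M T. Q x"
    using scales_measure_pos by (subst (asm) AE_density) auto
  then show ?thesis by (rule AE_distrD[OF scales_measure_measurable])
qed

lemma scales_measure_integral:
  fixes f :: "'a \<Rightarrow> real"
  assumes f: "f \<in> borel_measurable M"
  shows "integrable M (\<lambda>x. f (T x)) \<longleftrightarrow> integrable M f" "(\<integral>x. f (T x) \<partial>M) = (\<integral>x. f x \<partial>M) / K"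
proof -
  note [measurable] = scales_measure_measurable f
  have K: "0 < K" by (rule scales_measure_pos)
  have "integrable M f \<longleftrightarrow> integrable (density (distr M M T) (\<lambda>_. ennreal K)) f"
    using scales_measure_eq by simp
  also have "\<dots> \<longleftrightarrow> integrable M (\<lambda>x. f (T x))"
    using K by (simp add: integrable_density integrable_distr_eq)
  finally show "integrable M (\<lambda>x. f (T x)) \<longleftrightarrow> integrable M f" ..
  have "(\<integral>x. f x \<partial>M) = (\<integral>x. f x \<partial>density (distr M M T) (\<lambda>_. ennreal K))"
    using scales_measure_eq by simp
  also have "\<dots> = K * (\<integral>x. f (T x) \<partial>M)"
    using K by (simp add: integral_density integral_distr)
  finally show "(\<integral>x. f (T x) \<partial>M) = (\<integral>x. f x \<partial>M) / K" using K by simp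
qed

lemma scales_measure_L2: "f \<in> L2 M \<Longrightarrow> (\<lambda>x. f (T x)) \<in> L2 M"
  using scales_measure_integral(1)[of "\<lambda>x. (f x)\<^sup>2"] scales_measure_measurable
  by (auto simp: L2_def)

lemma scales_measure_inner:
  assumes "f \<in> borel_measurable M" "g \<in> borel_measurable M"
  shows "l2_inner M (\<lambda>x. f (T x)) (\<lambda>x. g (T x)) = l2_inner M f g / K"
  using scales_measure_integral(2)[of "\<lambda>x. f x * g x"] assms by (simp add: l2_inner_def)

lemma scales_measure_norm:
  assumes "f \<in> borel_measurable M"
  shows "l2_norm M (\<lambda>x. f (T x)) = l2_norm M f / sqrt K"
  using scales_measure_inner[OF assms assms] by (simp add: l2_norm_def real_sqrt_divide)

end

lemma (in pvm) spectral_integral_cmult: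
  assumes "c \<noteq> 0"
  shows "(f, \<lambda>x. c * g x) \<in> spectral_integral M E (\<lambda>s. c * h s) \<longleftrightarrow> (f, g) \<in> spectral_integral M E h"
proof -
  have "(\<lambda>x. c * g x) \<in> L2 M \<longleftrightarrow> g \<in> L2 M"
    using L2_cmult[of g M c] L2_cmult[of "\<lambda>x. c * g x" M "1/c"] assms by auto
  moreover have "integrable (\<mu> u) (\<lambda>s. (c * h s)\<^sup>2) \<longleftrightarrow> integrable (\<mu> u) (\<lambda>s. (h s)\<^sup>2)" for u
    using assms by (simp add: power_mult_distrib)
  ultimately show ?thesis
    using assms unfolding spectral_integral_iff
    by (simp add: l2_inner_cmult_left right_diff_distrib[symmetric] del: times_divide_eq_right)
qed

locale pvm_dilation = pvm M E for M :: "'a measure" and E +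
  fixes T T' :: "'a \<Rightarrow> 'a" and K K' \<rho> :: real
  assumes T: "scales_measure M T K" and T': "scales_measure M T' K'"
    and TT' [simp]: "\<And>x. T (T' x) = x" and T'T [simp]: "\<And>x. T' (T x) = x"
    and \<rho>: "0 < \<rho>"
begin

text \<open>Conjugation of \<open>E\<close> by composition with \<open>T\<close>, which multiplies
  all norms by the same factor 1 / sqrt K; the preimage is B / \<rho>, so the spectrum is stretched
  by \<rho>.\<close>

definition E_dil :: "real set \<Rightarrow> ('a \<Rightarrow> real) \<Rightarrow> ('a \<Rightarrow> real)" where
  "E_dil B f = (\<lambda>x. E ((\<lambda>s. \<rho> * s) -` B) (\<lambda>y. f (T' y)) (T x))"

lemma vimage_borel: "B \<in> sets borel \<Longrightarrow> (\<lambda>s. \<rho> * s) -` B \<in> sets borel"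
  using measurable_sets[of "\<lambda>s. \<rho> * s" borel borel B] by simp

lemma inner_T:
  assumes "f \<in> L2 M" "g \<in> L2 M"
  shows "l2_inner M (\<lambda>x. f (T x)) g = l2_inner M f (\<lambda>x. g (T' x)) / K"
  using scales_measure_inner[OF T, of f "\<lambda>x. g (T' x)"] assms scales_measure_L2[OF T']
  by (simp add: L2_measurable)

lemma E_dil_L2:
  assumes "B \<in> sets borel" "f \<in> L2 M" shows "E_dil B f \<in> L2 M"
  unfolding E_dil_def using assms
  by (intro scales_measure_L2[OF T] E_L2 vimage_borel scales_measure_L2[OF T'])

lemma pvm_E_dil: "pvm M E_dil"
proof
  let ?m = "\<lambda>B. (\<lambda>s. \<rho> * s) -` B"
  note L2T' = scales_measure_L2[OF T'] and AET = scales_measure_AE[OF T]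
  show "projection_valued_measure M E_dil"
    unfolding projection_valued_measure_def
  proof (intro conjI ballI allI impI)
    fix B :: "real set" assume B: "B \<in> sets borel"
    note mB = vimage_borel[OF B]
    show "orthogonal_projection M (E_dil B)"
      unfolding orthogonal_projection_def
    proof (intro conjI ballI allI)
      fix f assume f: "f \<in> L2 M"
      show "E_dil B f \<in> L2 M" by (rule E_dil_L2[OF B f])
      have "AE x in M. E (?m B) (E (?m B) (\<lambda>y. f (T' y))) x = E (?m B) (\<lambda>y. f (T' y)) x"
        using proj[OF mB] L2T'[OF f] by (simp add: orthogonal_projection_def)
      from AET[OF this] show "AE x in M. E_dil B (E_dil B f) x = E_dil B f x"
        by (simp add: E_dil_def)
      fix g assume g: "g \<in> L2 M"
      show "AE x in M. E_dil B (\<lambda>y. a * f y + b * g y) x = a * E_dil B f x + b * E_dil B g x" for a b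
        using AET[OF E_lincomb[OF mB L2T'[OF f] L2T'[OF g], of a b]] by (simp add: E_dil_def)
      have "l2_inner M (E_dil B f) g = l2_inner M (E (?m B) (\<lambda>y. f (T' y))) (\<lambda>x. g (T' x)) / K"
        unfolding E_dil_def by (rule inner_T[OF E_L2[OF mB L2T'[OF f]] g])
      also have "\<dots> = l2_inner M (E (?m B) (\<lambda>x. g (T' x))) (\<lambda>y. f (T' y)) / K"
        using E_sym[OF mB L2T'[OF f] L2T'[OF g]] by (simp add: l2_inner_commute)
      also have "\<dots> = l2_inner M (E_dil B g) f"
        unfolding E_dil_def by (rule inner_T[OF E_L2[OF mB L2T'[OF g]] f, symmetric])
      finally show "l2_inner M (E_dil B f) g = l2_inner M f (E_dil B g)" by (simp add: l2_inner_commute)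
    qed
    fix C :: "real set" and f assume C: "C \<in> sets borel" and f: "f \<in> L2 M"
    show "AE x in M. E_dil (B \<inter> C) f x = E_dil B (E_dil C f) x"
      using AET[OF E_Int[OF mB vimage_borel[OF C] L2T'[OF f]]] by (simp add: E_dil_def)
  next
    fix f assume f: "f \<in> L2 M"
    show "AE x in M. E_dil UNIV f x = f x"
      using AET[OF E_UNIV[OF L2T'[OF f]]] by (simp add: E_dil_def)
  next
    fix D :: "nat \<Rightarrow> real set" and f
    assume D: "range D \<subseteq> sets borel" "disjoint_family D" and f: "f \<in> L2 M"
    let ?F = "\<lambda>y. f (T' y)"
    have mD: "range (\<lambda>i. ?m (D i)) \<subseteq> sets borel" using D(1) vimage_borel by auto
    have "disjoint_family (\<lambda>i. ?m (D i))" using D(2) by (fastforce simp: disjoint_family_on_def)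
    with mD L2T'[OF f] have lim:
      "(\<lambda>N. l2_norm M (\<lambda>x. E (\<Union>i. ?m (D i)) ?F x - (\<Sum>i<N. E (?m (D i)) ?F x))) \<longlonglongrightarrow> 0"
      using pvm unfolding projection_valued_measure_def by blast
    have "l2_norm M (\<lambda>x. E_dil (\<Union>i. D i) f x - (\<Sum>i<N. E_dil (D i) f x)) =
        l2_norm M (\<lambda>x. E (\<Union>i. ?m (D i)) ?F x - (\<Sum>i<N. E (?m (D i)) ?F x)) / sqrt K" for N
    proof -
      have "(\<lambda>x. E (\<Union>i. ?m (D i)) ?F x - (\<Sum>i<N. E (?m (D i)) ?F x)) \<in> L2 M"
        using mD L2T'[OF f] by (intro L2_diff L2_sum E_L2 sets.countable_UN) auto
      from scales_measure_norm[OF T L2_measurable[OF this]] show ?thesis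
        by (simp add: E_dil_def vimage_UN)
    qed
    with tendsto_divide[OF lim tendsto_const[of "sqrt K"]] scales_measure_pos[OF T]
    show "(\<lambda>N. l2_norm M (\<lambda>x. E_dil (\<Union>i. D i) f x - (\<Sum>i<N. E_dil (D i) f x))) \<longlonglongrightarrow> 0"
      by simp
  qed
qed

sublocale E_dil: pvm M E_dil by (rule pvm_E_dil)

text \<open>The push-forward stretches the spectrum by \<rho>, and 1 / K is the factor by which
  composition with \<open>T\<close> changes inner products.\<close>

lemma scalar_E_dil:
  assumes u: "u \<in> L2 M"
  shows "E_dil.\<mu> (\<lambda>x. u (T x)) = density (distr (\<mu> u) borel (\<lambda>s. \<rho> * s)) (\<lambda>_. ennreal (1 / K))"
proof (rule E_dil.scalar_eqI)
  have K: "0 < K" by (rule scales_measure_pos[OF T])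
  have uT: "(\<lambda>x. u (T x)) \<in> L2 M" by (rule scales_measure_L2[OF T u])
  then show "(\<lambda>x. u (T x)) \<in> L2 M" .
  interpret finite_measure "\<mu> u" using u by (rule finite_scalar)
  have em: "emeasure (density (distr (\<mu> u) borel (\<lambda>s. \<rho> * s)) (\<lambda>_. ennreal (1 / K))) B =
      ennreal (measure (\<mu> u) ((\<lambda>s. \<rho> * s) -` B) / K)" if "B \<in> sets borel" for B
    using that K by (simp add: emeasure_density nn_integral_cmult emeasure_distr emeasure_eq_measure
        ennreal_mult[symmetric])
  show "finite_measure (density (distr (\<mu> u) borel (\<lambda>s. \<rho> * s)) (\<lambda>_. ennreal (1 / K)))"
    using em[of UNIV] by (intro finite_measureI) simp
  fix B :: "real set" assume B: "B \<in> sets borel"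
  have "measure (E_dil.\<mu> (\<lambda>x. u (T x))) B = l2_inner M (E ((\<lambda>s. \<rho> * s) -` B) u) u / K"
    using inner_T[OF E_L2[OF vimage_borel[OF B] u] uT] B uT
    by (simp add: E_dil.measure_scalar E_dil_def)
  then show "measure (E_dil.\<mu> (\<lambda>x. u (T x))) B =
      measure (density (distr (\<mu> u) borel (\<lambda>s. \<rho> * s)) (\<lambda>_. ennreal (1 / K))) B"
    using em[OF B] K by (simp add: measure_def[of "density _ _"] measure_scalar[OF vimage_borel[OF B] u, symmetric])
qed simp

lemma integral_scalar_E_dil:
  fixes h :: "real \<Rightarrow> real"
  assumes [measurable]: "h \<in> borel_measurable borel" and u: "u \<in> L2 M"
  shows "(\<integral>s. h s \<partial>E_dil.\<mu> (\<lambda>x. u (T x))) = (\<integral>s. h (\<rho> * s) \<partial>\<mu> u) / K"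
    and "integrable (E_dil.\<mu> (\<lambda>x. u (T x))) h \<longleftrightarrow> integrable (\<mu> u) (\<lambda>s. h (\<rho> * s))"
proof -
  have K: "0 < K" by (rule scales_measure_pos[OF T])
  then show "(\<integral>s. h s \<partial>E_dil.\<mu> (\<lambda>x. u (T x))) = (\<integral>s. h (\<rho> * s) \<partial>\<mu> u) / K"
    unfolding scalar_E_dil[OF u] by (simp add: integral_density integral_distr)
  have "integrable (E_dil.\<mu> (\<lambda>x. u (T x))) h \<longleftrightarrow> integrable (\<mu> u) (\<lambda>s. 1 / K * h (\<rho> * s))"
    unfolding scalar_E_dil[OF u] using K by (simp add: integrable_density integrable_distr_eq)
  then show "integrable (E_dil.\<mu> (\<lambda>x. u (T x))) h \<longleftrightarrow> integrable (\<mu> u) (\<lambda>s. h (\<rho> * s))"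
    using K by (simp only: integrable_mult_left_iff) simp
qed

lemma spectral_integral_E_dil:
  fixes h :: "real \<Rightarrow> real"
  assumes h[measurable]: "h \<in> borel_measurable borel"
  shows "((\<lambda>x. f (T x)), (\<lambda>x. g (T x))) \<in> spectral_integral M E_dil h \<longleftrightarrow>
    (f, g) \<in> spectral_integral M E (\<lambda>s. h (\<rho> * s))"
proof -
  have L2T: "(\<lambda>x. u (T x)) \<in> L2 M \<longleftrightarrow> u \<in> L2 M" for u
    using scales_measure_L2[OF T, of u] scales_measure_L2[OF T', of "\<lambda>x. u (T x)"] by auto
  have K: "0 < K" by (rule scales_measure_pos[OF T])
  \<comment> \<open>As \<open>T\<close> is invertible, every test vector is some k composed with
    \<open>T\<close>, so the weak identities on the two sides range over the same vectors.\<close>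
  have all: "(\<forall>k. k \<in> L2 M \<longrightarrow> Q k) \<longleftrightarrow> (\<forall>k. k \<in> L2 M \<longrightarrow> Q (\<lambda>x. k (T x)))" for Q
  proof (intro iffI allI impI)
    fix k assume "\<forall>k. k \<in> L2 M \<longrightarrow> Q k" "k \<in> L2 M"
    then show "Q (\<lambda>x. k (T x))" using L2T by blast
  next
    fix k assume *: "\<forall>k. k \<in> L2 M \<longrightarrow> Q (\<lambda>x. k (T x))" "k \<in> L2 M"
    then show "Q k" using *(1)[rule_format, of "\<lambda>x. k (T' x)"] scales_measure_L2[OF T', of k] by simp
  qed
  have int2: "integrable (E_dil.\<mu> (\<lambda>x. u (T x))) (\<lambda>s. (h s)\<^sup>2) \<longleftrightarrow> integrable (\<mu> u) (\<lambda>s. (h (\<rho> * s))\<^sup>2)"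
    if "u \<in> L2 M" for u
    using integral_scalar_E_dil(2)[of "\<lambda>s. (h s)\<^sup>2" u] that by simp
  have eq: "l2_inner M (\<lambda>x. g (T x)) (\<lambda>x. k (T x)) =
       ((\<integral>s. h s \<partial>E_dil.\<mu> (\<lambda>x. f (T x) + k (T x))) - (\<integral>s. h s \<partial>E_dil.\<mu> (\<lambda>x. f (T x) - k (T x)))) / 4 \<longleftrightarrow>
      l2_inner M g k = ((\<integral>s. h (\<rho> * s) \<partial>\<mu> (\<lambda>x. f x + k x)) - (\<integral>s. h (\<rho> * s) \<partial>\<mu> (\<lambda>x. f x - k x))) / 4"
    if "f \<in> L2 M" "g \<in> L2 M" "k \<in> L2 M" for k
    using K unfolding scales_measure_inner[OF T that(2,3)[THEN L2_measurable]]
      integral_scalar_E_dil(1)[OF h L2_add[OF that(1,3)]] integral_scalar_E_dil(1)[OF h L2_diff[OF that(1,3)]]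
    by (simp add: divide_simps)
  show ?thesis
    unfolding spectral_integral_iff E_dil.spectral_integral_iff L2T
    using int2 eq by (subst all) blast
qed

end

text \<open>The dilation invariance of \<open>A\<close> makes \<open>E_dil\<close> another
  resolution of \<open>A\<close>, which is then the witness for the dilated pair; homogeneity of
  \<open>h\<close> supplies the factor \<open>c\<close>.\<close>

lemma functional_calculus_dilation:
  fixes A :: "'a graph" and h :: "real \<Rightarrow> real"
  assumes T: "scales_measure M T K" and T': "scales_measure M T' K'"
    and inv: "\<And>x. T (T' x) = x" "\<And>x. T' (T x) = x" and \<rho>: "0 < \<rho>"
    and A: "\<And>f g. (f, g) \<in> A \<longleftrightarrow> (\<lambda>x. f (T x), \<lambda>x. \<rho> * g (T x)) \<in> A"
    and h: "h \<in> borel_measurable borel" "c \<noteq> 0" "\<And>s. h (\<rho> * s) = c * h s"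
    and fg: "(f, g) \<in> functional_calculus M A h"
  shows "(\<lambda>x. f (T x), \<lambda>x. c * g (T x)) \<in> functional_calculus M A h"
proof -
  obtain E where p: "projection_valued_measure M E" and AE: "A = spectral_integral M E (\<lambda>s. s)"
    and fgE: "(f, g) \<in> spectral_integral M E h"
    using fg by (auto simp: functional_calculus_def spectral_resolution_def)
  interpret pvm_dilation M E T T' K K' \<rho>
    using p T T' inv \<rho> by unfold_locales auto
  have "(u, v) \<in> A \<longleftrightarrow> (u, v) \<in> spectral_integral M E_dil (\<lambda>s. s)" for u v
  proof -
    \<comment> \<open>The invariance is read backwards: pulling back by \<open>T'\<close> divides
      the value by \<rho>, and this factor is absorbed into the integrand \<rho> s.\<close>
    have "(u, v) \<in> A \<longleftrightarrow> (\<lambda>x. u (T' x), \<lambda>x. 1 / \<rho> * v (T' x)) \<in> A"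
      using A[of "\<lambda>x. u (T' x)" "\<lambda>x. 1 / \<rho> * v (T' x)"] \<rho> inv by simp
    also have "\<dots> \<longleftrightarrow> (\<lambda>x. u (T' x), \<lambda>x. v (T' x)) \<in> spectral_integral M E (\<lambda>s. \<rho> * s)"
      using spectral_integral_cmult[of \<rho> "\<lambda>x. u (T' x)" "\<lambda>x. 1 / \<rho> * v (T' x)" "\<lambda>s. s"] \<rho>
      by (simp add: AE)
    also have "\<dots> \<longleftrightarrow> (u, v) \<in> spectral_integral M E_dil (\<lambda>s. s)"
      using spectral_integral_E_dil[of "\<lambda>s. s" "\<lambda>x. u (T' x)" "\<lambda>x. v (T' x)"] inv by simp
    finally show ?thesis .
  qed
  then have "spectral_resolution M A E_dil"
    using pvm_E_dil by (auto simp: spectral_resolution_def pvm_def)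
  moreover have "(f, \<lambda>x. c * g x) \<in> spectral_integral M E (\<lambda>s. c * h s)"
    using fgE h by (simp add: spectral_integral_cmult)
  then have "(\<lambda>x. f (T x), \<lambda>x. c * g (T x)) \<in> spectral_integral M E_dil h"
    using spectral_integral_E_dil[of h f "\<lambda>x. c * g x"] h by simp
  ultimately show ?thesis by (auto simp: functional_calculus_def)
qed

text \<open>The truncated power is homogeneous on the whole line: multiplication by a positive
  \<rho> preserves the half-line where it is set to 0.\<close>

lemma op_powr_dilation:
  assumes "scales_measure M T K" "scales_measure M T' K'"
    and "\<And>x. T (T' x) = x" "\<And>x. T' (T x) = x" and \<rho>: "0 < \<rho>"
    and "\<And>f g. (f, g) \<in> A \<longleftrightarrow> (\<lambda>x. f (T x), \<lambda>x. \<rho> * g (T x)) \<in> A"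
    and "(f, g) \<in> op_powr M A a"
  shows "(\<lambda>x. f (T x), \<lambda>x. \<rho> powr a * g (T x)) \<in> op_powr M A a"
  using assms unfolding op_powr_def
  by (elim functional_calculus_dilation) (auto simp: powr_mult zero_less_mult_iff)

lemma op_closure_dilation:
  assumes T: "scales_measure M T K" and T': "scales_measure M T' K'"
    and inv: "\<And>x. T (T' x) = x"
    and A: "\<And>f g. (f, g) \<in> A \<Longrightarrow> (\<lambda>x. f (T x), \<lambda>x. c * g (T x)) \<in> A"
    and fg: "(f, g) \<in> op_closure M A"
  shows "(\<lambda>x. f (T x), \<lambda>x. c * g (T x)) \<in> op_closure M A"
proof -
  obtain u v where f: "f \<in> L2 M" and g: "g \<in> L2 M" and uv: "\<And>k::nat. (u k, v k) \<in> A"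
    and u: "(\<lambda>k. l2_norm M (\<lambda>x. u k x - f x)) \<longlonglongrightarrow> 0" and v: "(\<lambda>k. l2_norm M (\<lambda>x. v k x - g x)) \<longlonglongrightarrow> 0"
    using fg by (auto simp: op_closure_def)
  \<comment> \<open>Members of \<open>A\<close> are arbitrary functions, so the scaling of norms
    must hold without measurability. If w^2 is not measurable, neither is its dilate, since
    \<open>T'\<close> would undo the dilation; both integrals then take the default value 0.\<close>
  have norm: "l2_norm M (\<lambda>x. w (T x)) = l2_norm M w / sqrt K" for w
  proof (cases "(\<lambda>x. w x * w x) \<in> borel_measurable M")
    case True
    then show ?thesis
      using scales_measure_integral(2)[OF T True] by (simp add: l2_norm_def l2_inner_def real_sqrt_divide)
  next
    case False
    have "(\<lambda>x. w (T x) * w (T x)) \<notin> borel_measurable M"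
      using measurable_compose[OF scales_measure_measurable[OF T'], of "\<lambda>x. w (T x) * w (T x)" borel] False inv
      by auto
    with False have "\<not> integrable M (\<lambda>x. w x * w x)" "\<not> integrable M (\<lambda>x. w (T x) * w (T x))"
      by (auto dest: borel_measurable_integrable)
    then show ?thesis by (simp add: l2_norm_def l2_inner_def not_integrable_integral_eq)
  qed
  have "(\<lambda>k. l2_norm M (\<lambda>x. u k x - f x) / sqrt K) \<longlonglongrightarrow> 0"
    using tendsto_divide[OF u tendsto_const[of "sqrt K"]] scales_measure_pos[OF T] by simp
  then have 1: "(\<lambda>k. l2_norm M (\<lambda>x. u k (T x) - f (T x))) \<longlonglongrightarrow> 0"
    by (subst norm[of "\<lambda>x. u _ x - f x"])
  have "(\<lambda>k. \<bar>c\<bar> * (l2_norm M (\<lambda>x. v k x - g x) / sqrt K)) \<longlonglongrightarrow> \<bar>c\<bar> * (0 / sqrt K)"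
    using scales_measure_pos[OF T] by (intro tendsto_intros v) simp
  moreover have "l2_norm M (\<lambda>x. c * v k (T x) - c * g (T x)) = \<bar>c\<bar> * (l2_norm M (\<lambda>x. v k x - g x) / sqrt K)" for k
  proof -
    have "l2_norm M (\<lambda>x. c * (v k (T x) - g (T x))) = \<bar>c\<bar> * l2_norm M (\<lambda>x. v k (T x) - g (T x))"
      by (simp add: l2_norm_def l2_inner_cmult_left l2_inner_cmult_right real_sqrt_mult mult.assoc[symmetric])
    then show ?thesis
      using norm[of "\<lambda>x. v k x - g x"] by (simp add: right_diff_distrib)
  qed
  ultimately have 2: "(\<lambda>k. l2_norm M (\<lambda>x. c * v k (T x) - c * g (T x))) \<longlonglongrightarrow> 0" by simp
  have "(\<lambda>x. u k (T x), \<lambda>x. c * v k (T x)) \<in> A" for k using A[OF uv] .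
  with 1 2 have "\<exists>u' v'. (\<forall>k::nat. (u' k, v' k) \<in> A) \<and>
      (\<lambda>k. l2_norm M (\<lambda>x. u' k x - f (T x))) \<longlonglongrightarrow> 0 \<and> (\<lambda>k. l2_norm M (\<lambda>x. v' k x - c * g (T x))) \<longlonglongrightarrow> 0"
    by (intro exI[of _ "\<lambda>k x. u k (T x)"] exI[of _ "\<lambda>k x. c * v k (T x)"]) simp
  then show ?thesis
    unfolding op_closure_def using scales_measure_L2[OF T f] L2_cmult[OF scales_measure_L2[OF T g]] by simp
qed

section \<open>The sub-Laplacian under dilations\<close>

lemma directional_deriv_compose_linear:
  assumes L: "bounded_linear L" and f: "f differentiable (at (L p))"
  shows "((\<lambda>q. f (L q)) has_derivative (\<lambda>v. frechet_derivative f (at (L p)) (L v))) (at p)"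
    and "directional_deriv v (\<lambda>q. f (L q)) p = directional_deriv (L v) f (L p)"
proof -
  have "(f has_derivative frechet_derivative f (at (L p))) (at (L p))"
    using f by (simp add: frechet_derivative_works)
  from diff_chain_at[OF bounded_linear_imp_has_derivative[OF L] this]
  show *: "((\<lambda>q. f (L q)) has_derivative (\<lambda>v. frechet_derivative f (at (L p)) (L v))) (at p)"
    by (simp add: o_def)
  show "directional_deriv v (\<lambda>q. f (L q)) p = directional_deriv (L v) f (L p)"
    using fun_cong[OF frechet_derivative_at[OF *], of v] by (simp add: directional_deriv_def)
qed

text \<open>The derivative of f o L along v is the derivative of f along L v, again composed with
  \<open>L\<close>; the induction closes because \<open>C_k\<close> quantifies over all
  directions.\<close>

lemma C_k_compose_linear:
  assumes L: "bounded_linear L" shows "C_k k f \<Longrightarrow> C_k k (\<lambda>q. f (L q))"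
proof (induction k arbitrary: f)
  case 0
  then show ?case
    using continuous_on_compose2[of UNIV f UNIV L] linear_continuous_on[OF L] by simp
next
  case (Suc k)
  have diff: "f differentiable (at q)" for q using Suc.prems by simp
  have "(\<lambda>q. f (L q)) differentiable (at p)" for p
    using directional_deriv_compose_linear(1)[OF L diff] unfolding differentiable_def by blast
  moreover have "directional_deriv v (\<lambda>q. f (L q)) = (\<lambda>q. directional_deriv (L v) f (L q))" for v
    using directional_deriv_compose_linear(2)[OF L diff] by auto
  ultimately show ?case using Suc by simp
qed

lemma directional_deriv_scaleR:
  assumes "f differentiable (at p)"
  shows "directional_deriv (c *\<^sub>R v) f p = c * directional_deriv v f p"
  using linear_scale[OF linear_frechet_derivative[OF assms], of c v] by (simp add: directional_deriv_def)

lemma directional_deriv_cmult: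
  assumes "f differentiable (at p)"
  shows "directional_deriv v (\<lambda>q. c * f q) p = c * directional_deriv v f p"
proof -
  have "((\<lambda>q. c * f q) has_derivative (\<lambda>v. c * frechet_derivative f (at p) v)) (at p)"
    using assms by (intro has_derivative_mult_right) (simp add: frechet_derivative_works)
  from frechet_derivative_at[OF this, symmetric] show ?thesis by (simp add: directional_deriv_def)
qed

lemma bounded_linear_heis_dilation: "bounded_linear (\<delta> r :: 'n::finite heis \<Rightarrow> 'n heis)"
  by (rule linear_conv_bounded_linear[THEN iffD1], rule linearI)
    (auto simp: heis_dilation_def algebra_simps)

lemma heis_dilation_inverse: "r \<noteq> 0 \<Longrightarrow> \<delta> r (\<delta> (1 / r) p) = p"
  by (cases p) (simp add: heis_dilation_def power2_eq_square)

lemma test_functions_dilation: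
  fixes f :: "'n::finite heis \<Rightarrow> real"
  assumes r: "r \<noteq> 0" and f: "f \<in> test_functions"
  shows "(\<lambda>q. f (\<delta> r q)) \<in> test_functions"
proof -
  obtain K where K: "compact K" "\<And>p. p \<notin> K \<Longrightarrow> f p = 0" using f by (auto simp: test_functions_def)
  have "compact (\<delta> (1 / r) ` K)"
    using K(1) by (intro compact_continuous_image linear_continuous_on bounded_linear_heis_dilation)
  moreover have "f (\<delta> r p) = 0" if "p \<notin> \<delta> (1 / r) ` K" for p
  proof (rule K(2), rule notI)
    assume "\<delta> r p \<in> K"
    then have "\<delta> (1 / r) (\<delta> r p) \<in> \<delta> (1 / r) ` K" by (rule imageI)
    then show False using that heis_dilation_inverse[of "1 / r" p] r by simp
  qed
  ultimately show ?thesis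
    using f C_k_compose_linear[OF bounded_linear_heis_dilation, of _ f r]
    unfolding test_functions_def by blast
qed

text \<open>The vertical derivative gains r^2, and one factor \<open>r\<close> turns the coefficient
  y into the coefficient r y at the dilated point. So both kinds of fields are homogeneous of degree
  1, although the dilation is not isotropic.\<close>

lemma heis_XY_dilation:
  fixes f :: "'n::finite heis \<Rightarrow> real"
  assumes f: "\<And>p. f differentiable (at p)"
  shows "heis_X i (\<lambda>q. f (\<delta> r q)) = (\<lambda>q. r * heis_X i f (\<delta> r q))"
    and "heis_Y i (\<lambda>q. f (\<delta> r q)) = (\<lambda>q. r * heis_Y i f (\<delta> r q))"
proof -
  have x: "directional_deriv (axis i 1, 0, 0) (\<lambda>q. f (\<delta> r q)) p = r * directional_deriv (axis i 1, 0, 0) f (\<delta> r p)"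
    and y: "directional_deriv (0, axis i 1, 0) (\<lambda>q. f (\<delta> r q)) p = r * directional_deriv (0, axis i 1, 0) f (\<delta> r p)"
    and z: "directional_deriv (0, 0, 1) (\<lambda>q. f (\<delta> r q)) p = r\<^sup>2 * directional_deriv (0, 0, 1) f (\<delta> r p)"
    for p :: "'n heis"
    unfolding directional_deriv_compose_linear(2)[OF bounded_linear_heis_dilation f]
      directional_deriv_scaleR[OF f, symmetric]
    by (simp_all add: heis_dilation_def)
  show "heis_X i (\<lambda>q. f (\<delta> r q)) = (\<lambda>q. r * heis_X i f (\<delta> r q))"
    "heis_Y i (\<lambda>q. f (\<delta> r q)) = (\<lambda>q. r * heis_Y i f (\<delta> r q))"
    unfolding heis_X_def heis_Y_def
    by (rule ext, case_tac q, simp only: x y z prod.case, simp add: heis_dilation_def power2_eq_square algebra_simps)+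
qed

lemma heis_XY_cmult:
  assumes f: "\<And>p. f differentiable (at p)"
  shows "heis_X i (\<lambda>q. c * f q) = (\<lambda>q. c * heis_X i f q)"
    and "heis_Y i (\<lambda>q. c * f q) = (\<lambda>q. c * heis_Y i f q)"
  unfolding heis_X_def heis_Y_def
  by (auto simp: fun_eq_iff directional_deriv_cmult[OF f] algebra_simps)

text \<open>Allows the homogeneity of the fields to be applied a second time, to X f and Y
  f.\<close>

lemma heis_XY_differentiable:
  fixes f :: "'n::finite heis \<Rightarrow> real"
  assumes f: "C_k (Suc (Suc k)) f"
  shows "heis_X i f differentiable (at p)" "heis_Y i f differentiable (at p)"
proof -
  have d: "directional_deriv v f differentiable (at p)" for v using f by (simp del: split_paired_All)
  have "bounded_linear (\<lambda>p::'n heis. fst p $ i)" "bounded_linear (\<lambda>p::'n heis. fst (snd p) $ i)"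
    by (intro bounded_linear_compose[OF bounded_linear_vec_nth] bounded_linear_fst
      bounded_linear_compose[OF bounded_linear_fst bounded_linear_snd])+
  then have c: "(\<lambda>p::'n heis. fst p $ i) differentiable (at p)" "(\<lambda>p::'n heis. fst (snd p) $ i) differentiable (at p)"
    by (auto dest: bounded_linear_imp_differentiable)
  have "heis_X i f = (\<lambda>p. directional_deriv (axis i 1, 0, 0) f p + 2 * fst (snd p) $ i * directional_deriv (0, 0, 1) f p)"
    "heis_Y i f = (\<lambda>p. directional_deriv (0, axis i 1, 0) f p - 2 * fst p $ i * directional_deriv (0, 0, 1) f p)"
    by (auto simp: heis_X_def heis_Y_def)
  then show "heis_X i f differentiable (at p)" "heis_Y i f differentiable (at p)"
    using d c by (auto intro!: differentiable_add differentiable_diff differentiable_mult)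
qed

lemma sublaplacian_dilation:
  fixes f :: "'n::finite heis \<Rightarrow> real"
  assumes f: "C_k 2 f"
  shows "sublaplacian (\<lambda>q. f (\<delta> r q)) = (\<lambda>q. r\<^sup>2 * sublaplacian f (\<delta> r q))"
proof -
  have f2: "C_k (Suc (Suc 0)) f" using f by (simp only: numeral_2_eq_2)
  have d0: "f differentiable (at p)" for p using f2 by (simp del: split_paired_All)
  note d1 = heis_XY_differentiable[OF f2]
  have comp: "(\<lambda>q. g (\<delta> r q)) differentiable (at p)" if "\<And>p. g differentiable (at p)" for g :: "'n heis \<Rightarrow> real" and p
    using directional_deriv_compose_linear(1)[OF bounded_linear_heis_dilation that] unfolding differentiable_def by blast
  show ?thesis
    unfolding sublaplacian_def heis_XY_dilation[OF d0]
      heis_XY_cmult[OF comp[OF d1(1)]] heis_XY_cmult[OF comp[OF d1(2)]]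
      heis_XY_dilation[OF d1(1)] heis_XY_dilation[OF d1(2)]
    by (simp add: fun_eq_iff sum_distrib_left power2_eq_square algebra_simps)
qed

section \<open>Lebesgue measure under dilations\<close>

lemma prod_Basis_prod:
  fixes f :: "'a::euclidean_space \<times> 'b::euclidean_space \<Rightarrow> real"
  shows "(\<Prod>j\<in>Basis. f j) = (\<Prod>i\<in>Basis. f (i, 0)) * (\<Prod>i\<in>Basis. f (0, i))"
proof -
  have "(\<Prod>j\<in>Basis. f j) = (\<Prod>j\<in>(\<lambda>u. (u, 0)) ` Basis. f j) * (\<Prod>j\<in>(\<lambda>v. (0, v)) ` Basis. f j)"
    unfolding Basis_prod_def by (rule prod.union_disjoint) auto
  then show ?thesis by (simp add: prod.reindex inj_on_def)
qed

text \<open>The dilation is diagonal: 2n horizontal coordinates contribute \<open>r\<close> each and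
  the vertical one contributes r^2, whence the exponent 2n + 2.\<close>

lemma scales_measure_heis_dilation:
  assumes r: "0 < r"
  shows "scales_measure lebesgue (\<delta> r :: 'n::finite heis \<Rightarrow> 'n heis) (r ^ (2 * CARD('n) + 2))"
proof -
  \<comment> \<open>A basis vector is horizontal exactly when its last component is 0.\<close>
  define c :: "'n heis \<Rightarrow> real" where "c j = (if snd (snd j) = 0 then r else r\<^sup>2)" for j
  have eq: "0 + (\<Sum>j\<in>Basis. (c j * (p \<bullet> j)) *\<^sub>R j) = \<delta> r p" for p
  proof (rule euclidean_eqI)
    fix b :: "'n heis" assume b: "b \<in> Basis"
    then have "c b * (p \<bullet> b) = \<delta> r p \<bullet> b"
      by (cases p) (auto simp: Basis_prod_def c_def heis_dilation_def)
    then show "(0 + (\<Sum>j\<in>Basis. (c j * (p \<bullet> j)) *\<^sub>R j)) \<bullet> b = \<delta> r p \<bullet> b"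
      using b by (simp add: inner_sum_left_Basis)
  qed
  have c: "c j \<noteq> 0" for j using r by (simp add: c_def)
  have "(\<Prod>j\<in>Basis. \<bar>c j\<bar>) = r ^ (2 * CARD('n) + 2)"
    using r by (simp add: prod_Basis_prod c_def power_add power_mult power2_eq_square mult_2)
  then show ?thesis
    using lebesgue_affine_euclidean[of c 0, OF c] lebesgue_affine_measurable[of c 0, OF c] r
    unfolding eq scales_measure_def by simp
qed

text \<open>The same diagonal map with factor 1 in time. Measurability between completed Lebesgue
  spaces is required, and it holds since no diagonal factor vanishes.\<close>

lemma measurable_dilation_time:
  assumes r: "0 < r"
  shows "(\<lambda>(t, q). (t, \<delta> r q)) \<in> (lebesgue :: (real \<times> 'n::finite heis) measure) \<rightarrow>\<^sub>M lebesgue"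
proof -
  define c :: "real \<times> 'n heis \<Rightarrow> real" where
    "c j = (if fst j \<noteq> 0 then 1 else if snd (snd (snd j)) = 0 then r else r\<^sup>2)" for j
  have eq: "0 + (\<Sum>j\<in>Basis. (c j * (p \<bullet> j)) *\<^sub>R j) = (case p of (t, q) \<Rightarrow> (t, \<delta> r q))" for p
  proof (rule euclidean_eqI)
    fix b :: "real \<times> 'n heis" assume b: "b \<in> Basis"
    then have "c b * (p \<bullet> b) = (case p of (t, q) \<Rightarrow> (t, \<delta> r q)) \<bullet> b"
      by (cases p) (auto simp: Basis_prod_def c_def heis_dilation_def)
    then show "(0 + (\<Sum>j\<in>Basis. (c j * (p \<bullet> j)) *\<^sub>R j)) \<bullet> b = (case p of (t, q) \<Rightarrow> (t, \<delta> r q)) \<bullet> b"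
      using b by (simp add: inner_sum_left_Basis)
  qed
  have c: "c j \<noteq> 0" for j using r by (simp add: c_def)
  show ?thesis using lebesgue_affine_measurable[of c 0, OF c] unfolding eq .
qed

lemma sublaplacian_op_dilation:
  fixes f g :: "'n::finite heis \<Rightarrow> real"
  assumes r: "0 < r" and fg: "(f, g) \<in> sublaplacian_op"
  shows "(\<lambda>q. f (\<delta> r q), \<lambda>q. r\<^sup>2 * g (\<delta> r q)) \<in> sublaplacian_op"
  unfolding sublaplacian_op_def
proof (rule op_closure_dilation)
  show "scales_measure lebesgue (\<delta> r :: 'n heis \<Rightarrow> 'n heis) (r ^ (2 * CARD('n) + 2))"
    "scales_measure lebesgue (\<delta> (1 / r) :: 'n heis \<Rightarrow> 'n heis) ((1 / r) ^ (2 * CARD('n) + 2))"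
    by (rule scales_measure_heis_dilation, use r in simp)+
  show "\<delta> r (\<delta> (1 / r) q) = q" for q :: "'n heis" using r by (simp add: heis_dilation_inverse)
  show "(f, g) \<in> op_closure lebesgue {(f, sublaplacian f) |f. f \<in> test_functions}"
    using fg by (simp add: sublaplacian_op_def)
  fix f g :: "'n heis \<Rightarrow> real"
  assume "(f, g) \<in> {(f, sublaplacian f) |f. f \<in> test_functions}"
  then have f: "f \<in> test_functions" and g: "g = sublaplacian f" by auto
  have "C_k 2 f" using f by (simp add: test_functions_def)
  from sublaplacian_dilation[OF this, of r] test_functions_dilation[OF _ f, of r] r
  show "(\<lambda>q. f (\<delta> r q), \<lambda>q. r\<^sup>2 * g (\<delta> r q)) \<in> {(f, sublaplacian f) |f. f \<in> test_functions}"
    unfolding g by auto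
qed

lemma neg_sublaplacian_op_dilation_iff:
  fixes f g :: "'n::finite heis \<Rightarrow> real"
  assumes r: "0 < r"
  shows "(f, g) \<in> op_uminus sublaplacian_op \<longleftrightarrow>
    (\<lambda>q. f (\<delta> r q), \<lambda>q. r\<^sup>2 * g (\<delta> r q)) \<in> op_uminus sublaplacian_op"
proof -
  have iff: "(u, v) \<in> op_uminus A \<longleftrightarrow> (u, \<lambda>x. - v x) \<in> A" for u v and A :: "'n heis graph"
    unfolding op_uminus_def by force
  have dil: "(\<lambda>q. u (\<delta> s q), \<lambda>q. s\<^sup>2 * v (\<delta> s q)) \<in> op_uminus sublaplacian_op"
    if "(u, v) \<in> op_uminus sublaplacian_op" "0 < s" for u v :: "'n heis \<Rightarrow> real" and s
    using sublaplacian_op_dilation[OF that(2)] that(1) unfolding iff by fastforce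
  show ?thesis
  proof
    assume "(\<lambda>q. f (\<delta> r q), \<lambda>q. r\<^sup>2 * g (\<delta> r q)) \<in> op_uminus sublaplacian_op"
    \<comment> \<open>The converse is the forward direction for the inverse dilation.\<close>
    from dil[OF this, of "1 / r"] r show "(f, g) \<in> op_uminus sublaplacian_op"
      by (simp add: heis_dilation_inverse power_one_over)
  qed (use dil r in blast)
qed

section \<open>Negative powers of the sub-Laplacian\<close>

lemma neg_power_graph_dilation:
  fixes f g :: "'n::finite heis \<Rightarrow> real"
  assumes r: "0 < r" and fg: "(f, g) \<in> neg_power_graph \<alpha>"
  shows "(\<lambda>q. f (\<delta> r q), \<lambda>q. r powr (- 2 * \<alpha>) * g (\<delta> r q)) \<in> neg_power_graph \<alpha>"
proof -
  have "(\<lambda>q. f (\<delta> r q), \<lambda>q. (r\<^sup>2) powr (- \<alpha>) * g (\<delta> r q)) \<in> neg_power_graph \<alpha>"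
    unfolding neg_power_graph_def
  proof (rule op_powr_dilation)
    show "scales_measure lebesgue (\<delta> r :: 'n heis \<Rightarrow> 'n heis) (r ^ (2 * CARD('n) + 2))"
      "scales_measure lebesgue (\<delta> (1 / r) :: 'n heis \<Rightarrow> 'n heis) ((1 / r) ^ (2 * CARD('n) + 2))"
      by (rule scales_measure_heis_dilation, use r in simp)+
    show "\<delta> r (\<delta> (1 / r) q) = q" for q :: "'n heis" using r by (simp add: heis_dilation_inverse)
    show "\<delta> (1 / r) (\<delta> r q) = q" for q :: "'n heis" using heis_dilation_inverse[of "1 / r" q] r by simp
    show "(f, g) \<in> op_powr lebesgue (op_uminus sublaplacian_op) (- \<alpha>)"
      using fg by (simp add: neg_power_graph_def)
  qed (use r neg_sublaplacian_op_dilation_iff[OF r] in auto)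
  moreover have "(r\<^sup>2) powr (- \<alpha>) = r powr (- 2 * \<alpha>)"
    using r powr_powr[of r 2 "- \<alpha>"] by simp
  ultimately show ?thesis by simp
qed

lemma neg_power_graph_functional:
  assumes "(f, g) \<in> neg_power_graph \<alpha>" "(f, g') \<in> neg_power_graph \<alpha>"
  shows "AE q in lebesgue. g q = g' q"
  using assms unfolding neg_power_graph_def op_powr_def
  by (rule functional_calculus_functional[rotated]) measurable

lemma neg_power_in_graph: "f \<in> sobolev_neg \<alpha> \<Longrightarrow> (f, neg_power \<alpha> f) \<in> neg_power_graph \<alpha>"
  unfolding neg_power_def sobolev_neg_def by (elim DomainE) (rule someI[of "\<lambda>g. (f, g) \<in> neg_power_graph \<alpha>"])

lemma neg_power_L2:
  assumes "f \<in> sobolev_neg \<alpha>" shows "neg_power \<alpha> f \<in> L2 lebesgue"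
  using neg_power_in_graph[OF assms]
  by (auto simp: neg_power_graph_def op_powr_def functional_calculus_def spectral_integral_def Let_def)

text \<open>The representative chosen for the dilated function and the scaled dilate of the one
  chosen for \<open>f\<close> are two values at one argument of a graph that is functional up to
  null sets.\<close>

lemma neg_power_dilation:
  fixes f :: "'n::finite heis \<Rightarrow> real"
  assumes r: "0 < r" and f: "f \<in> sobolev_neg \<alpha>"
  shows "(\<lambda>q. f (\<delta> r q)) \<in> sobolev_neg \<alpha>"
    and "AE q in lebesgue. neg_power \<alpha> (\<lambda>q. f (\<delta> r q)) q = r powr (- 2 * \<alpha>) * neg_power \<alpha> f (\<delta> r q)"
proof -
  note * = neg_power_graph_dilation[OF r neg_power_in_graph[OF f]]
  then show 1: "(\<lambda>q. f (\<delta> r q)) \<in> sobolev_neg \<alpha>" by (auto simp: sobolev_neg_def)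
  show "AE q in lebesgue. neg_power \<alpha> (\<lambda>q. f (\<delta> r q)) q = r powr (- 2 * \<alpha>) * neg_power \<alpha> f (\<delta> r q)"
    by (rule neg_power_graph_functional[OF neg_power_in_graph[OF 1] *])
qed

text \<open>Two factors r^(-2\<alpha>) come from the operators and r^(-(2n+2)) from the measure. The
  product is written as a square because the factor of the noise itself is its root.\<close>

lemma inner_neg_power_dilation:
  fixes f k :: "'n::finite heis \<Rightarrow> real"
  assumes r: "0 < r" and f: "f \<in> sobolev_neg \<alpha>" and k: "k \<in> sobolev_neg \<alpha>"
  shows "l2_inner lebesgue (neg_power \<alpha> (\<lambda>q. f (\<delta> r q))) (neg_power \<alpha> (\<lambda>q. k (\<delta> r q))) =
    (r powr (- (real CARD('n) + 1 + 2 * \<alpha>)))\<^sup>2 * l2_inner lebesgue (neg_power \<alpha> f) (neg_power \<alpha> k)"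
proof -
  let ?c = "r powr (- 2 * \<alpha>)" and ?K = "r ^ (2 * CARD('n) + 2)"
  note T = scales_measure_heis_dilation[OF r, where 'n = 'n]
  have L: "neg_power \<alpha> (\<lambda>q. u (\<delta> r q)) \<in> L2 lebesgue" "(\<lambda>q. ?c * neg_power \<alpha> u (\<delta> r q)) \<in> L2 lebesgue"
    if "u \<in> sobolev_neg \<alpha>" for u :: "'n heis \<Rightarrow> real"
    using that neg_power_L2 neg_power_dilation(1)[OF r] by (auto intro!: L2_cmult scales_measure_L2[OF T])
  have "l2_inner lebesgue (neg_power \<alpha> (\<lambda>q. f (\<delta> r q))) (neg_power \<alpha> (\<lambda>q. k (\<delta> r q))) =
      l2_inner lebesgue (\<lambda>q. ?c * neg_power \<alpha> f (\<delta> r q)) (neg_power \<alpha> (\<lambda>q. k (\<delta> r q)))"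
    using f k by (intro l2_inner_cong_AE neg_power_dilation(2) r L)
  also have "\<dots> = l2_inner lebesgue (\<lambda>q. ?c * neg_power \<alpha> k (\<delta> r q)) (\<lambda>q. ?c * neg_power \<alpha> f (\<delta> r q))"
    unfolding l2_inner_commute[of _ "\<lambda>q. ?c * neg_power \<alpha> f (\<delta> r q)"]
    using f k by (intro l2_inner_cong_AE neg_power_dilation(2) r L)
  also have "\<dots> = ?c * (?c * (l2_inner lebesgue (neg_power \<alpha> f) (neg_power \<alpha> k) / ?K))"
    using scales_measure_inner[OF T, of "neg_power \<alpha> k" "neg_power \<alpha> f"]
      L2_measurable[OF neg_power_L2[OF f]] L2_measurable[OF neg_power_L2[OF k]]
    by (simp only: l2_inner_cmult_left l2_inner_cmult_right) (simp add: l2_inner_commute)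
  also have "?c * (?c * (x / ?K)) = (r powr (- (real CARD('n) + 1 + 2 * \<alpha>)))\<^sup>2 * x" for x
  proof -
    have "?K = r powr real (2 * CARD('n) + 2)" by (rule powr_realpow[OF r, symmetric])
    also have "real (2 * CARD('n) + 2) = 2 * real CARD('n) + 2" by simp
    finally have "?K = r powr (2 * real CARD('n) + 2)" .
    then have "?c * ?c / ?K = r powr (- 2 * \<alpha> + - 2 * \<alpha> - (2 * real CARD('n) + 2))"
      by (simp only: powr_add powr_diff)
    also have "\<dots> = (r powr (- (real CARD('n) + 1 + 2 * \<alpha>)))\<^sup>2"
      unfolding power2_eq_square powr_add[symmetric] by (rule arg_cong[where f = "(powr) r"]) simp
    finally show ?thesis by (metis mult.assoc times_divide_eq_left times_divide_eq_right)
  qed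
  finally show ?thesis .
qed

section \<open>Functions of space and time and the noise covariance\<close>

text \<open>The inner integrals need not depend measurably on time, so the next two facts are stated for
  arbitrary functions.\<close>

lemma nn_integral_cmult_le:
  assumes "0 < c"
  shows "(\<integral>\<^sup>+x. ennreal c * f x \<partial>M) \<le> ennreal c * (\<integral>\<^sup>+x. f x \<partial>M)"
  unfolding nn_integral_def[of M "\<lambda>x. ennreal c * f x"]
proof (rule SUP_least, safe)
  fix g assume g: "simple_function M g" "g \<le> (\<lambda>x. ennreal c * f x)"
  \<comment> \<open>Division by \<open>c\<close> turns a simple function below c f into one below f,
    so constants are pulled out of integrals of simple functions only.\<close>
  have cc: "ennreal c * (ennreal (1 / c) * y) = y" "ennreal (1 / c) * (ennreal c * y) = y" for y
    using assms by (simp_all add: mult.assoc[symmetric] ennreal_mult[symmetric])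
  have "integral\<^sup>S M g = (\<integral>\<^sup>+x. g x \<partial>M)" using g(1) by (simp add: nn_integral_eq_simple_integral)
  also have "\<dots> = (\<integral>\<^sup>+x. ennreal c * (ennreal (1 / c) * g x) \<partial>M)" by (simp add: cc)
  also have "\<dots> = ennreal c * (\<integral>\<^sup>+x. ennreal (1 / c) * g x \<partial>M)"
    using borel_measurable_simple_function[OF g(1)] by (intro nn_integral_cmult) measurable
  also have "\<dots> \<le> ennreal c * (\<integral>\<^sup>+x. f x \<partial>M)"
  proof (intro mult_left_mono nn_integral_mono)
    fix x
    have "ennreal (1 / c) * g x \<le> ennreal (1 / c) * (ennreal c * f x)"
      using g(2) by (intro mult_left_mono) (auto simp: le_fun_def)
    then show "ennreal (1 / c) * g x \<le> f x" by (simp add: cc)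
  qed simp
  finally show "integral\<^sup>S M g \<le> ennreal c * (\<integral>\<^sup>+x. f x \<partial>M)" .
qed

lemma integral_cong_AE_lebesgue_on:
  fixes f g :: "'a::euclidean_space \<Rightarrow> real"
  assumes S: "S \<in> sets lebesgue" and ae: "AE x in lebesgue_on S. f x = g x"
  shows "(\<integral>x. f x \<partial>lebesgue_on S) = (\<integral>x. g x \<partial>lebesgue_on S)"
proof -
  let ?F = "\<lambda>x. indicator S x *\<^sub>R f x" and ?G = "\<lambda>x. indicator S x *\<^sub>R g x"
  have "AE x in lebesgue. x \<in> S \<longrightarrow> f x = g x"
    using ae S by (simp add: AE_restrict_space_iff)
  then have FG: "AE x in lebesgue. ?F x = ?G x" by eventually_elim (simp add: indicator_def)
  then have GF: "AE x in lebesgue. ?G x = ?F x" by eventually_elim auto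
  \<comment> \<open>Lebesgue measure is complete, so almost everywhere equal functions are
    measurable together; if neither is, both integrals are the default value 0.\<close>
  have "(\<integral>x. ?F x \<partial>lebesgue) = (\<integral>x. ?G x \<partial>lebesgue)"
  proof (cases "?F \<in> borel_measurable lebesgue")
    case True
    then show ?thesis using borel_measurable_AE[OF True FG] FG by (rule integral_cong_AE)
  next
    case False
    then have "?G \<notin> borel_measurable lebesgue" using borel_measurable_AE[OF _ GF] by blast
    with False have "\<not> integrable lebesgue ?F" "\<not> integrable lebesgue ?G"
      using borel_measurable_integrable by blast+
    then show ?thesis by (simp add: not_integrable_integral_eq)
  qed
  then show ?thesis using S by (simp add: integral_restrict_space)
qed

text \<open>Keeps dilated test functions in the index set, where the Gaussian and covariance
  hypotheses apply.\<close>

lemma L2_sobolev_neg_dilate: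
  fixes \<phi> :: "real \<times> 'n::finite heis \<Rightarrow> real"
  assumes r: "0 < r" and \<phi>: "\<phi> \<in> L2_sobolev_neg \<alpha>"
  shows "dilate r \<phi> \<in> L2_sobolev_neg \<alpha>"
proof -
  let ?\<kappa> = "(r powr (- (real CARD('n) + 1 + 2 * \<alpha>)))\<^sup>2"
  have sob: "AE t in lebesgue_on {0..}. (\<lambda>q. \<phi> (t, q)) \<in> sobolev_neg \<alpha>"
    and fin: "(\<integral>\<^sup>+t. ennreal ((l2_norm lebesgue (neg_power \<alpha> (\<lambda>q. \<phi> (t, q))))\<^sup>2) \<partial>lebesgue_on {0..}) < \<infinity>"
    and meas: "\<phi> \<in> borel_measurable (lebesgue_on ({0..} \<times> UNIV))"
    using \<phi> by (auto simp: L2_sobolev_neg_def)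
  have "(\<lambda>(t, q). (t, \<delta> r q)) \<in> lebesgue_on ({0..} \<times> UNIV :: (real \<times> 'n heis) set) \<rightarrow>\<^sub>M lebesgue_on ({0..} \<times> UNIV)"
    using measurable_dilation_time[OF r] by (intro measurable_restrict_space3) auto
  from measurable_compose[OF this meas] have "dilate r \<phi> \<in> borel_measurable (lebesgue_on ({0..} \<times> UNIV))"
    by (simp add: dilate_def case_prod_unfold)
  moreover have "AE t in lebesgue_on {0..}. (\<lambda>q. dilate r \<phi> (t, q)) \<in> sobolev_neg \<alpha>"
    using sob
  proof eventually_elim
    case (elim t)
    from neg_power_dilation(1)[OF r elim] show ?case by (simp add: dilate_def)
  qed
  moreover have "(\<integral>\<^sup>+t. ennreal ((l2_norm lebesgue (neg_power \<alpha> (\<lambda>q. dilate r \<phi> (t, q))))\<^sup>2) \<partial>lebesgue_on {0..}) < \<infinity>"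
  proof -
    have "(\<integral>\<^sup>+t. ennreal ((l2_norm lebesgue (neg_power \<alpha> (\<lambda>q. dilate r \<phi> (t, q))))\<^sup>2) \<partial>lebesgue_on {0..}) =
        (\<integral>\<^sup>+t. ennreal ?\<kappa> * ennreal ((l2_norm lebesgue (neg_power \<alpha> (\<lambda>q. \<phi> (t, q))))\<^sup>2) \<partial>lebesgue_on {0..})"
    proof (intro nn_integral_cong_AE, use sob in eventually_elim)
      fix t assume "(\<lambda>q. \<phi> (t, q)) \<in> sobolev_neg \<alpha>"
      from inner_neg_power_dilation[OF r this this]
      have "(l2_norm lebesgue (neg_power \<alpha> (\<lambda>q. dilate r \<phi> (t, q))))\<^sup>2 =
          ?\<kappa> * (l2_norm lebesgue (neg_power \<alpha> (\<lambda>q. \<phi> (t, q))))\<^sup>2"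
        unfolding l2_norm_square dilate_def prod.case .
      then show "ennreal ((l2_norm lebesgue (neg_power \<alpha> (\<lambda>q. dilate r \<phi> (t, q))))\<^sup>2) =
          ennreal ?\<kappa> * ennreal ((l2_norm lebesgue (neg_power \<alpha> (\<lambda>q. \<phi> (t, q))))\<^sup>2)"
        by (simp only: ennreal_mult zero_le_power2)
    qed
    also have "\<dots> \<le> ennreal ?\<kappa> * (\<integral>\<^sup>+t. ennreal ((l2_norm lebesgue (neg_power \<alpha> (\<lambda>q. \<phi> (t, q))))\<^sup>2) \<partial>lebesgue_on {0..})"
      using r by (intro nn_integral_cmult_le) simp
    also have "\<dots> < \<infinity>" using fin by (simp add: ennreal_mult_less_top)
    finally show ?thesis .
  qed
  ultimately show ?thesis by (simp add: L2_sobolev_neg_def)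
qed

lemma noise_covariance_dilate:
  fixes \<phi> \<psi> :: "real \<times> 'n::finite heis \<Rightarrow> real"
  assumes r: "0 < r" and \<phi>: "\<phi> \<in> L2_sobolev_neg \<alpha>" and \<psi>: "\<psi> \<in> L2_sobolev_neg \<alpha>"
  shows "noise_covariance \<alpha> (dilate r \<phi>) (dilate r \<psi>) =
    (r powr (- (real CARD('n) + 1 + 2 * \<alpha>)))\<^sup>2 * noise_covariance \<alpha> \<phi> \<psi>"
proof -
  let ?\<kappa> = "(r powr (- (real CARD('n) + 1 + 2 * \<alpha>)))\<^sup>2"
  have "AE t in lebesgue_on {0..}. (\<lambda>q. \<phi> (t, q)) \<in> sobolev_neg \<alpha>"
    "AE t in lebesgue_on {0..}. (\<lambda>q. \<psi> (t, q)) \<in> sobolev_neg \<alpha>"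
    using \<phi> \<psi> by (auto simp: L2_sobolev_neg_def)
  then have "AE t in lebesgue_on {0..}.
      l2_inner lebesgue (neg_power \<alpha> (\<lambda>q. dilate r \<phi> (t, q))) (neg_power \<alpha> (\<lambda>q. dilate r \<psi> (t, q))) =
      ?\<kappa> * l2_inner lebesgue (neg_power \<alpha> (\<lambda>q. \<phi> (t, q))) (neg_power \<alpha> (\<lambda>q. \<psi> (t, q)))"
  proof eventually_elim
    case (elim t)
    from inner_neg_power_dilation[OF r elim] show ?case unfolding dilate_def prod.case .
  qed
  from integral_cong_AE_lebesgue_on[OF _ this]
  have "(\<integral>t. l2_inner lebesgue (neg_power \<alpha> (\<lambda>q. dilate r \<phi> (t, q))) (neg_power \<alpha> (\<lambda>q. dilate r \<psi> (t, q)))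
        \<partial>lebesgue_on {0..}) =
      (\<integral>t. ?\<kappa> * l2_inner lebesgue (neg_power \<alpha> (\<lambda>q. \<phi> (t, q))) (neg_power \<alpha> (\<lambda>q. \<psi> (t, q))) \<partial>lebesgue_on {0..})"
    by simp
  \<comment> \<open>The constant leaves the time integral by a rule free of integrability
    conditions, so nothing has to be known about dependence on time.\<close>
  then show ?thesis
    unfolding noise_covariance_def l2_inner_def by (simp only: integral_mult_right_zero)
qed

section \<open>Laws determined by linear combinations\<close>

lemma (in prob_space) integrable_weighted_iexp:
  fixes U X :: "'a \<Rightarrow> real"
  assumes "U \<in> borel_measurable M" "X \<in> borel_measurable M" "\<And>x. \<bar>U x\<bar> \<le> B"
  shows "integrable M (\<lambda>x. complex_of_real (U x) * iexp (X x))"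
  using assms by (intro integrable_const_bound[where B = B]) (auto simp: norm_mult)

text \<open>A bounded nonnegative weight turns the law of \<open>X\<close> into a finite measure, to which the uniqueness
  theorem for characteristic functions applies after normalisation.\<close>

lemma (in prob_space) weighted_char_eq_imp:
  fixes U V X Y :: "'a \<Rightarrow> real"
  assumes [measurable]: "U \<in> borel_measurable M" "V \<in> borel_measurable M"
      "X \<in> borel_measurable M" "Y \<in> borel_measurable M"
    and U: "\<And>x. 0 \<le> U x" "\<And>x. U x \<le> B" and V: "\<And>x. 0 \<le> V x" "\<And>x. V x \<le> B"
    and eq: "\<And>t. (CLINT x|M. complex_of_real (U x) * iexp (t * X x)) = (CLINT x|M. complex_of_real (V x) * iexp (t * Y x))"
    and A[measurable]: "A \<in> sets borel"
  shows "(\<integral>x. U x * indicator A (X x) \<partial>M) = (\<integral>x. V x * indicator A (Y x) \<partial>M)"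
proof -
  define m where "m = (\<integral>x. U x \<partial>M)"
  \<comment> \<open>Frequency 0 shows that both weights have the same total mass, hence a common
    normalising constant.\<close>
  have m': "m = (\<integral>x. V x \<partial>M)" using eq[of 0] by (simp add: m_def)
  have int: "integrable M U" "integrable M V"
    using U V by (auto intro!: integrable_const_bound[where B = B])
  have m0: "0 \<le> m" unfolding m_def using U(1) by simp
  have int_zero: "(\<integral>x. W x * indicator A (Z x) \<partial>M) = 0"
    if W: "integrable M W" "\<And>x. 0 \<le> W x" "(\<integral>x. W x \<partial>M) = 0" for W Z :: "'a \<Rightarrow> real"
  proof -
    have "AE x in M. W x = 0" using W integral_nonneg_eq_0_iff_AE[OF W(1)] by simp
    then have "AE x in M. W x * indicator A (Z x) = 0" by eventually_elim simp
    then show ?thesis by (rule integral_eq_zero_AE)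
  qed
  show ?thesis
  proof (cases "m = 0")
    case True
    then show ?thesis
      using int_zero[OF int(1) U(1)] int_zero[OF int(2) V(1)] m' by (simp add: m_def)
  next
    case False
    then have m: "0 < m" using m0 by simp
    define N where "N W Z = distr (density M (\<lambda>x. ennreal (W x / m))) borel Z" for W Z :: "'a \<Rightarrow> real"
    have N: "real_distribution (N W Z)" "char (N W Z) t = (CLINT x|M. complex_of_real (W x) * iexp (t * Z x)) / m"
      "measure (N W Z) A = (\<integral>x. W x * indicator A (Z x) \<partial>M) / m"
      if [measurable]: "W \<in> borel_measurable M" "Z \<in> borel_measurable M" and W: "integrable M W" "\<And>x. 0 \<le> W x"
        "(\<integral>x. W x \<partial>M) = m" for W Z t
    proof -
      have "emeasure (density M (\<lambda>x. ennreal (W x / m))) (space M) = (\<integral>\<^sup>+x. ennreal (W x / m) \<partial>M)"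
        by (auto simp: emeasure_density intro!: nn_integral_cong)
      also have "\<dots> = 1"
        using W m by (subst nn_integral_eq_integral) auto
      finally have p: "prob_space (density M (\<lambda>x. ennreal (W x / m)))"
        by (intro prob_spaceI) simp
      show "real_distribution (N W Z)"
        unfolding N_def by (intro prob_space.real_distribution_distr p) simp
      show "char (N W Z) t = (CLINT x|M. complex_of_real (W x) * iexp (t * Z x)) / m"
        unfolding char_def N_def using W m
        by (simp add: integral_distr integral_density scaleR_conv_of_real)
      have "measure (N W Z) A = (\<integral>x. indicator A x \<partial>N W Z)"
        by (simp add: N_def)
      also have "\<dots> = (\<integral>x. W x * indicator A (Z x) \<partial>M) / m"
        unfolding N_def
        by (subst integral_distr, simp, simp, subst integral_density) (use W m in auto)
      finally show "measure (N W Z) A = (\<integral>x. W x * indicator A (Z x) \<partial>M) / m" .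
    qed
    have "N U X = N V Y"
    proof (rule Levy_uniqueness)
      show "char (N U X) = char (N V Y)"
        using int U V m' eq by (simp add: fun_eq_iff N m_def)
    qed (use int U V m' in \<open>auto intro!: N simp: m_def\<close>)
    then show ?thesis
      using N(3)[of U X] N(3)[of V Y] int U V m' m by (simp add: m_def)
  qed
qed

text \<open>Euler's formulas express the characteristic function for a modulated weight by the
  unmodulated ones at frequencies 0, 1 and -1 of \<theta>, to which the hypothesis on linear
  combinations applies.\<close>

lemma (in prob_space) weighted_cos_sin_iexp:
  fixes X \<theta> Z :: "'a \<Rightarrow> real"
  assumes [measurable]: "X \<in> borel_measurable M" "\<theta> \<in> borel_measurable M" "Z \<in> borel_measurable M"
    and Z: "\<And>x. \<bar>Z x\<bar> \<le> 1"
  defines "G \<equiv> \<lambda>s a. CLINT x|M. complex_of_real (Z x) * iexp (s * X x + a * \<theta> x)"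
  shows "(CLINT x|M. complex_of_real (Z x * (1 + cos (\<theta> x))) * iexp (s * X x)) = G s 0 + G s 1 / 2 + G s (-1) / 2"
    and "(CLINT x|M. complex_of_real (Z x * (1 + sin (\<theta> x))) * iexp (s * X x)) = G s 0 + (G s 1 - G s (-1)) / (2 * \<i>)"
proof -
  have i: "integrable M (\<lambda>x. complex_of_real (Z x) * iexp (s * X x + a * \<theta> x))" for a
    using Z by (intro integrable_weighted_iexp[where B = 1]) auto
  have cs: "complex_of_real (cos y) = (iexp y + iexp (- y)) / 2" "complex_of_real (sin y) = (iexp y - iexp (- y)) / (2 * \<i>)" for y :: real
    by (simp_all add: cos_of_real[symmetric] sin_of_real[symmetric] cos_exp_eq sin_exp_eq)
  have e: "iexp (s * X x + 0 * \<theta> x) = iexp (s * X x)" "iexp (s * X x + 1 * \<theta> x) = iexp (s * X x) * iexp (\<theta> x)"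
    "iexp (s * X x + (-1) * \<theta> x) = iexp (s * X x) * iexp (- \<theta> x)" for x
    by (simp_all add: exp_add[symmetric] algebra_simps)
  have "(CLINT x|M. complex_of_real (Z x * (1 + cos (\<theta> x))) * iexp (s * X x)) =
      (CLINT x|M. complex_of_real (Z x) * iexp (s * X x + 0 * \<theta> x) + complex_of_real (Z x) * iexp (s * X x + 1 * \<theta> x) / 2
        + complex_of_real (Z x) * iexp (s * X x + (-1) * \<theta> x) / 2)"
    unfolding e unfolding of_real_mult of_real_add cs by (intro Bochner_Integration.integral_cong refl) (simp add: field_simps)
  also have "\<dots> = G s 0 + G s 1 / 2 + G s (-1) / 2"
    unfolding G_def using i[of 0] i[of 1] i[of "-1"] by (simp del: mult_minus_left)
  finally show "(CLINT x|M. complex_of_real (Z x * (1 + cos (\<theta> x))) * iexp (s * X x)) = G s 0 + G s 1 / 2 + G s (-1) / 2" .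
  have "(CLINT x|M. complex_of_real (Z x * (1 + sin (\<theta> x))) * iexp (s * X x)) =
      (CLINT x|M. complex_of_real (Z x) * iexp (s * X x + 0 * \<theta> x) + (complex_of_real (Z x) * iexp (s * X x + 1 * \<theta> x)
        - complex_of_real (Z x) * iexp (s * X x + (-1) * \<theta> x)) / (2 * \<i>))"
    unfolding e unfolding of_real_mult of_real_add cs by (intro Bochner_Integration.integral_cong refl) (simp add: field_simps)
  also have "\<dots> = G s 0 + (G s 1 - G s (-1)) / (2 * \<i>)"
    unfolding G_def using i[of 0] i[of 1] i[of "-1"] by (simp del: mult_minus_left)
  finally show "(CLINT x|M. complex_of_real (Z x * (1 + sin (\<theta> x))) * iexp (s * X x)) = G s 0 + (G s 1 - G s (-1)) / (2 * \<i>)" .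
qed

text \<open>The exchange of one coordinate: \<open>Z\<close> collects the indicators already
  present, \<open>X\<close> is the coordinate being converted and \<theta> the remaining linear
  combination. Since exp(i\<theta>) is not a nonnegative weight, it is recovered from the weights 1
  + cos and 1 + sin by subtracting the case of weight 1.\<close>

lemma (in prob_space) indicator_iexp_eq:
  fixes X \<theta> Z X' \<theta>' Z' :: "'a \<Rightarrow> real"
  assumes [measurable]: "X \<in> borel_measurable M" "\<theta> \<in> borel_measurable M" "Z \<in> borel_measurable M"
      "X' \<in> borel_measurable M" "\<theta>' \<in> borel_measurable M" "Z' \<in> borel_measurable M"
    and Z: "\<And>x. 0 \<le> Z x" "\<And>x. Z x \<le> 1" and Z': "\<And>x. 0 \<le> Z' x" "\<And>x. Z' x \<le> 1"
    and eq: "\<And>s a. (CLINT x|M. complex_of_real (Z x) * iexp (s * X x + a * \<theta> x)) =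
        (CLINT x|M. complex_of_real (Z' x) * iexp (s * X' x + a * \<theta>' x))"
    and A[measurable]: "A \<in> sets borel"
  shows "(CLINT x|M. complex_of_real (Z x * indicator A (X x)) * iexp (\<theta> x)) =
    (CLINT x|M. complex_of_real (Z' x * indicator A (X' x)) * iexp (\<theta>' x))"
proof -
  have absZ: "\<bar>Z x\<bar> \<le> 1" "\<bar>Z' x\<bar> \<le> 1" for x using Z[of x] Z'[of x] by auto
  have trig: "0 \<le> 1 + cos y" "1 + cos y \<le> 2" "0 \<le> 1 + sin y" "1 + sin y \<le> 2" for y :: real
    using cos_ge_minus_one[of y] cos_le_one[of y] sin_ge_minus_one[of y] sin_le_one[of y] by linarith+
  have bd: "u * v \<le> 2" if "0 \<le> u" "u \<le> 1" "0 \<le> v" "v \<le> 2" for u v :: real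
    using mult_mono[of u 1 v 2] that by simp
  have 0: "(\<integral>x. Z x * indicator A (X x) \<partial>M) = (\<integral>x. Z' x * indicator A (X' x) \<partial>M)"
    using eq[of _ 0] by (intro weighted_char_eq_imp[where B = 1]) (auto simp: Z Z')
  have 1: "(\<integral>x. Z x * (1 + cos (\<theta> x)) * indicator A (X x) \<partial>M) = (\<integral>x. Z' x * (1 + cos (\<theta>' x)) * indicator A (X' x) \<partial>M)"
  proof (rule weighted_char_eq_imp[where B = 2])
    show "(CLINT x|M. complex_of_real (Z x * (1 + cos (\<theta> x))) * iexp (t * X x)) =
        (CLINT x|M. complex_of_real (Z' x * (1 + cos (\<theta>' x))) * iexp (t * X' x))" for t
      by (simp only: weighted_cos_sin_iexp assms(1-6) absZ eq)
  qed (auto intro!: bd mult_nonneg_nonneg simp: Z Z' trig)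
  have 2: "(\<integral>x. Z x * (1 + sin (\<theta> x)) * indicator A (X x) \<partial>M) = (\<integral>x. Z' x * (1 + sin (\<theta>' x)) * indicator A (X' x) \<partial>M)"
  proof (rule weighted_char_eq_imp[where B = 2])
    show "(CLINT x|M. complex_of_real (Z x * (1 + sin (\<theta> x))) * iexp (t * X x)) =
        (CLINT x|M. complex_of_real (Z' x * (1 + sin (\<theta>' x))) * iexp (t * X' x))" for t
      by (simp only: weighted_cos_sin_iexp assms(1-6) absZ eq)
  qed (auto intro!: bd mult_nonneg_nonneg simp: Z Z' trig)
  have expand: "(CLINT x|M. complex_of_real (W x * indicator A (V x)) * iexp (\<eta> x)) =
      complex_of_real ((\<integral>x. W x * (1 + cos (\<eta> x)) * indicator A (V x) \<partial>M) - (\<integral>x. W x * indicator A (V x) \<partial>M)) +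
      \<i> * complex_of_real ((\<integral>x. W x * (1 + sin (\<eta> x)) * indicator A (V x) \<partial>M) - (\<integral>x. W x * indicator A (V x) \<partial>M))"
    if [measurable]: "W \<in> borel_measurable M" "V \<in> borel_measurable M" "\<eta> \<in> borel_measurable M" and W: "\<And>x. \<bar>W x\<bar> \<le> 1"
    for W V \<eta> :: "'a \<Rightarrow> real"
  proof -
    have ind: "\<bar>indicator A y :: real\<bar> \<le> 1" for y by (simp add: indicator_def)
    have wi: "\<bar>W x * indicator A (V x)\<bar> \<le> 1" for x
      using mult_mono[OF W[of x] ind[of "V x"]] by (simp add: abs_mult)
    have i0: "integrable M (\<lambda>x. W x * indicator A (V x))"
      by (rule integrable_const_bound[where B = 1]) (use wi in auto)
    have mm: "\<bar>W x * indicator A (V x) * u\<bar> \<le> 1" if "\<bar>u\<bar> \<le> 1" for x u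
      using mult_mono[OF wi[of x] that] by (simp add: abs_mult)
    have ic: "integrable M (\<lambda>x. W x * indicator A (V x) * cos (\<eta> x))"
    proof (rule integrable_const_bound[where B = 1])
      show "AE x in M. norm (W x * indicator A (V x) * cos (\<eta> x)) \<le> 1"
        by (rule AE_I2, unfold real_norm_def, rule mm, simp)
    qed measurable
    have isn: "integrable M (\<lambda>x. W x * indicator A (V x) * sin (\<eta> x))"
    proof (rule integrable_const_bound[where B = 1])
      show "AE x in M. norm (W x * indicator A (V x) * sin (\<eta> x)) \<le> 1"
        by (rule AE_I2, unfold real_norm_def, rule mm, simp)
    qed measurable
    have c: "(\<integral>x. W x * (1 + cos (\<eta> x)) * indicator A (V x) \<partial>M) =
        (\<integral>x. W x * indicator A (V x) \<partial>M) + (\<integral>x. W x * indicator A (V x) * cos (\<eta> x) \<partial>M)"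
      using i0 ic by (subst Bochner_Integration.integral_add[symmetric]) (auto simp: algebra_simps)
    have s: "(\<integral>x. W x * (1 + sin (\<eta> x)) * indicator A (V x) \<partial>M) =
        (\<integral>x. W x * indicator A (V x) \<partial>M) + (\<integral>x. W x * indicator A (V x) * sin (\<eta> x) \<partial>M)"
      using i0 isn by (subst Bochner_Integration.integral_add[symmetric]) (auto simp: algebra_simps)
    have "(CLINT x|M. complex_of_real (W x * indicator A (V x)) * iexp (\<eta> x)) =
        (CLINT x|M. complex_of_real (W x * indicator A (V x) * cos (\<eta> x)) + \<i> * complex_of_real (W x * indicator A (V x) * sin (\<eta> x)))"
      by (intro Bochner_Integration.integral_cong refl)
        (simp add: exp_Euler cos_of_real sin_of_real algebra_simps)
    also have "\<dots> = complex_of_real (\<integral>x. W x * indicator A (V x) * cos (\<eta> x) \<partial>M)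
        + \<i> * complex_of_real (\<integral>x. W x * indicator A (V x) * sin (\<eta> x) \<partial>M)"
    proof (subst Bochner_Integration.integral_add)
      show "integrable M (\<lambda>x. complex_of_real (W x * indicator A (V x) * cos (\<eta> x)))"
        by (rule integrable_of_real[OF ic])
      show "integrable M (\<lambda>x. \<i> * complex_of_real (W x * indicator A (V x) * sin (\<eta> x)))"
        by (intro integrable_mult_right integrable_of_real[OF isn])
    qed (simp only: integral_mult_right_zero integral_complex_of_real)
    finally show ?thesis unfolding c s by simp
  qed
  show ?thesis
    using absZ by (subst (1 2) expand) (simp_all only: assms(1-6) 0 1 2)
qed

text \<open>\<open>K\<close> is the set of coordinates already converted to indicators: the empty
  set is the hypothesis on characteristic functions, and K = J is equality of the joint laws on
  boxes.\<close>

lemma (in prob_space) joint_indicator_iexp_eq: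
  fixes X Y :: "'i \<Rightarrow> 'a \<Rightarrow> real"
  assumes J: "finite J" and X[measurable]: "\<And>i. i \<in> J \<Longrightarrow> X i \<in> borel_measurable M"
    and Y[measurable]: "\<And>i. i \<in> J \<Longrightarrow> Y i \<in> borel_measurable M"
    and eq: "\<And>c. (CLINT x|M. iexp (\<Sum>i\<in>J. c i * X i x)) = (CLINT x|M. iexp (\<Sum>i\<in>J. c i * Y i x))"
    and A[measurable]: "\<And>i. A i \<in> sets borel"
    and K: "K \<subseteq> J"
  shows "(CLINT x|M. complex_of_real (\<Prod>i\<in>K. indicator (A i) (X i x)) * iexp (\<Sum>i\<in>J-K. c i * X i x)) =
    (CLINT x|M. complex_of_real (\<Prod>i\<in>K. indicator (A i) (Y i x)) * iexp (\<Sum>i\<in>J-K. c i * Y i x))"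
proof -
  have "finite K" using K J by (rule finite_subset)
  then show ?thesis
    using K
  proof (induction K arbitrary: c)
    case empty
    then show ?case using eq by simp
  next
    case (insert k K)
    let ?Z = "\<lambda>W x. \<Prod>i\<in>K. indicator (A i) (W i x) :: real"
    let ?\<theta> = "\<lambda>W x. \<Sum>i\<in>J - insert k K. c i * W i x"
    have k: "k \<in> J" "K \<subseteq> J" "k \<notin> K" using insert by auto
    have sub: "J - K = insert k (J - insert k K)" using k by auto
    \<comment> \<open>The exchange needs all frequencies s of the new coordinate and all multiples a
      of the rest; these are further coefficient families, which is why \<open>c\<close> is
      arbitrary in the induction.\<close>
    have sum: "(\<Sum>i\<in>J-K. (if i = k then s else a * c i) * W i x) = s * W k x + a * ?\<theta> W x" for s a W x
      unfolding sub using J by (subst sum.insert) (auto simp: sum_distrib_left mult.assoc intro!: sum.cong)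
    have prod: "(\<Prod>i\<in>insert k K. indicator (A i) (W i x)) = ?Z W x * indicator (A k) (W k x)" for W x
      using insert by (simp add: mult.commute)
    have [measurable]: "X k \<in> borel_measurable M" "Y k \<in> borel_measurable M" using k X Y by auto
    have [measurable]: "X i \<in> borel_measurable M" "Y i \<in> borel_measurable M" if "i \<in> K" for i using that k X Y by auto
    have [measurable]: "X i \<in> borel_measurable M" "Y i \<in> borel_measurable M" if "i \<in> J - insert k K" for i
      using that k X Y by auto
    show ?case
      unfolding prod
    proof (rule indicator_iexp_eq)
      show "(CLINT x|M. complex_of_real (?Z X x) * iexp (s * X k x + a * ?\<theta> X x)) =
          (CLINT x|M. complex_of_real (?Z Y x) * iexp (s * Y k x + a * ?\<theta> Y x))" for s a
        using insert.IH[OF k(2), of "\<lambda>i. if i = k then s else a * c i"] unfolding sum .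
    qed (auto intro!: prod_nonneg prod_le_1 borel_measurable_prod borel_measurable_sum simp: indicator_def)
  qed
qed

text \<open>Cylinders over finite boxes determine a finite measure on the product space, and their
  probabilities are expectations of products of indicators, which linear combinations
  determine.\<close>

lemma equal_in_lawI:
  fixes X Y :: "'i \<Rightarrow> 'w \<Rightarrow> real"
  assumes "prob_space P"
    and X[measurable]: "\<And>i. i \<in> I \<Longrightarrow> X i \<in> borel_measurable P"
    and Y[measurable]: "\<And>i. i \<in> I \<Longrightarrow> Y i \<in> borel_measurable P"
    and eq: "\<And>J c. finite J \<Longrightarrow> J \<subseteq> I \<Longrightarrow>
      distr P borel (\<lambda>\<omega>. \<Sum>i\<in>J. c i * X i \<omega>) = distr P borel (\<lambda>\<omega>. \<Sum>i\<in>J. c i * Y i \<omega>)"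
  shows "equal_in_law P I X Y"
  unfolding equal_in_law_def
proof (intro conjI ballI)
  interpret prob_space P by fact
  have restr: "(\<lambda>\<omega>. \<lambda>i\<in>I. Z i \<omega>) \<in> P \<rightarrow>\<^sub>M Pi\<^sub>M I (\<lambda>_. borel)"
    if "\<And>i. i \<in> I \<Longrightarrow> Z i \<in> borel_measurable P" for Z :: "'i \<Rightarrow> 'w \<Rightarrow> real"
    using that by (rule measurable_restrict)
  show "distr P (Pi\<^sub>M I (\<lambda>_. borel)) (\<lambda>\<omega>. \<lambda>i\<in>I. X i \<omega>) = distr P (Pi\<^sub>M I (\<lambda>_. borel)) (\<lambda>\<omega>. \<lambda>i\<in>I. Y i \<omega>)"
    (is "?DX = ?DY")
  proof (rule measure_eqI_PiM_infinite[where M = "\<lambda>_. borel" and I = I])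
    show "finite_measure ?DX" by (intro prob_space.finite_measure prob_space_distr restr X)
    fix A :: "'i \<Rightarrow> real set" and J
    assume J: "finite J" "J \<subseteq> I" and A: "\<And>i. i \<in> J \<Longrightarrow> A i \<in> sets borel"
    \<comment> \<open>\<open>A\<close> is measurable on \<open>J\<close> only; extending it by
      \<open>UNIV\<close> gives a family of Borel sets indexed by the whole type.\<close>
    define B where "B i = (if i \<in> J then A i else UNIV)" for i
    have B: "B i \<in> sets borel" for i using A by (simp add: B_def)
    have em: "emeasure (distr P (Pi\<^sub>M I (\<lambda>_. borel)) (\<lambda>\<omega>. \<lambda>i\<in>I. Z i \<omega>)) (prod_emb I (\<lambda>_. borel) J (Pi\<^sub>E J A)) =
        ennreal (\<integral>\<omega>. (\<Prod>i\<in>J. indicator (B i) (Z i \<omega>)) \<partial>P)"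
      if Z: "\<And>i. i \<in> I \<Longrightarrow> Z i \<in> borel_measurable P" for Z :: "'i \<Rightarrow> 'w \<Rightarrow> real"
    proof -
      let ?S = "{\<omega> \<in> space P. \<forall>i\<in>J. Z i \<omega> \<in> A i}"
      have Zm: "Z i -` A i \<inter> space P \<in> sets P" if "i \<in> J" for i
        using that Z A J by (intro measurable_sets[of _ P borel]) auto
      have S: "?S \<in> sets P"
      proof -
        have "?S = (\<Inter>i\<in>J. Z i -` A i \<inter> space P)" if "J \<noteq> {}" using that by auto
        then show ?thesis
          using J Zm by (cases "J = {}") (auto intro!: sets.finite_INT simp del: INT_simps)
      qed
      have "emeasure (distr P (Pi\<^sub>M I (\<lambda>_. borel)) (\<lambda>\<omega>. \<lambda>i\<in>I. Z i \<omega>)) (prod_emb I (\<lambda>_. borel) J (Pi\<^sub>E J A)) =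
          emeasure P ((\<lambda>\<omega>. \<lambda>i\<in>I. Z i \<omega>) -` prod_emb I (\<lambda>_. borel) J (Pi\<^sub>E J A) \<inter> space P)"
        using J A by (intro emeasure_distr restr Z sets_PiM_I) auto
      also have "(\<lambda>\<omega>. \<lambda>i\<in>I. Z i \<omega>) -` prod_emb I (\<lambda>_. borel) J (Pi\<^sub>E J A) \<inter> space P = ?S"
      proof -
        have JI: "i \<in> I" if "i \<in> J" for i using that J by auto
        then show ?thesis by (auto simp: prod_emb_def PiE_iff extensional_def cong: ball_cong)
      qed
      also have "emeasure P ?S = ennreal (\<integral>\<omega>. indicator ?S \<omega> \<partial>P)"
        using S by (simp add: emeasure_eq_measure)
      also have "(\<integral>\<omega>. indicator ?S \<omega> \<partial>P) = (\<integral>\<omega>. (\<Prod>i\<in>J. indicator (B i) (Z i \<omega>)) \<partial>P :: real)"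
      proof (rule Bochner_Integration.integral_cong[OF refl])
        fix \<omega> assume "\<omega> \<in> space P"
        then show "indicator ?S \<omega> = (\<Prod>i\<in>J. indicator (B i) (Z i \<omega>) :: real)"
          using J(1) by (auto simp: indicator_def B_def prod_zero_iff)
      qed
      finally show ?thesis .
    qed
    have XJ: "X i \<in> borel_measurable P" and YJ: "Y i \<in> borel_measurable P" if "i \<in> J" for i using that J X Y by auto
    have "(CLINT x|P. iexp (\<Sum>i\<in>J. c i * X i x)) = (CLINT x|P. iexp (\<Sum>i\<in>J. c i * Y i x))" for c
    proof -
      have "(CLINT x|P. iexp (\<Sum>i\<in>J. c i * Z i x)) = (CLINT y|distr P borel (\<lambda>x. \<Sum>i\<in>J. c i * Z i x). iexp y)"
        if "\<And>i. i \<in> J \<Longrightarrow> Z i \<in> borel_measurable P" for Z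
        using that by (subst integral_distr) auto
      then show ?thesis using eq[OF J, of c] XJ YJ by simp
    qed
    from joint_indicator_iexp_eq[OF J(1) XJ YJ this B order_refl]
    have "(\<integral>\<omega>. (\<Prod>i\<in>J. indicator (B i) (X i \<omega>)) \<partial>P :: real) = (\<integral>\<omega>. (\<Prod>i\<in>J. indicator (B i) (Y i \<omega>)) \<partial>P)"
      by (simp del: of_real_prod)
    then show "emeasure ?DX (prod_emb I (\<lambda>_. borel) J (Pi\<^sub>E J A)) = emeasure ?DY (prod_emb I (\<lambda>_. borel) J (Pi\<^sub>E J A))"
      using em[OF X] em[OF Y] by simp
  qed simp_all
qed (use X Y in auto)

section \<open>Centered Gaussian laws and their variances\<close>

lemma (in prob_space) normal_second_moment:
  assumes \<sigma>: "0 < \<sigma>" and D: "distributed M lborel X (normal_density 0 \<sigma>)"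
  shows "integrable M (\<lambda>x. (X x)\<^sup>2)" "expectation (\<lambda>x. (X x)\<^sup>2) = \<sigma>\<^sup>2"
proof -
  show "integrable M (\<lambda>x. (X x)\<^sup>2)"
    using distributed_integrable[OF D, of "\<lambda>x. x\<^sup>2"] integrable_normal_moment[OF \<sigma>, of 0 2]
    by (simp add: normal_density_nonneg)
  show "expectation (\<lambda>x. (X x)\<^sup>2) = \<sigma>\<^sup>2"
    using normal_distributed_variance[OF \<sigma> D] normal_distributed_expectation[OF \<sigma> D] by simp
qed

lemma centered_gaussian_square_integrable:
  assumes "prob_space P" "centered_gaussian P X"
  shows "integrable P (\<lambda>\<omega>. (X \<omega>)\<^sup>2)"
proof -
  interpret prob_space P by fact
  have [measurable]: "X \<in> borel_measurable P" using assms(2) by (simp add: centered_gaussian_def)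
  from assms(2) consider "AE \<omega> in P. X \<omega> = 0" | \<sigma> where "0 < \<sigma>" "distributed P lborel X (normal_density 0 \<sigma>)"
    by (auto simp: centered_gaussian_def)
  then show ?thesis
  proof cases
    case 1
    then have "AE \<omega> in P. (X \<omega>)\<^sup>2 = 0" by eventually_elim simp
    then show ?thesis by (subst integrable_cong_AE[where g = "\<lambda>_. 0"]) auto
  qed (rule normal_second_moment)
qed

text \<open>The law is a function of the second moment alone. The point mass at 0 is needed for
  variance 0, where no density exists.\<close>

lemma centered_gaussian_distr_eq:
  assumes "prob_space P" and X: "centered_gaussian P X" and Y: "centered_gaussian P Y"
    and var: "prob_space.expectation P (\<lambda>\<omega>. (X \<omega>)\<^sup>2) = prob_space.expectation P (\<lambda>\<omega>. (Y \<omega>)\<^sup>2)"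
  shows "distr P borel X = distr P borel Y"
proof -
  interpret prob_space P by fact
  define D where "D v = (if v = 0 then return borel 0 else density lborel (normal_density 0 (sqrt v)))" for v :: real
  have "distr P borel Z = D (expectation (\<lambda>\<omega>. (Z \<omega>)\<^sup>2))" if Z: "centered_gaussian P Z" for Z
  proof -
    have [measurable]: "Z \<in> borel_measurable P" using Z by (simp add: centered_gaussian_def)
    from Z consider "AE \<omega> in P. Z \<omega> = 0" | \<sigma> where "0 < \<sigma>" "distributed P lborel Z (normal_density 0 \<sigma>)"
      by (auto simp: centered_gaussian_def)
    then show ?thesis
    proof cases
      case 1
      then have "AE \<omega> in P. (Z \<omega>)\<^sup>2 = 0" by eventually_elim simp
      then have "expectation (\<lambda>\<omega>. (Z \<omega>)\<^sup>2) = 0" by (rule integral_eq_zero_AE)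
      moreover have "distr P borel Z = distr P borel (\<lambda>_. 0)"
        using 1 by (intro distr_cong_AE) auto
      moreover have "distr P borel (\<lambda>_. 0::real) = return borel 0"
        by (rule distr_const) simp
      ultimately show ?thesis by (simp add: D_def)
    next
      case 2
      have "distr P borel Z = distr P lborel Z" by (rule distr_cong) auto
      also have "\<dots> = density lborel (normal_density 0 \<sigma>)" by (rule distributed_distr_eq_density[OF 2(2)])
      finally show ?thesis using normal_second_moment(2)[OF 2] 2(1) by (simp add: D_def)
    qed
  qed
  then show ?thesis using X Y var by simp
qed

text \<open>On a probability space and for centered variables this is the variance of a linear
  combination, so covariances determine it.\<close>

lemma l2_inner_sum_sum:
  assumes "\<And>i. i \<in> J \<Longrightarrow> f i \<in> L2 M"
  shows "l2_inner M (\<lambda>x. \<Sum>i\<in>J. a i * f i x) (\<lambda>x. \<Sum>i\<in>J. a i * f i x) =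
    (\<Sum>i\<in>J. \<Sum>j\<in>J. a i * a j * l2_inner M (f i) (f j))"
proof -
  let ?S = "\<lambda>x. \<Sum>i\<in>J. a i * f i x"
  have L: "(\<lambda>x. a i * f i x) \<in> L2 M" if "i \<in> J" for i using assms[OF that] by (rule L2_cmult)
  then have S: "?S \<in> L2 M" by (rule L2_sum)
  have "l2_inner M ?S ?S = (\<Sum>i\<in>J. l2_inner M (\<lambda>x. a i * f i x) ?S)"
    by (rule l2_inner_sum_left[OF L S])
  also have "\<dots> = (\<Sum>i\<in>J. \<Sum>j\<in>J. a i * a j * l2_inner M (f i) (f j))"
  proof (rule sum.cong[OF refl])
    fix i assume i: "i \<in> J"
    have "l2_inner M ?S (\<lambda>x. a i * f i x) = (\<Sum>j\<in>J. l2_inner M (\<lambda>x. a j * f j x) (\<lambda>x. a i * f i x))"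
      by (rule l2_inner_sum_left[OF L L[OF i]])
    then show "l2_inner M (\<lambda>x. a i * f i x) ?S = (\<Sum>j\<in>J. a i * a j * l2_inner M (f i) (f j))"
      by (simp add: l2_inner_commute[of M _ ?S] l2_inner_cmult_left l2_inner_cmult_right
          l2_inner_commute[of M "f i"] mult_ac)
  qed
  finally show ?thesis .
qed

section \<open>Scaling of the Gaussian family\<close>

lemma dilate_inverse: "r \<noteq> 0 \<Longrightarrow> dilate (1 / r) (dilate r \<phi>) = \<phi>"
  by (auto simp: dilate_def heis_dilation_inverse fun_eq_iff)

theorem proposition3p4:
  fixes \<alpha> r :: real
    and P :: "'w measure"
    and W :: "(real \<times> 'n::finite heis \<Rightarrow> real) \<Rightarrow> 'w \<Rightarrow> real"
  assumes "0 < \<alpha>" and "\<alpha> < (real CARD('n) + 1) / 2"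
    and "prob_space P"
    and "centered_gaussian_family P (L2_sobolev_neg \<alpha>) W"
    and "\<And>\<phi> \<psi>. \<phi> \<in> L2_sobolev_neg \<alpha> \<Longrightarrow> \<psi> \<in> L2_sobolev_neg \<alpha> \<Longrightarrow>
           prob_space.expectation P (\<lambda>\<omega>. W \<phi> \<omega> * W \<psi> \<omega>) = noise_covariance \<alpha> \<phi> \<psi>"
    and "r > 0"
  shows "equal_in_law P (L2_sobolev_neg \<alpha>)
           (\<lambda>\<phi>. W (dilate r \<phi>))
           (\<lambda>\<phi> \<omega>. r powr (- (real CARD('n) + 1 + 2 * \<alpha>)) * W \<phi> \<omega>)"
proof -
  note gauss = assms(4) and cov = assms(5) and r = assms(6)
  let ?I = "L2_sobolev_neg \<alpha> :: (real \<times> 'n heis \<Rightarrow> real) set"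
  define \<kappa> where "\<kappa> = r powr (- (real CARD('n) + 1 + 2 * \<alpha>))"
  interpret prob_space P by fact
  have dil: "dilate r \<phi> \<in> ?I" if "\<phi> \<in> ?I" for \<phi> using r that by (rule L2_sobolev_neg_dilate)
  have W: "W \<phi> \<in> L2 P" if "\<phi> \<in> ?I" for \<phi>
  proof -
    \<comment> \<open>Singletons with coefficient 1 give the individual variables, hence their
      square integrability.\<close>
    have "centered_gaussian P (\<lambda>\<omega>. \<Sum>i\<in>{\<phi>}. 1 * W i \<omega>)"
      using gauss that unfolding centered_gaussian_family_def
      by (elim allE[of _ "{\<phi>}"] allE[of _ "\<lambda>_. 1"]) auto
    then have "centered_gaussian P (W \<phi>)" by simp
    then show ?thesis
      using centered_gaussian_square_integrable[OF \<open>prob_space P\<close>] by (simp add: L2_def centered_gaussian_def)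
  qed
  have inner: "l2_inner P (W \<phi>) (W \<psi>) = noise_covariance \<alpha> \<phi> \<psi>" if "\<phi> \<in> ?I" "\<psi> \<in> ?I" for \<phi> \<psi>
    using cov[OF that] by (simp add: l2_inner_def)
  have "equal_in_law P ?I (\<lambda>\<phi>. W (dilate r \<phi>)) (\<lambda>\<phi> \<omega>. \<kappa> * W \<phi> \<omega>)"
  proof (rule equal_in_lawI[OF \<open>prob_space P\<close>])
    show "W (dilate r \<phi>) \<in> borel_measurable P" "(\<lambda>\<omega>. \<kappa> * W \<phi> \<omega>) \<in> borel_measurable P" if "\<phi> \<in> ?I" for \<phi>
      using L2_measurable[OF W[OF dil[OF that]]] L2_measurable[OF W[OF that]] by simp_all
    fix J c assume J: "finite J" "J \<subseteq> ?I"
    let ?X = "\<lambda>\<omega>. \<Sum>\<phi>\<in>J. c \<phi> * W (dilate r \<phi>) \<omega>" and ?Y = "\<lambda>\<omega>. \<Sum>\<phi>\<in>J. (c \<phi> * \<kappa>) * W \<phi> \<omega>"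
    \<comment> \<open>The Gaussian hypothesis concerns sums over sets of test functions, so a
      combination of dilated variables is rewritten as a sum over the image of \<open>J\<close>;
      injectivity keeps the terms apart.\<close>
    have inj: "inj_on (dilate r) J"
      using r by (intro inj_on_inverseI[where g = "dilate (1 / r)"]) (simp add: dilate_inverse)
    have "centered_gaussian P (\<lambda>\<omega>. \<Sum>\<psi>\<in>dilate r ` J. c (dilate (1 / r) \<psi>) * W \<psi> \<omega>)"
    proof (rule gauss[unfolded centered_gaussian_family_def, rule_format])
      show "finite (dilate r ` J)" "dilate r ` J \<subseteq> ?I" using J dil by auto
    qed
    then have X: "centered_gaussian P ?X"
      using r by (simp add: sum.reindex[OF inj] dilate_inverse)
    have Y: "centered_gaussian P ?Y"
      by (rule gauss[unfolded centered_gaussian_family_def, rule_format, OF J])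
    have "l2_inner P ?X ?X = (\<Sum>i\<in>J. \<Sum>j\<in>J. c i * c j * l2_inner P (W (dilate r i)) (W (dilate r j)))"
      using J W dil by (intro l2_inner_sum_sum) auto
    also have "\<dots> = (\<Sum>i\<in>J. \<Sum>j\<in>J. (c i * \<kappa>) * (c j * \<kappa>) * l2_inner P (W i) (W j))"
    proof (intro sum.cong refl)
      fix i j assume "i \<in> J" "j \<in> J"
      then have ij: "i \<in> ?I" "j \<in> ?I" using J by auto
      then show "c i * c j * l2_inner P (W (dilate r i)) (W (dilate r j)) =
          (c i * \<kappa>) * (c j * \<kappa>) * l2_inner P (W i) (W j)"
        unfolding inner[OF dil[OF ij(1)] dil[OF ij(2)]] inner[OF ij]
          noise_covariance_dilate[OF r ij] \<kappa>_def[symmetric]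
        by (simp add: power2_eq_square)
    qed
    also have "\<dots> = l2_inner P ?Y ?Y"
      using J W by (intro l2_inner_sum_sum[symmetric]) auto
    \<comment> \<open>Both combinations are centered Gaussian, so equality of the second moments
      already gives equality of their laws.\<close>
    finally have "expectation (\<lambda>\<omega>. (?X \<omega>)\<^sup>2) = expectation (\<lambda>\<omega>. (?Y \<omega>)\<^sup>2)"
      by (simp add: l2_inner_def power2_eq_square)
    from centered_gaussian_distr_eq[OF \<open>prob_space P\<close> X Y this]
    show "distr P borel ?X = distr P borel (\<lambda>\<omega>. \<Sum>\<phi>\<in>J. c \<phi> * (\<kappa> * W \<phi> \<omega>))"
      by (simp add: mult.assoc)
  qed
  then show ?thesis unfolding \<kappa>_def .
qed

end
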